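(* Let $\mathcal{A}$ be a free arrangement in $V$ and $H\in\mathcal{A}$. If $\mathcal{A}^H$ is free, then $$J_{\mathcal{A}}^H=\bigcap_{X\in\Xi_3(\mathcal{A},H)}J_{\mathcal{A}_X}^H$$ and each $J_{\mathcal{A}_X}^H$ with $X\in\Xi_3(\mathcal{A},H)$ is a height two complete intersection.
   Context: Let $\mathbb{K}$ be a field, $V$ an $\ell$-dimensional $\mathbb{K}$-vector space, $x_1,\dots,x_\ell$ a basis of $V^*$ and $S=\mathrm{Sym}(V^* )=\mathbb{K}[x_1,\dots,x_\ell]$. An arrangement in $V$ is a finite set $\mathcal{A}$ of linear hyperplanes (through the origin) of $V$. For a hyperplane $H$, $\alpha_H\in V^*$ denotes a fixed defining linear form, and $Q(\mathcal{A})=\prod_{H\in\mathcal{A}}\alpha_H$. Let $\Omega_V^1=\bigoplus_i S\,dx_i$, $\Omega_V^2=\bigwedge^2\Omega_V^1$, and for $\alpha=\sum c_ix_i$ let $d\alpha=\sum c_i\,dx_i$. Define $$\Omega^1(\mathcal{A})=\{\omega\in \tfrac{1}{Q(\mathcal{A})}\Omega^1_V \mid Q(\mathcal{A})\,\omega\wedge d\alpha_L\in\alpha_L\Omega_V^2\ \text{for all } L\in\mathcal{A}\}.$$ $\mathcal{A}$ is free if $\Omega^1(\mathcal{A})$ is a free $S$-module (equivalently, if $D(\mathcal{A})=\{\theta\in\bigoplus_i S\,\partial_{x_i}\mid \theta(\alpha_L)\in(\alpha_L)\ \forall L\in\mathcal{A}\}$ is free). For $H\in\mathcal{A}$, the restriction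 is $\mathcal{A}^H=\{H\cap L\mid L\in\mathcal{A},L\ne H\}$, an arrangement in $H$ with coordinate ring $\overline S=S/(\alpha_H)=\mathrm{Sym}(H^* )$ (freeness of $\mathcal{A}^H$ is over $\overline S$); $\overline g$ is the image in $\overline S$ of $g\in S$. The residue map $\mathrm{res}^H_{\mathcal{A}}:\Omega^1(\mathcal{A})\to\overline S$ is $$\mathrm{res}^H_{\mathcal{A}}\big(f\,d\alpha_H+f_2\,d\alpha_2+\cdots+f_\ell\,d\alpha_\ell\big)=\frac{1}{Q(\mathcal{A}^H)}\,\overline{Q(\mathcal{A})f},$$ where $\alpha_H,\alpha_2,\dots,\alpha_\ell$ is any basis of $V^*$ (well defined, independent of the choice of $\alpha_2,\dots,\alpha_\ell$, with values in $\overline S$). The residue ideal $J_{\mathcal{A}}^H\subset\overline S$ is the image of $\mathrm{res}^H_{\mathcal{A}}$. $L(\mathcal{A}^H)$ is the set of all subspaces of $H$ that are intersections of hyperplanes of $\mathcal{A}^H$ (including $H$ as the empty intersection). For a subspace $X$, $\mathcal{A}_X=\{L\in\mathcal{A}\mid X\subseteq L\}$. Define $\Xi(\mathcal{A},H)=\{X\in L(\mathcal{A}^H)\mid J_{\mathcal{A}_X}^H\ne\overline S\}$ and $\Xi_3(\mathcal{A},H)=\{X\in\Xi(\mathcal{A},H)\mid\dim X=\ell-3\}$. An ideal $J\subset\overline S$ is a complete intersection if, for some $k$, it is generated by $k$ elements and $\overline S/J$ has Krull dimension $\ell-1-k$. An empty intersection of ideals of $\overline S$ is $\overline S$. *)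

theory Defs
  imports
    Complex_Main
    "HOL-Library.FuncSet"
    "HOL-Library.Poly_Mapping"
    "HOL-Library.Extended_Real"
    "HOL-Computational_Algebra.Fraction_Field"
    "HOL-Algebra.Module"
    "HOL-Algebra.QuotRing"
begin

section \<open>Krull dimension, height, complete intersections, free modules\<close>

definition prime_chain :: "('a, 'm) ring_scheme \<Rightarrow> nat \<Rightarrow> (nat \<Rightarrow> 'a set) \<Rightarrow> bool" where
  "prime_chain R n P \<longleftrightarrow> (\<forall>i\<le>n. primeideal (P i) R) \<and> (\<forall>i<n. P i \<subset> P (Suc i))"

text \<open>Values in the extended reals, so that the zero ring has dimension \<open>-\<infinity>\<close>
  and the unit ideal has height \<open>\<infinity>\<close>.\<close>

definition krull_dim :: "('a, 'm) ring_scheme \<Rightarrow> ereal" where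
  "krull_dim R = (SUP n \<in> {n. \<exists>P. prime_chain R n P}. ereal (real n))"

definition prime_height :: "('a, 'm) ring_scheme \<Rightarrow> 'a set \<Rightarrow> ereal" where
  "prime_height R \<pp> = (SUP n \<in> {n. \<exists>P. prime_chain R n P \<and> P n = \<pp>}. ereal (real n))"

definition ideal_height :: "('a, 'm) ring_scheme \<Rightarrow> 'a set \<Rightarrow> ereal" where
  "ideal_height R J = (INF \<pp> \<in> {\<pp>. primeideal \<pp> R \<and> J \<subseteq> \<pp>}. prime_height R \<pp>)"

definition free_module :: "('r, 'm) ring_scheme \<Rightarrow> ('r, 'v, 'n) module_scheme \<Rightarrow> bool" where
  "free_module R M \<longleftrightarrow>
     (\<exists>B \<subseteq> carrier M. \<forall>x \<in> carrier M.
        \<exists>!c. c \<in> B \<rightarrow>\<^sub>E carrier R \<and> finite {v \<in> B. c v \<noteq> \<zero>\<^bsub>R\<^esub>} \<and>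
             x = (\<Oplus>\<^bsub>M\<^esub>v \<in> {v \<in> B. c v \<noteq> \<zero>\<^bsub>R\<^esub>}. c v \<odot>\<^bsub>M\<^esub> v))"


section \<open>Polynomial rings\<close>

text \<open>A polynomial maps exponent vectors to coefficients. All polynomial rings
  \<open>K[x\<^sub>0, \<dots>, x\<^sub>n\<^sub>-\<^sub>1]\<close> live in the one type of polynomials in countably many variables.\<close>

type_synonym 'k mpoly = "(nat \<Rightarrow>\<^sub>0 nat) \<Rightarrow>\<^sub>0 'k"

definition const :: "'k::field \<Rightarrow> 'k mpoly" where
  "const c = Poly_Mapping.single 0 c"

definition var :: "nat \<Rightarrow> 'k::field mpoly" where
  "var i = Poly_Mapping.single (Poly_Mapping.single i 1) 1"

definition polys :: "nat \<Rightarrow> 'k::field mpoly set" where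
  "polys n = {p. \<forall>m \<in> Poly_Mapping.keys p. Poly_Mapping.keys m \<subseteq> {..<n}}"

definition poly_ring :: "nat \<Rightarrow> 'k::field mpoly ring" where
  "poly_ring n = \<lparr>carrier = polys n, monoid.mult = (*), one = 1, ring.zero = 0, add = (+)\<rparr>"

definition poly_subst :: "(nat \<Rightarrow> 'k mpoly) \<Rightarrow> 'k::field mpoly \<Rightarrow> 'k mpoly" where
  "poly_subst \<sigma> p = (\<Sum>m \<in> Poly_Mapping.keys p. const (Poly_Mapping.lookup p m) *
                        (\<Prod>i \<in> Poly_Mapping.keys m. \<sigma> i ^ Poly_Mapping.lookup m i))"

definition complete_intersection :: "nat \<Rightarrow> 'k::field mpoly set \<Rightarrow> bool" where
  "complete_intersection n J \<longleftrightarrow>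
     (\<exists>k gs. length gs = k \<and> set gs \<subseteq> polys n \<and> J = Idl\<^bsub>poly_ring n\<^esub> (set gs) \<and>
             krull_dim (poly_ring n Quot J) = ereal (real n - real k))"


section \<open>Differential forms\<close>

text \<open>Rational differential forms in \<open>n\<close> variables are given by their coefficients in the
  fraction field: \<open>\<omega> i\<close> is the coefficient of \<open>dx\<^sub>i\<close> and, for \<open>i < j\<close>, \<open>\<tau> i j\<close> is the
  coefficient of \<open>dx\<^sub>i \<and> dx\<^sub>j\<close>; all other values are 0.\<close>

type_synonym 'k form1 = "nat \<Rightarrow> 'k mpoly fract"
type_synonym 'k form2 = "nat \<Rightarrow> nat \<Rightarrow> 'k mpoly fract"

definition emb :: "'k::field mpoly \<Rightarrow> 'k mpoly fract" where
  "emb p = Fract p 1"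

definition reg_forms1 :: "nat \<Rightarrow> 'k::field form1 set" where
  "reg_forms1 n = {\<omega>. (\<forall>i<n. \<omega> i \<in> emb ` polys n) \<and> (\<forall>i\<ge>n. \<omega> i = 0)}"

definition reg_forms2 :: "nat \<Rightarrow> 'k::field form2 set" where
  "reg_forms2 n = {\<tau>. \<forall>i j. if i < j \<and> j < n then \<tau> i j \<in> emb ` polys n else \<tau> i j = 0}"

definition wedge :: "'k::field form1 \<Rightarrow> 'k form1 \<Rightarrow> 'k form2" where
  "wedge \<omega> \<eta> = (\<lambda>i j. if i < j then \<omega> i * \<eta> j - \<omega> j * \<eta> i else 0)"


section \<open>Arrangements and logarithmic forms\<close>

definition arr_restrict :: "'b set set \<Rightarrow> 'b set \<Rightarrow> 'b set set" where
  "arr_restrict A H = {H \<inter> L |L. L \<in> A \<and> L \<noteq> H}"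

definition arr_localize :: "'b set set \<Rightarrow> 'b set \<Rightarrow> 'b set set" where
  "arr_localize A X = {L \<in> A. X \<subseteq> L}"

definition flats :: "'b set \<Rightarrow> 'b set set \<Rightarrow> 'b set set" where
  "flats W A = {W \<inter> \<Inter>B |B. B \<subseteq> A}"

text \<open>A fresh locale without additional assumptions: definitions in \<open>vector_space\<close> itself would be
  propagated to the real vector space interpretations of the library, whose names then clash.\<close>

locale arr_space = vector_space scale
  for scale :: "'a::field \<Rightarrow> 'b::ab_group_add \<Rightarrow> 'b"
begin

definition ordered_basis :: "'b list \<Rightarrow> 'b set \<Rightarrow> bool" where
  "ordered_basis e W \<longleftrightarrow> distinct e \<and> independent (set e) \<and> span (set e) = W"

definition arrangement :: "'b set \<Rightarrow> 'b set set \<Rightarrow> bool" where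
  "arrangement W A \<longleftrightarrow> finite A \<and> (\<forall>L \<in> A. subspace L \<and> L \<subseteq> W \<and> dim L + 1 = dim W)"

text \<open>Linear forms on a subspace \<open>W\<close> are represented by linear forms on the ambient space,
  of which only the values on \<open>W\<close> are ever used.\<close>

definition linear_form :: "('b \<Rightarrow> 'a) \<Rightarrow> bool" where
  "linear_form \<alpha> \<longleftrightarrow> Vector_Spaces.linear scale (*) \<alpha>"

definition defining_form :: "'b set \<Rightarrow> 'b set \<Rightarrow> 'b \<Rightarrow> 'a" where
  "defining_form W L = (SOME \<alpha>. linear_form \<alpha> \<and> {w \<in> W. \<alpha> w = 0} = L)"

definition dual_basis :: "'b set \<Rightarrow> ('b \<Rightarrow> 'a) list \<Rightarrow> bool" where
  "dual_basis W as \<longleftrightarrow> (\<forall>\<alpha> \<in> set as. linear_form \<alpha>) \<and>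
     (\<forall>\<beta>. linear_form \<beta> \<longrightarrow>
        (\<exists>!c. c \<in> {..<length as} \<rightarrow>\<^sub>E UNIV \<and> (\<forall>w \<in> W. \<beta> w = (\<Sum>i<length as. c i * (as ! i) w))))"

text \<open>In the following, \<open>e\<close> is an ordered basis of the subspace \<open>span (set e)\<close>, whose symmetric
  algebra \<open>Sym((span (set e))\<^sup>*)\<close> is thereby identified with \<open>poly_ring (length e)\<close>:
  \<open>var i\<close> is the \<open>i\<close>-th element of the basis dual to \<open>e\<close>, and a linear form \<open>\<alpha>\<close> is
  \<open>\<alpha>(e\<^sub>0) x\<^sub>0 + \<alpha>(e\<^sub>1) x\<^sub>1 + \<dots>\<close>.\<close>

definition form_poly :: "'b list \<Rightarrow> ('b \<Rightarrow> 'a) \<Rightarrow> 'a mpoly" where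
  "form_poly e \<alpha> = (\<Sum>i<length e. const (\<alpha> (e ! i)) * var i)"

definition form_diff :: "'b list \<Rightarrow> ('b \<Rightarrow> 'a) \<Rightarrow> 'a form1" where
  "form_diff e \<alpha> = (\<lambda>i. if i < length e then emb (const (\<alpha> (e ! i))) else 0)"

definition arr_poly :: "'b list \<Rightarrow> 'b set set \<Rightarrow> 'a mpoly" where
  "arr_poly e A = (\<Prod>L \<in> A. form_poly e (defining_form (span (set e)) L))"

definition log_forms :: "'b list \<Rightarrow> 'b set set \<Rightarrow> 'a form1 set" where
  "log_forms e A =
     {\<omega>. \<omega> \<in> (\<lambda>\<eta> i. \<eta> i / emb (arr_poly e A)) ` reg_forms1 (length e) \<and>
         (\<forall>L \<in> A. wedge (\<lambda>i. emb (arr_poly e A) * \<omega> i) (form_diff e (defining_form (span (set e)) L))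
            \<in> (\<lambda>\<tau> i j. emb (form_poly e (defining_form (span (set e)) L)) * \<tau> i j)
                ` reg_forms2 (length e))}"

text \<open>The record type of modules extends that of rings; the fields \<open>mult\<close> and \<open>one\<close> play no role.\<close>

definition log_module :: "'b list \<Rightarrow> 'b set set \<Rightarrow> ('a mpoly, 'a form1) module" where
  "log_module e A =
     \<lparr>carrier = log_forms e A, monoid.mult = undefined, one = undefined,
      ring.zero = (\<lambda>i. 0), add = (\<lambda>\<omega> \<eta> i. \<omega> i + \<eta> i), smult = (\<lambda>p \<omega> i. emb p * \<omega> i)\<rparr>"

definition free_arrangement :: "'b list \<Rightarrow> 'b set set \<Rightarrow> bool" where
  "free_arrangement e A \<longleftrightarrow> free_module (poly_ring (length e)) (log_module e A)"


section \<open>Residues\<close>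

text \<open>For \<open>b\<close> a basis of a hyperplane \<open>H\<close>, the restriction of polynomials from \<open>V\<close> to \<open>H\<close>. It
  identifies \<open>poly_ring (length b) = Sym(H\<^sup>*)\<close> with the quotient of \<open>poly_ring (length e)\<close> by the
  ideal generated by the defining form of \<open>H\<close>.\<close>

definition poly_restrict :: "'b list \<Rightarrow> 'b list \<Rightarrow> 'a mpoly \<Rightarrow> 'a mpoly" where
  "poly_restrict e b =
     poly_subst (\<lambda>i. form_poly b (\<lambda>v. representation (set e) v (e ! i)))"

text \<open>The graph of the residue map: \<open>is_residue e b A H \<omega> r\<close> says that \<open>r\<close> is the residue
  of \<open>\<omega>\<close> along \<open>H\<close>, computed in some basis of linear forms beginning with that of \<open>H\<close>.\<close>

definition is_residue ::
  "'b list \<Rightarrow> 'b list \<Rightarrow> 'b set set \<Rightarrow> 'b set \<Rightarrow> 'a form1 \<Rightarrow> 'a mpoly \<Rightarrow> bool" where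
  "is_residue e b A H \<omega> r \<longleftrightarrow>
     (\<exists>as f g. dual_basis (span (set e)) (defining_form (span (set e)) H # as) \<and>
        \<omega> = (\<lambda>i. f 0 * form_diff e (defining_form (span (set e)) H) i
                 + (\<Sum>j<length as. f (Suc j) * form_diff e (as ! j) i)) \<and>
        g \<in> polys (length e) \<and> r \<in> polys (length b) \<and>
        emb g = emb (arr_poly e A) * f 0 \<and>
        emb r = emb (poly_restrict e b g) / emb (arr_poly b (arr_restrict A H)))"

definition residue_ideal ::
  "'b list \<Rightarrow> 'b list \<Rightarrow> 'b set set \<Rightarrow> 'b set \<Rightarrow> 'a mpoly set" where
  "residue_ideal e b A H = {r. \<exists>\<omega> \<in> log_forms e A. is_residue e b A H \<omega> r}"

definition Xi :: "'b list \<Rightarrow> 'b list \<Rightarrow> 'b set set \<Rightarrow> 'b set \<Rightarrow> 'b set set" where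
  "Xi e b A H = {X \<in> flats H (arr_restrict A H).
                   residue_ideal e b (arr_localize A X) H \<noteq> carrier (poly_ring (length b))}"

definition Xi3 :: "'b list \<Rightarrow> 'b list \<Rightarrow> 'b set set \<Rightarrow> 'b set \<Rightarrow> 'b set set" where
  "Xi3 e b A H = {X \<in> Xi e b A H. int (dim X) = int (length e) - 3}"

end

end

theory Submission
  imports Defs "HOL-Computational_Algebra.Factorial_Ring"
begin

text \<open>Regard a form as a linear map \<open>\<eta>\<close> from \<open>V\<close> to \<open>S\<close>. Restricting \<open>\<eta> / \<alpha>\<^sub>H\<close> to \<open>H\<close> turns \<open>Q(A) \<Omega>\<^sup>1(A)\<close> into
  forms \<open>\<xi>\<close> of the Ziegler multirestriction, with multiplicities \<open>m\<^sub>Y\<close>, and modulo the product \<open>\<beta>\<close> of the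
  \<open>\<alpha>\<^sub>Y ^ (m\<^sub>Y - 1)\<close> the residue is the contraction of \<open>\<xi>\<close> with the Euler derivation, divided by \<open>Q(A\<^sup>H)\<close>.
  Let \<open>J'\<close> be the ideal of all such contractions; it contains the residue ideal \<open>J\<close>.

  If \<open>A\<close> is free, then \<open>J' = J\<close>: every \<open>\<xi>\<close> lifts explicitly after multiplication by forms other than \<open>\<alpha>\<^sub>Y\<close>,
  for each \<open>Y\<close>, and since a sequence \<open>\<alpha>\<^sub>H, p, q\<close> of independent linear forms is regular on \<open>\<Omega>\<^sup>1(A)\<close>, a form
  whose multiples by \<open>p\<close> and \<open>q\<close> lift is itself liftable. If \<open>A\<^sup>H\<close> is free, then \<open>p g, q g, r g \<in> J'\<close> imply
  \<open>g \<in> J'\<close> for independent \<open>p, q, r\<close>: the syzygies are forms annihilated by the Euler derivation, and these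
  are \<open>\<beta>\<close> times elements of the free module \<open>Q(A\<^sup>H) \<Omega>\<^sup>1(A\<^sup>H)\<close>. This replaces the unmixedness of the
  Hilbert-Burch ideal \<open>J\<close>. An element of the intersection outside \<open>J\<close> has a multiple outside \<open>J\<close> which is
  killed by three independent \<open>\<alpha>\<^sub>Y\<close>, a contradiction.

  For \<open>X\<close> of codimension two in \<open>H\<close>, the multirestriction of \<open>A\<^sub>X\<close> essentially has rank two, so it has two
  homogeneous generators, whose contractions are binary forms without common linear factor.\<close>

section \<open>Polynomials and substitutions\<close>

text \<open>Each freeness hypothesis acts on a different side: freeness of A decides which forms on
  H come from V, freeness of A^H controls the relations among forms on H. \<open>J'\<close> is
  visible from both sides, being defined on H alone. The element \<beta> is, up to a scalar, the
  residue of d\<alpha>_H / \<alpha>_H; it belongs to \<open>J\<close>, and to \<open>J'\<close>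
  unless A^H is empty, so identities modulo \<beta> decide membership. That a residue is a
  contraction comes from splitting the Euler derivation at H: the part tangent to H contracts \<xi>,
  the normal part is the residue with opposite sign, and their sum is divisible by Q(A). In the
  final contradiction two of the three linear forms come from elements of \<open>J'\<close> prime to
  a given \<alpha>_Y. The third comes from the residue ideal at the flat Y1 \<inter> Y2, whose
  elements are multiplied into \<open>J\<close> by forms that do not vanish on this flat and are
  therefore independent of the first two.\<close>

abbreviation "keys \<equiv> Poly_Mapping.keys"
abbreviation "lookup \<equiv> Poly_Mapping.lookup"

lemma const_add: "const (a + b) = const a + const b" by (simp add: const_def single_add)
lemma const_0 [simp]: "const 0 = 0" by (simp add: const_def)
lemma const_1 [simp]: "const 1 = 1" by (simp add: const_def)
lemma const_mult: "const (a * b) = const a * const b" by (simp add: const_def mult_single)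
lemma const_minus: "const (- a) = - const a" by (simp add: const_def single_uminus)
lemma const_diff: "const (a - b) = const a - const b" by (simp add: const_def single_diff)
lemma const_sum: "const (\<Sum>i\<in>I. f i) = (\<Sum>i\<in>I. const (f i))"
  by (induction I rule: infinite_finite_induct) (simp_all add: const_add)
lemma const_eq_iff [simp]: "const a = const b \<longleftrightarrow> a = b"
  unfolding const_def by (metis lookup_single_eq)
lemma const_eq_0_iff [simp]: "const a = 0 \<longleftrightarrow> a = 0"
  using const_eq_iff[of a 0] by simp
lemma const_mult_inverse: "c \<noteq> 0 \<Longrightarrow> const c * const (inverse c) = 1"
  by (metis const_1 const_mult right_inverse)
lemma const_mult_dvd_iff: "c \<noteq> 0 \<Longrightarrow> const c * p dvd q \<longleftrightarrow> p dvd q"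
proof -
  assume c: "c \<noteq> 0"
  have "const c * p dvd q" if "p dvd q"
  proof -
    have "const c * p dvd const c * (const (inverse c) * q)"
      using that by (intro mult_dvd_mono) auto
    then show ?thesis using const_mult_inverse[OF c] by (simp add: mult.assoc[symmetric])
  qed
  then show ?thesis by (metis dvd_mult_right)
qed
lemma dvd_const_mult_iff: "c \<noteq> 0 \<Longrightarrow> p dvd const c * q \<longleftrightarrow> p dvd q"
proof -
  assume c: "c \<noteq> 0"
  have "p dvd q" if "p dvd const c * q"
  proof -
    have "p dvd const (inverse c) * (const c * q)" using that by (rule dvd_mult)
    also have "const (inverse c) * (const c * q) = (const c * const (inverse c)) * q"
      by (simp only: mult_ac)
    also have "\<dots> = q" by (simp add: const_mult_inverse[OF c])
    finally show ?thesis .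
  qed
  then show ?thesis by (meson dvd_mult)
qed

section \<open>Polynomials in the first n variables\<close>

lemma polys_0 [simp]: "0 \<in> polys n" by (simp add: polys_def)
lemma polys_const [simp]: "const c \<in> polys n" by (auto simp: polys_def const_def)
lemma polys_1 [simp]: "1 \<in> polys n" using polys_const[of 1] by simp
lemma polys_var: "i < n \<Longrightarrow> var i \<in> polys n" by (auto simp: polys_def var_def)
lemma polys_add [simp]: "p \<in> polys n \<Longrightarrow> q \<in> polys n \<Longrightarrow> p + q \<in> polys n"
  using keys_add[of p q] unfolding polys_def by blast
lemma polys_mult [simp]:
  assumes "p \<in> polys n" "q \<in> polys n"
  shows "p * q \<in> polys n"
  unfolding polys_def
proof (intro CollectI ballI subsetI)
  fix m i assume "m \<in> keys (p * q)" "i \<in> keys m"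
  then obtain a b where "m = a + b" "a \<in> keys p" "b \<in> keys q"
    using keys_mult[of p q] by blast
  moreover from this have "i \<in> keys a \<union> keys b"
    using \<open>i \<in> keys m\<close> keys_add[of a b] by blast
  ultimately show "i \<in> {..<n}" using assms unfolding polys_def by blast
qed
lemma polys_uminus [simp]: "p \<in> polys n \<Longrightarrow> - p \<in> polys n"
  using polys_mult[OF polys_const[of "-1"], of p n] by (simp add: const_minus)
lemma polys_diff [simp]: "p \<in> polys n \<Longrightarrow> q \<in> polys n \<Longrightarrow> p - q \<in> polys n"
  using polys_add[of p n "- q"] by simp
lemma polys_sum [simp]: "(\<And>i. i \<in> I \<Longrightarrow> f i \<in> polys n) \<Longrightarrow> sum f I \<in> polys n"
  by (induction I rule: infinite_finite_induct) simp_all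
lemma polys_prod [simp]: "(\<And>i. i \<in> I \<Longrightarrow> f i \<in> polys n) \<Longrightarrow> prod f I \<in> polys n"
  by (induction I rule: infinite_finite_induct) simp_all
lemma polys_power [simp]: "p \<in> polys n \<Longrightarrow> p ^ k \<in> polys n"
  by (induction k) simp_all

section \<open>Substitution homomorphisms\<close>

definition monom_subst :: "(nat \<Rightarrow> 'k mpoly) \<Rightarrow> (nat \<Rightarrow>\<^sub>0 nat) \<Rightarrow> 'k::field mpoly" where
  "monom_subst \<sigma> m = (\<Prod>i \<in> keys m. \<sigma> i ^ lookup m i)"

lemma monom_subst_superset:
  assumes "finite I" "keys m \<subseteq> I"
  shows "monom_subst \<sigma> m = (\<Prod>i\<in>I. \<sigma> i ^ lookup m i)"
  unfolding monom_subst_def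
  by (rule prod.mono_neutral_left) (use assms in \<open>auto simp: in_keys_iff\<close>)

lemma monom_subst_0 [simp]: "monom_subst \<sigma> 0 = 1" by (simp add: monom_subst_def)

lemma monom_subst_add: "monom_subst \<sigma> (m + m') = monom_subst \<sigma> m * monom_subst \<sigma> m'"
proof -
  let ?I = "keys m \<union> keys m'"
  have "monom_subst \<sigma> (m + m') = (\<Prod>i\<in>?I. \<sigma> i ^ lookup (m + m') i)"
    by (rule monom_subst_superset) (use keys_add[of m m'] in auto)
  also have "\<dots> = (\<Prod>i\<in>?I. \<sigma> i ^ lookup m i) * (\<Prod>i\<in>?I. \<sigma> i ^ lookup m' i)"
    by (simp add: lookup_add power_add prod.distrib)
  also have "\<dots> = monom_subst \<sigma> m * monom_subst \<sigma> m'"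
    by (simp add: monom_subst_superset[of ?I])
  finally show ?thesis .
qed

lemma poly_subst_superset:
  assumes "finite M" "keys p \<subseteq> M"
  shows "poly_subst \<sigma> p = (\<Sum>m\<in>M. const (lookup p m) * monom_subst \<sigma> m)"
  unfolding poly_subst_def monom_subst_def[symmetric]
  by (rule sum.mono_neutral_left) (use assms in \<open>auto simp: in_keys_iff\<close>)

lemma poly_subst_0 [simp]: "poly_subst \<sigma> 0 = 0" by (simp add: poly_subst_def)

lemma poly_subst_add: "poly_subst \<sigma> (p + q) = poly_subst \<sigma> p + poly_subst \<sigma> q"
proof -
  let ?M = "keys p \<union> keys q"
  have "poly_subst \<sigma> (p + q) = (\<Sum>m\<in>?M. const (lookup (p + q) m) * monom_subst \<sigma> m)"
    by (rule poly_subst_superset) (use keys_add[of p q] in auto)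
  then show ?thesis
    by (simp add: lookup_add const_add distrib_right sum.distrib poly_subst_superset[of ?M])
qed

lemma poly_subst_sum: "poly_subst \<sigma> (\<Sum>i\<in>I. f i) = (\<Sum>i\<in>I. poly_subst \<sigma> (f i))"
  by (induction I rule: infinite_finite_induct) (simp_all add: poly_subst_add)

lemma poly_subst_single: "poly_subst \<sigma> (Poly_Mapping.single m c) = const c * monom_subst \<sigma> m"
  by (subst poly_subst_superset[of "{m}"]) auto

lemma sum_single_keys: "(\<Sum>m\<in>keys p. Poly_Mapping.single m (lookup p m)) = p"
proof (rule poly_mapping_eqI)
  fix k
  have "lookup (\<Sum>m\<in>keys p. Poly_Mapping.single m (lookup p m)) k
      = (\<Sum>m\<in>keys p. if m = k then lookup p m else 0)"
    unfolding lookup_sum by (intro sum.cong) (auto simp: lookup_single when_def)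
  also have "\<dots> = lookup p k" by (simp add: in_keys_iff)
  finally show "lookup (\<Sum>m\<in>keys p. Poly_Mapping.single m (lookup p m)) k = lookup p k" .
qed

lemma poly_subst_mult: "poly_subst \<sigma> (p * q) = poly_subst \<sigma> p * poly_subst \<sigma> q"
proof -
  let ?s = "\<lambda>p m. Poly_Mapping.single m (lookup p m)"
  have "p * q = (\<Sum>m\<in>keys p. \<Sum>m'\<in>keys q. ?s p m * ?s q m')"
    by (subst (1) sum_single_keys[symmetric, of p], subst (1) sum_single_keys[symmetric, of q])
      (simp add: sum_product)
  then have "poly_subst \<sigma> (p * q) = (\<Sum>m\<in>keys p. \<Sum>m'\<in>keys q. poly_subst \<sigma> (?s p m) * poly_subst \<sigma> (?s q m'))"
    by (simp add: poly_subst_sum mult_single poly_subst_single monom_subst_add const_mult mult_ac)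
  also have "\<dots> = poly_subst \<sigma> (\<Sum>m\<in>keys p. ?s p m) * poly_subst \<sigma> (\<Sum>m'\<in>keys q. ?s q m')"
    by (simp add: poly_subst_sum sum_product)
  finally show ?thesis by (simp only: sum_single_keys)
qed

lemma poly_subst_const [simp]: "poly_subst \<sigma> (const c) = const c"
  by (simp add: const_def poly_subst_single) 

lemma poly_subst_1 [simp]: "poly_subst \<sigma> 1 = 1"
  using poly_subst_const[of \<sigma> 1] by simp

lemma poly_subst_var [simp]: "poly_subst \<sigma> (var i) = \<sigma> i"
  by (simp add: var_def poly_subst_single monom_subst_def)

lemma poly_subst_uminus: "poly_subst \<sigma> (- p) = - poly_subst \<sigma> p"
  using poly_subst_add[of \<sigma> p "- p"] by (simp add: eq_neg_iff_add_eq_0 add.commute)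
lemma poly_subst_diff: "poly_subst \<sigma> (p - q) = poly_subst \<sigma> p - poly_subst \<sigma> q"
  using poly_subst_add[of \<sigma> p "- q"] by (simp add: poly_subst_uminus)
lemma poly_subst_power: "poly_subst \<sigma> (p ^ k) = poly_subst \<sigma> p ^ k"
  by (induction k) (simp_all add: poly_subst_mult)
lemma poly_subst_prod: "poly_subst \<sigma> (\<Prod>i\<in>I. f i) = (\<Prod>i\<in>I. poly_subst \<sigma> (f i))"
  by (induction I rule: infinite_finite_induct) (simp_all add: poly_subst_mult)

lemma poly_subst_dvd: "p dvd q \<Longrightarrow> poly_subst \<sigma> p dvd poly_subst \<sigma> q"
  by (auto simp: dvd_def poly_subst_mult)

lemma monom_subst_var: "monom_subst var m = Poly_Mapping.single m 1"
proof -
  have pw: "var i ^ k = Poly_Mapping.single (Poly_Mapping.single i k) 1" for i k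
    by (induction k) (simp_all add: var_def mult_single single_add[symmetric])
  have *: "(\<Prod>i\<in>I. var i ^ f i) = Poly_Mapping.single (\<Sum>i\<in>I. Poly_Mapping.single i (f i)) 1" 
    if "finite I" for I and f :: "nat \<Rightarrow> nat"
    using that by induction (simp_all add: pw mult_single)
  show ?thesis unfolding monom_subst_def *[OF finite_keys] sum_single_keys ..
qed

lemma poly_subst_var_id: "poly_subst var p = p"
proof -
  have "poly_subst var p = (\<Sum>m\<in>keys p. Poly_Mapping.single m (lookup p m))"
    unfolding poly_subst_superset[OF finite_keys order_refl]
    by (simp add: monom_subst_var const_def mult_single)
  then show ?thesis by (simp only: sum_single_keys)
qed

lemma polys_iff: "p \<in> polys n \<longleftrightarrow> (\<forall>m\<in>keys p. \<forall>i\<in>keys m. i < n)"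
  by (auto simp: polys_def)

lemma poly_subst_in_polys:
  assumes "p \<in> polys n" "\<And>i. i < n \<Longrightarrow> \<sigma> i \<in> polys k"
  shows "poly_subst \<sigma> p \<in> polys k"
  unfolding poly_subst_def using assms by (auto simp: polys_iff[of p] intro!: polys_sum polys_mult polys_prod polys_power)

lemma poly_subst_cong:
  assumes "p \<in> polys n" "\<And>i. i < n \<Longrightarrow> \<sigma> i = \<tau> i"
  shows "poly_subst \<sigma> p = poly_subst \<tau> p"
  unfolding poly_subst_def using assms by (auto simp: polys_iff[of p] intro!: sum.cong prod.cong)

text \<open>\<open>poly_subst_var_id\<close> writes \<open>p\<close> as a finite sum of products of
  constants and variables, so closure under sums and products suffices.\<close>

lemma poly_induct [case_names const var add mult]:
  assumes "\<And>c. P (const c)" "\<And>i. P (var i)"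
    "\<And>p q. P p \<Longrightarrow> P q \<Longrightarrow> P (p + q)" "\<And>p q. P p \<Longrightarrow> P q \<Longrightarrow> P (p * q)"
  shows "P (p :: 'k::field mpoly)"
proof -
  have z: "P 0" and o: "P 1" using assms(1)[of 0] assms(1)[of 1] by simp_all
  have pw: "P (q ^ k)" if "P q" for q k using that by (induction k) (auto intro: assms o)
  have pr: "P (prod f I)" if "\<And>i. i \<in> I \<Longrightarrow> P (f i)" for f :: "nat \<Rightarrow> 'k mpoly" and I
    using that by (induction I rule: infinite_finite_induct) (auto intro: assms o)
  have sm: "P (sum f I)" if "\<And>i. i \<in> I \<Longrightarrow> P (f i)" for f :: "(nat \<Rightarrow>\<^sub>0 nat) \<Rightarrow> 'k mpoly" and I
    using that by (induction I rule: infinite_finite_induct) (auto intro: assms z)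
  have "P (poly_subst var p)"
    unfolding poly_subst_def by (intro sm assms(4) pr pw assms(1,2))
  then show ?thesis by (simp add: poly_subst_var_id)
qed

lemma poly_subst_poly_subst:
  "poly_subst \<tau> (poly_subst \<sigma> p) = poly_subst (\<lambda>i. poly_subst \<tau> (\<sigma> i)) p"
  by (induction p rule: poly_induct) (simp_all add: poly_subst_add poly_subst_mult)

text \<open>All polynomial rings share one type, so a witness found there may involve variables
  beyond \<open>n\<close>. Setting those to 0 is a ring homomorphism that retracts onto
  \<open>polys n\<close> and moves such witnesses back.\<close>

definition trunc :: "nat \<Rightarrow> 'k::field mpoly \<Rightarrow> 'k mpoly" where
  "trunc n = poly_subst (\<lambda>i. if i < n then var i else 0)"

lemma trunc_in_polys [simp]: "trunc n p \<in> polys n"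
  unfolding trunc_def
  by (induction p rule: poly_induct) (auto simp: poly_subst_add poly_subst_mult polys_var)

lemma trunc_id: "p \<in> polys n \<Longrightarrow> trunc n p = p"
proof -
  assume "p \<in> polys n"
  then have "trunc n p = poly_subst var p" unfolding trunc_def by (rule poly_subst_cong) simp
  then show ?thesis by (simp add: poly_subst_var_id)
qed

lemma trunc_add: "trunc n (p + q) = trunc n p + trunc n q"
  and trunc_mult: "trunc n (p * q) = trunc n p * trunc n q"
  by (simp_all add: trunc_def poly_subst_add poly_subst_mult)

text \<open>Truncation fixes \<open>a\<close> and the product, so the cofactor equals its own
  truncation. Divisibility in the ambient type thus gives a quotient in
  \<open>polys n\<close>.\<close>

lemma polys_divide:
  assumes "a \<in> polys n" "a \<noteq> 0" "a * g \<in> polys n"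
  shows "g \<in> polys n"
proof -
  have "a * g = trunc n (a * g)" by (simp only: trunc_id[OF assms(3)])
  also have "\<dots> = a * trunc n g" by (simp add: trunc_mult trunc_id assms(1))
  finally have "g = trunc n g" using assms(2) by simp
  then show ?thesis by (metis trunc_in_polys)
qed

lemma polys_dvdE:
  assumes "a dvd f" "a \<in> polys n" "a \<noteq> 0" "f \<in> polys n"
  obtains g where "g \<in> polys n" "f = a * g"
  using assms polys_divide by (metis dvdE)

section \<open>Divisibility by prime elements of a domain\<close>

lemma prime_elem_power_dvd_cancel:
  fixes p :: "'a::idom"
  assumes "prime_elem p" "\<not> p dvd a" "p ^ k dvd a * b"
  shows "p ^ k dvd b"
  using assms(3)
proof (induction k arbitrary: b)
  case (Suc k)
  then have "p dvd a * b" by (metis dvd_mult_left power_Suc)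
  then have "p dvd b" using assms(1,2) by (auto simp: prime_elem_def)
  then obtain b' where b': "b = p * b'" by (auto elim: dvdE)
  have "p * p ^ k dvd p * (a * b')" using Suc.prems b' by (simp add: mult_ac)
  then have "p ^ k dvd a * b'" using assms(1) by (auto simp: prime_elem_def)
  then have "p ^ k dvd b'" by (rule Suc.IH)
  then show ?case unfolding b' power_Suc by (rule mult_dvd_mono[OF dvd_refl])
qed simp

lemma prime_elem_dvd_prodD:
  fixes p :: "'a::idom"
  assumes "prime_elem p" "finite I" "p dvd prod f I"
  shows "\<exists>i\<in>I. p dvd f i"
  using assms(2,3)
proof (induction I)
  case empty
  then show ?case using assms(1) by (simp add: prime_elem_def)
next
  case (insert i I)
  then show ?case using assms(1) by (auto simp: prime_elem_def)
qed

lemma prime_elem_dvd_powerD: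
  fixes p :: "'a::idom"
  assumes "prime_elem p" "p dvd a ^ k"
  shows "p dvd a"
  using assms(2)
proof (induction k)
  case 0
  then show ?case using assms(1) by (simp add: prime_elem_def)
next
  case (Suc k)
  then show ?case using assms(1) by (auto simp: prime_elem_def)
qed

text \<open>The new \<open>p j\<close> divides none of the primes treated so far, hence not their
  product, so its power passes to the cofactor.\<close>

lemma prod_prime_powers_dvd:
  fixes p :: "'i \<Rightarrow> 'a::idom"
  assumes "finite I" "\<And>i. i \<in> I \<Longrightarrow> prime_elem (p i)"
    "\<And>i j. i \<in> I \<Longrightarrow> j \<in> I \<Longrightarrow> i \<noteq> j \<Longrightarrow> \<not> p i dvd p j"
    "\<And>i. i \<in> I \<Longrightarrow> p i ^ k i dvd f"
  shows "(\<Prod>i\<in>I. p i ^ k i) dvd f"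
  using assms
proof (induction I)
  case (insert j I)
  then have "(\<Prod>i\<in>I. p i ^ k i) dvd f" by simp
  then obtain g where g: "f = (\<Prod>i\<in>I. p i ^ k i) * g" by (auto elim: dvdE)
  have "\<not> p j dvd (\<Prod>i\<in>I. p i ^ k i)"
  proof
    assume "p j dvd (\<Prod>i\<in>I. p i ^ k i)"
    then obtain i where "i \<in> I" "p j dvd p i ^ k i"
      using prime_elem_dvd_prodD[OF insert.prems(1)[OF insertI1] insert.hyps(1)] by blast
    then have "p j dvd p i" using prime_elem_dvd_powerD insert.prems(1) by blast
    then show False using insert.prems(2) \<open>i \<in> I\<close> insert.hyps by blast
  qed
  moreover have "p j ^ k j dvd (\<Prod>i\<in>I. p i ^ k i) * g" using insert.prems(3)[of j] g by simp
  ultimately have "p j ^ k j dvd g" using prime_elem_power_dvd_cancel insert.prems(1) by blast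
  then have "p j ^ k j * (\<Prod>i\<in>I. p i ^ k i) dvd g * (\<Prod>i\<in>I. p i ^ k i)"
    by (rule mult_dvd_mono[OF _ dvd_refl])
  then show ?case using insert.hyps g by (simp add: mult.commute)
qed simp

section \<open>Chains of prime ideals\<close>

lemma poly_ring_simps [simp]:
  "carrier (poly_ring n) = polys n" "x \<otimes>\<^bsub>poly_ring n\<^esub> y = x * y"
  "x \<oplus>\<^bsub>poly_ring n\<^esub> y = x + y" "\<one>\<^bsub>poly_ring n\<^esub> = 1" "\<zero>\<^bsub>poly_ring n\<^esub> = 0"
  by (simp_all add: poly_ring_def)

lemma cring_poly_ring: "cring (poly_ring n)"
proof (rule cringI)
  show "abelian_group (poly_ring n)"
  proof (rule abelian_groupI)
    fix x assume x: "x \<in> carrier (poly_ring n)"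
    show "\<exists>y\<in>carrier (poly_ring n). y \<oplus>\<^bsub>poly_ring n\<^esub> x = \<zero>\<^bsub>poly_ring n\<^esub>"
      by (rule bexI[of _ "- x"]) (use x in auto)
  qed (auto simp: add_ac)
  show "Group.comm_monoid (poly_ring n)"
    by (rule comm_monoidI) (auto simp: mult_ac)
qed (auto simp: distrib_right)

lemma ideal_poly_ring_iff:
  "ideal J (poly_ring n) \<longleftrightarrow> J \<subseteq> polys n \<and> 0 \<in> J \<and> (\<forall>x\<in>J. \<forall>y\<in>J. x + y \<in> J) \<and>
     (\<forall>x\<in>J. \<forall>r\<in>polys n. r * x \<in> J)" (is "?l \<longleftrightarrow> ?r")
proof
  interpret cring "poly_ring n" by (rule cring_poly_ring)
  assume ?l
  then interpret ideal J "poly_ring n" .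
  show ?r
    using a_subset zero_closed a_closed I_l_closed by simp
next
  interpret cring "poly_ring n" by (rule cring_poly_ring)
  assume r: ?r
  have minus: "- x \<in> J" if "x \<in> J" for x
  proof -
    have "(- 1) * x \<in> J" using r that polys_uminus[OF polys_1] by blast
    then show ?thesis by simp
  qed
  have inv: "\<ominus>\<^bsub>poly_ring n\<^esub> x = - x" if "x \<in> polys n" for x
    using minus_equality[of "- x" x] that by simp
  show ?l
  proof (rule idealI)
    show "subgroup J (add_monoid (poly_ring n))"
    proof (rule group.subgroupI)
      show "group (add_monoid (poly_ring n))" by (rule a_group)
      fix a assume "a \<in> J"
      then show "inv\<^bsub>add_monoid (poly_ring n)\<^esub> a \<in> J"
        using r minus inv[of a] unfolding a_inv_def by auto
    qed (use r in auto)
  qed (use r ring_axioms in \<open>auto simp: mult.commute\<close>)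
qed

lemma primeideal_poly_ring_iff:
  "primeideal J (poly_ring n) \<longleftrightarrow> ideal J (poly_ring n) \<and> 1 \<notin> J \<and>
     (\<forall>x\<in>polys n. \<forall>y\<in>polys n. x * y \<in> J \<longrightarrow> x \<in> J \<or> y \<in> J)"
proof -
  have *: "polys n = J" if "ideal J (poly_ring n)" "1 \<in> J"
  proof -
    have "\<forall>x\<in>J. \<forall>r\<in>polys n. r * x \<in> J" "J \<subseteq> polys n"
      using that(1) unfolding ideal_poly_ring_iff by blast+
    then show ?thesis using that(2) by (metis mult.right_neutral subsetI subset_antisym)
  qed
  have "polys n \<noteq> J \<longleftrightarrow> 1 \<notin> J" if "ideal J (poly_ring n)" 
    using *[OF that] polys_1 by blast
  then show ?thesis
    unfolding primeideal_def primeideal_axioms_def using cring_poly_ring by auto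
qed

section \<open>Algebraic dependence by counting dimensions\<close>

lemma (in vector_space) exists_linear_relation:
  assumes "finite I" "g ` I \<subseteq> span T" "finite T" "card T < card I"
  shows "\<exists>c. (\<exists>i\<in>I. c i \<noteq> 0) \<and> (\<Sum>i\<in>I. c i *s g i) = 0"
proof (cases "inj_on g I")
  case True
  have "dependent (g ` I)"
    using independent_span_bound[OF assms(3) _ assms(2)] assms(4) card_image[OF True] by linarith
  then obtain u v where u: "(\<Sum>v\<in>g ` I. u v *s v) = 0" "v \<in> g ` I" "u v \<noteq> 0"
    using dependent_finite[of "g ` I"] assms(1) by auto
  then have "(\<Sum>i\<in>I. u (g i) *s g i) = 0" by (simp add: sum.reindex[OF True] o_def)
  then show ?thesis using u(2,3) by (intro exI[of _ "u \<circ> g"]) auto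
next
  case False
  then obtain i j where ij: "i \<in> I" "j \<in> I" "i \<noteq> j" "g i = g j" by (auto simp: inj_on_def)
  let ?c = "\<lambda>k. if k = i then 1 else if k = j then - 1 else 0"
  have "(\<Sum>k\<in>I. ?c k *s g k) = (\<Sum>k\<in>{i, j}. ?c k *s g k)"
    by (rule sum.mono_neutral_right) (use assms(1) ij in auto)
  also have "\<dots> = 0" using ij by simp
  finally show ?thesis using ij(1) by (intro exI[of _ ?c]) auto
qed

lemma vector_space_mpoly: "vector_space (\<lambda>c p. const c * (p :: 'k::field mpoly))"
  by unfold_locales (simp_all add: const_add const_mult algebra_simps)

text \<open>Degrees are bounded in each variable separately: the exponents then form a box with
  \<open>Suc d ^ n\<close> points, and products simply add the bounds.\<close>

definition bounded_polys :: "nat \<Rightarrow> nat \<Rightarrow> 'k::field mpoly set" where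
  "bounded_polys n d = {p. \<forall>m\<in>keys p. (\<forall>i. lookup m i \<le> d) \<and> keys m \<subseteq> {..<n}}"

lemma bounded_polys_mono: "p \<in> bounded_polys n d \<Longrightarrow> d \<le> d' \<Longrightarrow> p \<in> bounded_polys n d'"
  by (auto simp: bounded_polys_def intro: order_trans)

lemma bounded_polys_1: "1 \<in> bounded_polys n d" by (simp add: bounded_polys_def)

lemma bounded_polys_mult:
  assumes "p \<in> bounded_polys n d" "q \<in> bounded_polys n d'"
  shows "p * q \<in> bounded_polys n (d + d')"
  unfolding bounded_polys_def
proof (intro CollectI ballI)
  fix m assume "m \<in> keys (p * q)"
  then obtain a b where ab: "m = a + b" "a \<in> keys p" "b \<in> keys q" using keys_mult[of p q] by blast
  then have "lookup a i \<le> d" "lookup b i \<le> d'" "keys a \<subseteq> {..<n}" "keys b \<subseteq> {..<n}" for i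
    using assms unfolding bounded_polys_def by blast+
  then show "(\<forall>i. lookup m i \<le> d + d') \<and> keys m \<subseteq> {..<n}"
    unfolding ab(1) lookup_add using keys_add[of a b] by (metis Un_least add_mono order_trans)
qed

lemma bounded_polys_power: "p \<in> bounded_polys n d \<Longrightarrow> p ^ k \<in> bounded_polys n (k * d)"
  by (induction k) (auto simp: bounded_polys_1 intro: bounded_polys_mult)

lemma bounded_polys_prod:
  assumes "finite I" "\<And>i. i \<in> I \<Longrightarrow> f i \<in> bounded_polys n d"
  shows "prod f I \<in> bounded_polys n (card I * d)"
  using assms by (induction I) (auto simp: bounded_polys_1 intro: bounded_polys_mult)

lemma polys_bounded:
  assumes "p \<in> polys n" shows "\<exists>d. p \<in> bounded_polys n d"
proof -
  let ?S = "\<Union>m\<in>keys p. insert 0 (lookup m ` keys m)"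
  have "lookup m i \<le> Max (insert 0 ?S)" if "m \<in> keys p" for m i
  proof (rule Max_ge)
    have "lookup m i \<in> insert 0 (lookup m ` keys m)"
      by (cases "i \<in> keys m") (auto simp: in_keys_iff)
    then show "lookup m i \<in> insert 0 ?S" using that by blast
  qed simp
  then show ?thesis using assms by (auto simp: bounded_polys_def polys_def)
qed

lemma bounded_polys_span:
  "\<exists>T. finite T \<and> card T \<le> Suc d ^ n \<and>
     bounded_polys n d \<subseteq> module.span (\<lambda>c p. const c * p) (T :: 'k::field mpoly set)"
proof -
  interpret vs: vector_space "\<lambda>c p. const c * (p :: 'k mpoly)" by (rule vector_space_mpoly)
  define M where "M = {m :: nat \<Rightarrow>\<^sub>0 nat. (\<forall>i. lookup m i \<le> d) \<and> keys m \<subseteq> {..<n}}"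
  let ?r = "\<lambda>m. restrict (lookup m) {..<n}"
  have inj: "inj_on ?r M"
  proof (rule inj_onI, rule poly_mapping_eqI)
    fix a b i assume *: "a \<in> M" "b \<in> M" "?r a = ?r b"
    show "lookup a i = lookup b i"
    proof (cases "i < n")
      case True
      then show ?thesis using fun_cong[OF *(3), of i] by simp
    next
      case False
      then have "i \<notin> keys a" "i \<notin> keys b" using * by (auto simp: M_def)
      then show ?thesis by (simp add: in_keys_iff)
    qed
  qed
  have sub: "?r ` M \<subseteq> PiE {..<n} (\<lambda>_. {..d})"
    unfolding M_def by (intro image_subsetI) (simp add: restrict_PiE_iff)
  have fin: "finite (PiE {..<n} (\<lambda>_. {..d}) :: (nat \<Rightarrow> nat) set)" by (rule finite_PiE) auto
  have "finite M" using inj_on_finite[OF inj sub fin] .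
  have "card M \<le> card (PiE {..<n} (\<lambda>_. {..d}) :: (nat \<Rightarrow> nat) set)"
    using card_inj_on_le[OF inj sub fin] .
  also have "\<dots> = Suc d ^ n" by (simp add: card_PiE)
  finally have card: "card M \<le> Suc d ^ n" .
  let ?T = "(\<lambda>m. Poly_Mapping.single m 1) ` M :: 'k mpoly set"
  have "p \<in> vs.span ?T" if p: "p \<in> bounded_polys n d" for p
  proof -
    have "(\<Sum>m\<in>keys p. const (lookup p m) * Poly_Mapping.single m 1) \<in> vs.span ?T"
      using p by (intro vs.span_sum vs.span_scale vs.span_base) (auto simp: bounded_polys_def M_def)
    also have "(\<Sum>m\<in>keys p. const (lookup p m) * Poly_Mapping.single m 1) = p"
      by (simp add: const_def mult_single sum_single_keys)
    finally show ?thesis .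
  qed
  moreover have "card ?T \<le> Suc d ^ n" using card_image_le[OF \<open>finite M\<close>] card order_trans by blast
  ultimately show ?thesis using \<open>finite M\<close> by (intro exI[of _ ?T]) auto
qed

text \<open>The \<open>N ^ Suc n\<close> products with exponents below \<open>N\<close> lie in a
  space whose dimension grows only like \<open>N ^ n\<close>.\<close>

lemma algebraic_relation:
  fixes f :: "nat \<Rightarrow> 'k::field mpoly"
  assumes "\<And>j. j \<le> n \<Longrightarrow> f j \<in> polys n"
  shows "\<exists>F c. finite F \<and> F \<noteq> {} \<and> F \<subseteq> PiE {..n} (\<lambda>_. UNIV) \<and> (\<forall>a\<in>F. c a \<noteq> 0) \<and>
    (\<Sum>a\<in>F. const (c a) * (\<Prod>j\<le>n. f j ^ a j)) = 0"
proof -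
  interpret vs: vector_space "\<lambda>c p. const c * (p :: 'k mpoly)" by (rule vector_space_mpoly)
  have "\<forall>j\<in>{..n}. \<exists>d. f j \<in> bounded_polys n d" using assms polys_bounded by blast
  then obtain d where d: "\<And>j. j \<le> n \<Longrightarrow> f j \<in> bounded_polys n (d j)"
    unfolding bchoice_iff by auto
  define D where "D = Max (d ` {..n})"
  have D: "f j \<in> bounded_polys n D" if "j \<le> n" for j
    by (rule bounded_polys_mono[OF d[OF that]]) (use that in \<open>auto simp: D_def\<close>)
  \<comment> \<open>One more than the factor that remains of the dimension bound once
    \<open>N ^ n\<close> is split off, which makes the comparison with \<open>card I\<close>
    strict.\<close>
  define N where "N = Suc (Suc (Suc n * D) ^ n)"
  define I where "I = PiE {..n} (\<lambda>_. {..<N})"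
  define g where "g = (\<lambda>a. \<Prod>j\<le>n. f j ^ a j)"
  have fin: "finite I" unfolding I_def by (rule finite_PiE) auto
  have cardI: "card I = N ^ Suc n" unfolding I_def by (simp add: card_PiE)
  have g: "g a \<in> bounded_polys n (Suc n * (N * D))" if "a \<in> I" for a
  proof -
    have "f j ^ a j \<in> bounded_polys n (N * D)" if "j \<in> {..n}" for j
    proof (rule bounded_polys_mono)
      show "f j ^ a j \<in> bounded_polys n (a j * D)" using that D by (intro bounded_polys_power) auto
      have "a j < N" using \<open>a \<in> I\<close> that by (auto simp: I_def)
      then show "a j * D \<le> N * D" by simp
    qed
    then have "g a \<in> bounded_polys n (card {..n} * (N * D))"
      unfolding g_def by (intro bounded_polys_prod) auto
    then show ?thesis by simp
  qed
  obtain T :: "'k mpoly set" where T: "finite T" "card T \<le> Suc (Suc n * (N * D)) ^ n"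
      "bounded_polys n (Suc n * (N * D)) \<subseteq> vs.span T"
    using bounded_polys_span by blast
  have "Suc (Suc n * (N * D)) \<le> N * Suc (Suc n * D)"
    by (simp add: N_def algebra_simps)
  then have "Suc (Suc n * (N * D)) ^ n \<le> (N * Suc (Suc n * D)) ^ n" by (rule power_mono) simp
  also have "\<dots> = N ^ n * Suc (Suc n * D) ^ n" by (rule power_mult_distrib)
  also have "\<dots> < N ^ n * N" by (rule mult_strict_left_mono) (simp_all add: N_def)
  also have "\<dots> = card I" by (simp add: cardI)
  finally have "card T < card I" using T(2) by linarith
  then obtain c where c: "\<exists>i\<in>I. c i \<noteq> 0" "(\<Sum>i\<in>I. const (c i) * g i) = 0"
    using vs.exists_linear_relation[OF fin _ T(1), of g] g T(3) by blast
  define F where "F = {a \<in> I. c a \<noteq> 0}"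
  have "(\<Sum>a\<in>F. const (c a) * g a) = (\<Sum>i\<in>I. const (c i) * g i)"
    by (rule sum.mono_neutral_left) (use fin in \<open>auto simp: F_def\<close>)
  then show ?thesis using c fin unfolding g_def
    by (intro exI[of _ F] exI[of _ c]) (auto simp: F_def I_def)
qed

lemma prime_power_mem:
  assumes "primeideal P (poly_ring n)" "x \<in> polys n" "y \<in> polys n" "x ^ k * y \<in> P" "x \<notin> P"
  shows "y \<in> P"
  using assms(4)
proof (induction k)
  case (Suc k)
  have "x * (x ^ k * y) \<in> P" using Suc.prems by (simp add: mult.assoc)
  then have "x ^ k * y \<in> P" using assms unfolding primeideal_poly_ring_iff by (meson polys_mult polys_power)
  then show ?case by (rule Suc.IH)
qed simp

text \<open>An algebraic relation between elements \<open>f\<^sub>i \<in> P\<^sub>i\<^sub>+\<^sub>1 - P\<^sub>i\<close> loses one variable at each step of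
  the chain, until a nonzero constant is left in the last prime.\<close>

lemma prime_chain_le:
  assumes "prime_chain (poly_ring n :: 'k::field mpoly ring) k P"
  shows "k \<le> n"
proof (rule ccontr)
  assume "\<not> k \<le> n"
  then have pr: "primeideal (P i) (poly_ring n)" if "i \<le> Suc n" for i
    using assms that by (simp add: prime_chain_def)
  have "\<forall>i\<in>{..n}. \<exists>x. x \<in> P (Suc i) - P i"
  proof
    fix i assume "i \<in> {..n}"
    then have "P i \<subset> P (Suc i)" using assms \<open>\<not> k \<le> n\<close> unfolding prime_chain_def by simp
    then show "\<exists>x. x \<in> P (Suc i) - P i" by blast
  qed
  then obtain f where f: "\<And>i. i \<le> n \<Longrightarrow> f i \<in> P (Suc i)" "\<And>i. i \<le> n \<Longrightarrow> f i \<notin> P i"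
    unfolding bchoice_iff by auto
  have id: "ideal (P i) (poly_ring n)" if "i \<le> Suc n" for i
    using pr[OF that] unfolding primeideal_poly_ring_iff by blast
  note idl = id[unfolded ideal_poly_ring_iff]
  have fp: "f i \<in> polys n" if "i \<le> n" for i using f(1)[OF that] idl[of "Suc i"] that by auto
  obtain F and c :: "(nat \<Rightarrow> nat) \<Rightarrow> 'k" where F: "finite F" "F \<noteq> {}" "F \<subseteq> PiE {..n} (\<lambda>_. UNIV)"
      "\<forall>a\<in>F. c a \<noteq> 0" "(\<Sum>a\<in>F. const (c a) * (\<Prod>j\<le>n. f j ^ a j)) = 0"
    using algebraic_relation[of n f] fp by blast
  let ?t = "\<lambda>i a. const (c a) * (\<Prod>j\<in>{i..n}. f j ^ a j)"
  have tp: "?t i a \<in> polys n" for i a using fp by (intro polys_mult polys_prod polys_power) auto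
  \<comment> \<open>\<open>G\<close> is what survives of the relation: its exponent vectors agree in
    the entries \<open>j < i\<close>, and the powers of these \<open>f j\<close> have been cancelled
    from its terms.\<close>
  have "\<exists>G\<subseteq>F. G \<noteq> {} \<and> (\<forall>a\<in>G. \<forall>a'\<in>G. \<forall>j<i. a j = a' j) \<and> (\<Sum>a\<in>G. ?t i a) \<in> P i"
    if "i \<le> Suc n" for i
    using that
  proof (induction i)
    case 0
    have "(\<Sum>a\<in>F. ?t 0 a) \<in> P 0" using F(5) idl[of 0] by (simp add: atMost_atLeast0)
    then show ?case using F(2) by blast
  next
    case (Suc i)
    then obtain G where G: "G \<subseteq> F" "G \<noteq> {}" "\<forall>a\<in>G. \<forall>a'\<in>G. \<forall>j<i. a j = a' j"
        "(\<Sum>a\<in>G. ?t i a) \<in> P i" by auto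
    have i: "i \<le> n" using Suc.prems by simp
    have finG: "finite G" using G(1) F(1) finite_subset by blast
    define e where "e = Min ((\<lambda>a. a i) ` G)"
    define G' where "G' = {a \<in> G. a i = e}"
    have e: "e \<le> a i" if "a \<in> G" for a using that finG by (auto simp: e_def)
    have "e \<in> (\<lambda>a. a i) ` G" unfolding e_def using finG G(2) by (intro Min_in) auto
    then have "G' \<noteq> {}" by (auto simp: G'_def)
    have split: "?t i a = f i ^ a i * ?t (Suc i) a" for a
    proof -
      have "{i..n} = insert i {Suc i..n}" using i by auto
      then show ?thesis by (simp add: mult_ac)
    qed
    let ?A = "\<Sum>a\<in>G'. ?t (Suc i) a" and ?B = "\<Sum>a\<in>G - G'. f i ^ (a i - Suc e) * ?t (Suc i) a"
    have "(\<Sum>a\<in>G. ?t i a) = (\<Sum>a\<in>G'. ?t i a) + (\<Sum>a\<in>G - G'. ?t i a)"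
      by (subst sum.subset_diff[of G' G]) (use finG in \<open>auto simp: G'_def add.commute\<close>)
    also have "(\<Sum>a\<in>G'. ?t i a) = f i ^ e * ?A"
      unfolding sum_distrib_left by (intro sum.cong refl) (simp only: split, simp add: G'_def)
    also have "(\<Sum>a\<in>G - G'. ?t i a) = f i ^ e * (f i * ?B)"
      unfolding sum_distrib_left
    proof (intro sum.cong refl)
      fix a assume "a \<in> G - G'"
      then have "a i = e + Suc (a i - Suc e)" using e[of a] by (auto simp: G'_def)
      then have "f i ^ a i = f i ^ e * (f i * f i ^ (a i - Suc e))"
        by (metis power_add power_Suc)
      then show "?t i a = f i ^ e * (f i * (f i ^ (a i - Suc e) * ?t (Suc i) a))"
        unfolding split[of a] by (simp only: mult.assoc)
    qed
    finally have eq: "(\<Sum>a\<in>G. ?t i a) = f i ^ e * (?A + f i * ?B)" by (simp only: distrib_left)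
    have A: "?A \<in> polys n" by (intro polys_sum tp)
    have B: "?B \<in> polys n" by (intro polys_sum polys_mult[OF polys_power[OF fp[OF i]] tp])
    have "?A + f i * ?B \<in> P i"
      by (rule prime_power_mem[OF pr, of _ "f i" _ e])
        (use i fp[OF i] A B G(4) eq f(2)[OF i] in auto)
    moreover have "P i \<subset> P (Suc i)" using assms i \<open>\<not> k \<le> n\<close> unfolding prime_chain_def by simp
    ultimately have 1: "?A + f i * ?B \<in> P (Suc i)" by blast
    have 2: "(- ?B) * f i \<in> P (Suc i)"
      using idl[OF Suc.prems] f(1)[OF i] B polys_uminus by blast
    have "(?A + f i * ?B) + (- ?B) * f i \<in> P (Suc i)"
      using idl[OF Suc.prems] 1 2 by blast
    also have "(?A + f i * ?B) + (- ?B) * f i = ?A" by (simp add: mult.commute)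
    finally have "?A \<in> P (Suc i)" .
    moreover have "\<forall>a\<in>G'. \<forall>a'\<in>G'. \<forall>j<Suc i. a j = a' j"
      using G(3) by (auto simp: G'_def less_Suc_eq)
    ultimately show ?case using G(1) \<open>G' \<noteq> {}\<close> by (intro exI[of _ G']) (auto simp: G'_def)
  qed
  from this[of "Suc n"] obtain G where G: "G \<subseteq> F" "G \<noteq> {}"
      "\<forall>a\<in>G. \<forall>a'\<in>G. \<forall>j<Suc n. a j = a' j" "(\<Sum>a\<in>G. ?t (Suc n) a) \<in> P (Suc n)" by auto
  obtain a where a: "a \<in> G" using G(2) by blast
  \<comment> \<open>The exponent vectors now agree in all entries, so a single term remains, and its
    product over \<open>{Suc n..n}\<close> is empty.\<close>
  have "G = {a}"
  proof -
    have "a' = a" if "a' \<in> G" for a'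
    proof (rule PiE_ext)
      show "a' \<in> PiE {..n} (\<lambda>_. UNIV)" "a \<in> PiE {..n} (\<lambda>_. UNIV)" using that a G(1) F(3) by blast+
    qed (use G(3) a that in auto)
    then show ?thesis using a by blast
  qed
  then have "const (c a) \<in> P (Suc n)" using G(4) by simp
  moreover have "const (inverse (c a)) * const (c a) = 1"
    using const_mult_inverse[of "c a"] F(4) G(1) a by (simp add: mult.commute subset_iff)
  ultimately have "1 \<in> P (Suc n)" using idl[of "Suc n"] by (metis order_refl polys_const)
  then show False using pr[of "Suc n"] unfolding primeideal_poly_ring_iff by blast
qed

section \<open>Primes of quotients, height and dimension\<close>

lemma prime_quotient_image:
  assumes J: "ideal J (poly_ring n)" and Q: "primeideal Q (poly_ring n)" "J \<subseteq> Q"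
  shows "primeideal ((+>\<^bsub>poly_ring n\<^esub>) J ` Q) (poly_ring n Quot J)"
    and "x \<in> polys n \<Longrightarrow> J +>\<^bsub>poly_ring n\<^esub> x \<in> (+>\<^bsub>poly_ring n\<^esub>) J ` Q \<Longrightarrow> x \<in> Q"
proof -
  let ?R = "poly_ring n"
  interpret cring ?R by (rule cring_poly_ring)
  interpret J: ideal J ?R by (rule J)
  have Qid: "ideal Q ?R" using Q(1) unfolding primeideal_poly_ring_iff by blast
  note Qid' = Qid[unfolded ideal_poly_ring_iff]
  \<comment> \<open>\<open>Q\<close> contains \<open>J\<close>, so it is a union of cosets and
    membership can be tested in the quotient.\<close>
  have mem: "x \<in> Q" if x: "x \<in> polys n" and xm: "J +>\<^bsub>?R\<^esub> x \<in> (+>\<^bsub>?R\<^esub>) J ` Q" for x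
  proof -
    obtain q where q: "q \<in> Q" "J +>\<^bsub>?R\<^esub> x = J +>\<^bsub>?R\<^esub> q" using xm by blast
    have "x \<in> J +>\<^bsub>?R\<^esub> q" using J.a_rcos_self[of x] x q(2) by simp
    then obtain j where "j \<in> J" "x = j + q" by (auto simp: a_r_coset_def')
    then show ?thesis using Qid' q(1) Q(2) by blast
  qed
  show "x \<in> polys n \<Longrightarrow> J +>\<^bsub>?R\<^esub> x \<in> (+>\<^bsub>?R\<^esub>) J ` Q \<Longrightarrow> x \<in> Q" by (rule mem)
  have carr: "\<exists>x\<in>polys n. a = J +>\<^bsub>?R\<^esub> x" if "a \<in> carrier (?R Quot J)" for a
    using that by (auto simp: FactRing_def A_RCOSETS_def')
  show "primeideal ((+>\<^bsub>?R\<^esub>) J ` Q) (?R Quot J)"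
  proof (rule primeidealI)
    show "ideal ((+>\<^bsub>?R\<^esub>) J ` Q) (?R Quot J)" by (rule ring_ideal_imp_quot_ideal[OF J Qid])
    show "cring (?R Quot J)" by (rule J.quotient_is_cring[OF is_cring])
    show "carrier (?R Quot J) \<noteq> (+>\<^bsub>?R\<^esub>) J ` Q"
    proof
      assume eq: "carrier (?R Quot J) = (+>\<^bsub>?R\<^esub>) J ` Q"
      have "J +>\<^bsub>?R\<^esub> 1 \<in> carrier (?R Quot J)" by (auto simp: FactRing_def A_RCOSETS_def')
      then have "1 \<in> Q" using mem[of 1] eq by simp
      then show False using Q(1) unfolding primeideal_poly_ring_iff by blast
    qed
    fix a b assume a: "a \<in> carrier (?R Quot J)" and b: "b \<in> carrier (?R Quot J)"
      and ab: "a \<otimes>\<^bsub>?R Quot J\<^esub> b \<in> (+>\<^bsub>?R\<^esub>) J ` Q"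
    obtain x y where xy: "x \<in> polys n" "y \<in> polys n" "a = J +>\<^bsub>?R\<^esub> x" "b = J +>\<^bsub>?R\<^esub> y"
      using carr a b by blast
    have "J +>\<^bsub>?R\<^esub> (x * y) \<in> (+>\<^bsub>?R\<^esub>) J ` Q"
      using ab J.rcoset_mult_add[of x y] xy by (simp add: FactRing_def)
    then have "x * y \<in> Q" using mem xy by simp
    then have "x \<in> Q \<or> y \<in> Q" using Q(1) xy unfolding primeideal_poly_ring_iff by blast
    then show "a \<in> (+>\<^bsub>?R\<^esub>) J ` Q \<or> b \<in> (+>\<^bsub>?R\<^esub>) J ` Q" using xy by blast
  qed
qed

lemma prime_chain_append:
  assumes "prime_chain R k P" "prime_chain R m P'" "P k = P' 0"
  shows "prime_chain R (k + m) (\<lambda>i. if i \<le> k then P i else P' (i - k))"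
  unfolding prime_chain_def
proof (intro conjI allI impI)
  fix i assume "i \<le> k + m"
  then show "primeideal (if i \<le> k then P i else P' (i - k)) R"
    using assms unfolding prime_chain_def by auto
next
  fix i assume i: "i < k + m"
  consider "i < k" | "i = k" | "k < i" by linarith
  then show "(if i \<le> k then P i else P' (i - k)) \<subset> (if Suc i \<le> k then P (Suc i) else P' (Suc i - k))"
  proof cases
    case 1
    then show ?thesis using assms unfolding prime_chain_def by auto
  next
    case 2
    then have "P' 0 \<subset> P' (Suc 0)" using assms i unfolding prime_chain_def by auto
    then show ?thesis using 2 assms(3) by auto
  next
    case 3
    then have "i - k < m" "Suc i - k = Suc (i - k)" using i by auto
    then have "P' (i - k) \<subset> P' (Suc i - k)" using assms(2) unfolding prime_chain_def by auto
    then show ?thesis using 3 by auto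
  qed
qed

text \<open>A complete flag of \<open>n\<close> steps whose member \<open>Q h\<close> is the least
  prime over \<open>J\<close>. As no chain of primes has more than \<open>n\<close> steps, the parts
  of the flag below and above \<open>Q h\<close> are both as long as possible, which determines the
  height of \<open>J\<close> and the dimension of its quotient.\<close>

locale prime_flag =
  fixes n :: nat and Q :: "nat \<Rightarrow> 'k::field mpoly set" and h :: nat and J :: "'k mpoly set"
  assumes prime: "k \<le> n \<Longrightarrow> primeideal (Q k) (poly_ring n)"
    and strict: "k < n \<Longrightarrow> Q k \<subset> Q (Suc k)"
    and h: "h \<le> n"
    and J: "ideal J (poly_ring n)" "J \<subseteq> Q h"
    and minimal: "primeideal P (poly_ring n) \<Longrightarrow> J \<subseteq> P \<Longrightarrow> Q h \<subseteq> P"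
begin

text \<open>Every prime over \<open>J\<close> contains \<open>Q h\<close> and can take its place at
  the top of the lower part of the flag.\<close>

lemma chain_below:
  assumes "primeideal P (poly_ring n)" "J \<subseteq> P"
  shows "prime_chain (poly_ring n) h (\<lambda>i. if i < h then Q i else P)"
proof -
  have "Q i \<subset> P" if "i < h" "\<not> Suc i < h" for i
  proof -
    have "h = Suc i" using that by simp
    then show ?thesis using strict[of i] h minimal[OF assms] by auto
  qed
  then show ?thesis using prime strict h assms(1) by (auto simp: prime_chain_def)
qed

lemma height_eq: "ideal_height (poly_ring n) J = ereal (real h)"
proof (rule antisym)
  have "prime_height (poly_ring n) (Q h) \<le> ereal (real h)"
    unfolding prime_height_def
  proof (rule SUP_least)
    fix k assume "k \<in> {k. \<exists>P. prime_chain (poly_ring n) k P \<and> P k = Q h}"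
    then obtain P where P: "prime_chain (poly_ring n) k P" "P k = Q h" by blast
    \<comment> \<open>The upper part of the flag extends any chain ending in \<open>Q h\<close> by
      \<open>n - h\<close> steps, and the total is at most \<open>n\<close>.\<close>
    have "prime_chain (poly_ring n) (n - h) (\<lambda>i. Q (h + i))"
      using prime strict h unfolding prime_chain_def by auto
    from prime_chain_le[OF prime_chain_append[OF P(1) this]] P(2) h
    show "ereal (real k) \<le> ereal (real h)" by auto
  qed
  moreover have "Q h \<in> {\<pp>. primeideal \<pp> (poly_ring n) \<and> J \<subseteq> \<pp>}" using prime h J by auto
  ultimately show "ideal_height (poly_ring n) J \<le> ereal (real h)"
    unfolding ideal_height_def by (meson INF_lower2)
  show "ereal (real h) \<le> ideal_height (poly_ring n) J"
    unfolding ideal_height_def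
  proof (rule INF_greatest)
    fix P assume "P \<in> {\<pp>. primeideal \<pp> (poly_ring n) \<and> J \<subseteq> \<pp>}"
    then have "prime_chain (poly_ring n) h (\<lambda>i. if i < h then Q i else P)"
      using chain_below by blast
    then show "ereal (real h) \<le> prime_height (poly_ring n) P"
      unfolding prime_height_def by (intro SUP_upper) auto
  qed
qed

lemma krull_dim_quotient: "krull_dim (poly_ring n Quot J) = ereal (real n - real h)"
proof (rule antisym)
  let ?R = "poly_ring n :: 'k mpoly ring"
  interpret cring ?R by (rule cring_poly_ring)
  interpret J: ideal J ?R by (rule J)
  interpret hom: ring_hom_ring ?R "?R Quot J" "(+>\<^bsub>?R\<^esub>) J" by (rule J.rcos_ring_hom_ring)
  show "krull_dim (?R Quot J) \<le> ereal (real n - real h)"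
    unfolding krull_dim_def
  proof (rule SUP_least)
    fix k assume "k \<in> {k. \<exists>P. prime_chain (?R Quot J) k P}"
    then obtain P where P: "prime_chain (?R Quot J) k P" by blast
    define P' where "P' = (\<lambda>i. {r \<in> polys n. J +>\<^bsub>?R\<^esub> r \<in> P i})"
    have pr: "primeideal (P' i) ?R" if "i \<le> k" for i
      using hom.primeideal_vimage[OF is_cring, of "P i"] P that unfolding P'_def prime_chain_def by simp
    have "P' i \<subset> P' (Suc i)" if "i < k" for i
    proof -
      have sub: "P i \<subset> P (Suc i)" using P that unfolding prime_chain_def by blast
      have "primeideal (P (Suc i)) (?R Quot J)" using P that unfolding prime_chain_def by auto
      then have "ideal (P (Suc i)) (?R Quot J)" by (rule primeideal.axioms)
      then have "P (Suc i) \<subseteq> carrier (?R Quot J)" by (simp add: additive_subgroup.a_subset ideal_def)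
      obtain a where a: "a \<in> P (Suc i)" "a \<notin> P i" using sub by blast
      then have "a \<in> carrier (?R Quot J)" using \<open>P (Suc i) \<subseteq> _\<close> by blast
      then obtain r where r: "r \<in> polys n" "a = J +>\<^bsub>?R\<^esub> r"
        by (auto simp: FactRing_def A_RCOSETS_def')
      then have "r \<in> P' (Suc i) - P' i" using a by (simp add: P'_def)
      moreover have "P' i \<subseteq> P' (Suc i)" using sub unfolding P'_def by blast
      ultimately show ?thesis by blast
    qed
    then have chain: "prime_chain ?R k P'" using pr unfolding prime_chain_def by blast
    have "J \<subseteq> P' 0"
    proof
      fix j assume j: "j \<in> J"
      have "primeideal (P 0) (?R Quot J)" using P unfolding prime_chain_def by blast
      then have "ideal (P 0) (?R Quot J)" by (rule primeideal.axioms)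
      then have "J \<in> P 0" using additive_subgroup.zero_closed[of "P 0" "?R Quot J"]
        by (simp add: ideal_def FactRing_def)
      moreover have "J +>\<^bsub>?R\<^esub> j = J" by (rule J.a_rcos_const[OF j])
      ultimately show "j \<in> P' 0" using j J.a_subset unfolding P'_def by auto
    qed
    \<comment> \<open>The chain in the quotient has been pulled back to primes over
      \<open>J\<close>, below which the flag contributes another \<open>h\<close> steps.\<close>
    have "prime_chain ?R h (\<lambda>i. if i < h then Q i else P' 0)"
      using chain_below[OF pr \<open>J \<subseteq> P' 0\<close>] by simp
    from prime_chain_le[OF prime_chain_append[OF this chain]] show "ereal (real k) \<le> ereal (real n - real h)"
      using h by simp
  qed
  have "prime_chain (?R Quot J) (n - h) (\<lambda>i. (+>\<^bsub>?R\<^esub>) J ` Q (h + i))"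
    unfolding prime_chain_def
  proof (intro conjI allI impI)
    have sub: "J \<subseteq> Q (h + i)" if "i \<le> n - h" for i
      using that
    proof (induction i)
      case (Suc i)
      have "Q (h + i) \<subset> Q (Suc (h + i))" by (rule strict) (use Suc.prems in linarith)
      then show ?case using Suc by auto
    qed (use J in simp)
    show "primeideal ((+>\<^bsub>?R\<^esub>) J ` Q (h + i)) (?R Quot J)" if "i \<le> n - h" for i
      by (rule prime_quotient_image[OF J(1) prime]) (use that h sub in auto)
    fix i assume i: "i < n - h"
    have Qi: "Q (h + i) \<subset> Q (h + Suc i)" using strict[of "h + i"] i h by simp
    then obtain x where x: "x \<in> Q (h + Suc i)" "x \<notin> Q (h + i)" by blast
    have "ideal (Q (h + Suc i)) ?R"
      using prime[of "h + Suc i"] i h unfolding primeideal_poly_ring_iff by auto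
    then have "x \<in> polys n" using x(1) unfolding ideal_poly_ring_iff by blast
    then have "J +>\<^bsub>?R\<^esub> x \<notin> (+>\<^bsub>?R\<^esub>) J ` Q (h + i)"
      using prime_quotient_image(2)[OF J(1) prime[of "h + i"] sub] i h x(2) by auto
    then show "(+>\<^bsub>?R\<^esub>) J ` Q (h + i) \<subset> (+>\<^bsub>?R\<^esub>) J ` Q (h + Suc i)"
      using Qi x(1) by blast
  qed
  then have "ereal (real (n - h)) \<le> krull_dim (?R Quot J)"
    unfolding krull_dim_def by (intro SUP_upper) auto
  then show "ereal (real n - real h) \<le> krull_dim (?R Quot J)" using h by (simp add: of_nat_diff)
qed

end

section \<open>Linear forms on a based subspace\<close>

context arr_space
begin

notation scale (infixr "*s" 75)

lemma linear_form_iff: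
  "linear_form \<alpha> \<longleftrightarrow> (\<forall>u v. \<alpha> (u + v) = \<alpha> u + \<alpha> v) \<and> (\<forall>c u. \<alpha> (c *s u) = c * \<alpha> u)"
proof -
  have "vector_space ((*) :: 'a \<Rightarrow> 'a \<Rightarrow> 'a)" by unfold_locales (simp_all add: algebra_simps)
  then show ?thesis
    unfolding linear_form_def Vector_Spaces.linear_iff using vector_space_axioms by simp
qed

lemma linear_form_add: "linear_form \<alpha> \<Longrightarrow> \<alpha> (u + v) = \<alpha> u + \<alpha> v"
  and linear_form_scale: "linear_form \<alpha> \<Longrightarrow> \<alpha> (c *s u) = c * \<alpha> u"
  by (simp_all add: linear_form_iff)

lemma linear_form_0 [simp]: "linear_form \<alpha> \<Longrightarrow> \<alpha> 0 = 0"
  using linear_form_scale[of \<alpha> 0 0] by simp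

lemma linear_form_diff: "linear_form \<alpha> \<Longrightarrow> \<alpha> (u - v) = \<alpha> u - \<alpha> v"
  using linear_form_add[of \<alpha> "u - v" v] by simp

lemma linear_form_sum: "linear_form \<alpha> \<Longrightarrow> \<alpha> (\<Sum>i\<in>I. f i) = (\<Sum>i\<in>I. \<alpha> (f i))"
  by (induction I rule: infinite_finite_induct) (simp_all add: linear_form_add)

lemmas linear_form_simps = linear_form_add linear_form_scale linear_form_diff linear_form_sum

lemma linear_form_combination:
  "linear_form \<alpha> \<Longrightarrow> linear_form \<beta> \<Longrightarrow> linear_form (\<lambda>v. a * \<alpha> v + b * \<beta> v)"
  by (simp add: linear_form_iff algebra_simps)

lemma linear_form_cmult: "linear_form \<alpha> \<Longrightarrow> linear_form (\<lambda>v. a * \<alpha> v)"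
  by (simp add: linear_form_iff algebra_simps)

text \<open>The number \<open>n\<close> of variables is independent of \<open>W\<close>, because
  forms on H with coefficients in the polynomials on V occur as well.\<close>

definition poly_form :: "'b set \<Rightarrow> nat \<Rightarrow> ('b \<Rightarrow> 'a mpoly) \<Rightarrow> bool" where
  "poly_form W n \<eta> \<longleftrightarrow> (\<forall>w\<in>W. \<eta> w \<in> polys n) \<and> (\<forall>u\<in>W. \<forall>v\<in>W. \<eta> (u + v) = \<eta> u + \<eta> v) \<and>
     (\<forall>c. \<forall>u\<in>W. \<eta> (c *s u) = const c * \<eta> u)"

lemma poly_form_in_polys: "poly_form W n \<eta> \<Longrightarrow> w \<in> W \<Longrightarrow> \<eta> w \<in> polys n"
  and poly_form_add: "poly_form W n \<eta> \<Longrightarrow> u \<in> W \<Longrightarrow> v \<in> W \<Longrightarrow> \<eta> (u + v) = \<eta> u + \<eta> v"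
  and poly_form_scale: "poly_form W n \<eta> \<Longrightarrow> u \<in> W \<Longrightarrow> \<eta> (c *s u) = const c * \<eta> u"
  by (simp_all add: poly_form_def)

lemma poly_form_linear_form:
  "linear_form p \<Longrightarrow> f \<in> polys n \<Longrightarrow> poly_form W n (\<lambda>w. const (p w) * f)"
  by (simp add: poly_form_def linear_form_simps const_add const_mult algebra_simps)

lemma poly_form_plus:
  "poly_form W n \<eta> \<Longrightarrow> poly_form W n \<zeta> \<Longrightarrow> poly_form W n (\<lambda>w. \<eta> w + \<zeta> w)"
  by (simp add: poly_form_def algebra_simps)

lemma poly_form_minus:
  "poly_form W n \<eta> \<Longrightarrow> poly_form W n \<zeta> \<Longrightarrow> poly_form W n (\<lambda>w. \<eta> w - \<zeta> w)"
  by (simp add: poly_form_def algebra_simps)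

lemma poly_form_cmult:
  "poly_form W n \<eta> \<Longrightarrow> f \<in> polys n \<Longrightarrow> poly_form W n (\<lambda>w. f * \<eta> w)"
  by (simp add: poly_form_def algebra_simps)

lemma poly_form_divide:
  assumes "poly_form W n \<eta>" "subspace W" "d \<in> polys n" "d \<noteq> 0" "\<And>w. w \<in> W \<Longrightarrow> d dvd \<eta> w"
  obtains \<zeta> where "poly_form W n \<zeta>" "\<And>w. w \<in> W \<Longrightarrow> \<eta> w = d * \<zeta> w"
proof -
  obtain \<zeta> where \<zeta>: "\<And>w. w \<in> W \<Longrightarrow> \<eta> w = d * \<zeta> w" using assms(5) unfolding dvd_def by metis
  have "poly_form W n \<zeta>"
    unfolding poly_form_def
  proof (intro conjI ballI allI)
    fix w assume "w \<in> W"
    then show "\<zeta> w \<in> polys n" using polys_divide[OF assms(3,4)] \<zeta> poly_form_in_polys[OF assms(1)] by metis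
  next
    fix u v assume uv: "u \<in> W" "v \<in> W"
    then have "d * \<zeta> (u + v) = d * (\<zeta> u + \<zeta> v)"
      using \<zeta> poly_form_add[OF assms(1)] subspace_add[OF assms(2)] by (simp add: distrib_left)
    then show "\<zeta> (u + v) = \<zeta> u + \<zeta> v" using assms(4) by simp
  next
    fix c u assume u: "u \<in> W"
    have "d * \<zeta> (c *s u) = \<eta> (c *s u)" using \<zeta> u subspace_scale[OF assms(2)] by simp
    also have "\<dots> = d * (const c * \<zeta> u)" using \<zeta>[OF u] poly_form_scale[OF assms(1) u] by (simp add: mult_ac)
    finally show "\<zeta> (c *s u) = const c * \<zeta> u" using assms(4) by simp
  qed
  then show ?thesis using \<zeta> that by blast
qed

end

section \<open>Coordinates and linear forms on a subspace with a basis\<close>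

locale based_space = arr_space scale
  for scale :: "'a::field \<Rightarrow> 'b::ab_group_add \<Rightarrow> 'b" +
  fixes e :: "'b list" and W :: "'b set"
  assumes ordered_basis: "ordered_basis e W"
begin

notation scale (infixr "*s" 75)

definition coord :: "'b \<Rightarrow> nat \<Rightarrow> 'a" where
  "coord v i = (if i < length e then representation (set e) v (e ! i) else 0)"

lemma distinct_e: "distinct e" and indep_e: "independent (set e)" and span_e: "span (set e) = W"
  using ordered_basis by (simp_all add: ordered_basis_def)

lemma subspace_W: "subspace W" using subspace_span[of "set e"] by (simp add: span_e)

lemma nth_in_W [simp]: "i < length e \<Longrightarrow> e ! i \<in> W"
  using span_base[of "e ! i" "set e"] by (simp add: span_e)

lemmas W_closed [simp] = subspace_add[OF subspace_W] subspace_diff[OF subspace_W]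
  subspace_scale[OF subspace_W] subspace_0[OF subspace_W]

lemma sum_in_W: "(\<And>i. i \<in> I \<Longrightarrow> f i \<in> W) \<Longrightarrow> sum f I \<in> W"
  by (rule subspace_sum[OF subspace_W])

lemma coord_expand:
  assumes "w \<in> W"
  shows "(\<Sum>i<length e. coord w i *s e ! i) = w"
proof -
  have "w = (\<Sum>v\<in>set e. representation (set e) w v *s v)"
    by (rule sum_representation_eq[symmetric]) (use assms indep_e span_e in auto)
  also have "\<dots> = (\<Sum>i<length e. representation (set e) w (e ! i) *s e ! i)"
    by (rule sum.reindex_bij_betw[symmetric])
      (use bij_betw_nth[OF distinct_e refl refl] in \<open>simp add: lessThan_atLeast0\<close>)
  also have "\<dots> = (\<Sum>i<length e. coord w i *s e ! i)"
    by (intro sum.cong) (auto simp: coord_def)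
  finally show ?thesis by simp
qed

lemma coord_add: "u \<in> W \<Longrightarrow> v \<in> W \<Longrightarrow> coord (u + v) i = coord u i + coord v i"
  and coord_scale: "u \<in> W \<Longrightarrow> coord (c *s u) i = c * coord u i"
  by (simp_all add: coord_def representation_add[OF indep_e]
      representation_scale[OF indep_e] span_e)

lemma coord_nth: "j < length e \<Longrightarrow> coord (e ! j) i = (if i = j then 1 else 0)"
  using distinct_e by (auto simp: coord_def representation_basis[OF indep_e] nth_eq_iff_index_eq)

lemma linear_form_coord:
  assumes "linear_form \<alpha>" "w \<in> W"
  shows "\<alpha> w = (\<Sum>i<length e. coord w i * \<alpha> (e ! i))"
proof -
  have "\<alpha> w = \<alpha> (\<Sum>i<length e. coord w i *s e ! i)" by (simp add: coord_expand assms)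
  then show ?thesis by (simp add: linear_form_simps assms(1))
qed

lemma poly_form_sum:
  assumes "poly_form W n \<eta>" "\<And>i. i \<in> I \<Longrightarrow> f i \<in> W"
  shows "\<eta> (\<Sum>i\<in>I. f i) = (\<Sum>i\<in>I. \<eta> (f i))"
  using assms(2)
proof (induction I rule: infinite_finite_induct)
  case empty
  show ?case using poly_form_scale[OF assms(1), of 0 0] by simp
next
  case (infinite I)
  show ?case using poly_form_scale[OF assms(1), of 0 0] infinite(1) by simp
next
  case (insert i I)
  then show ?case by (simp add: poly_form_add[OF assms(1)] sum_in_W)
qed

lemma poly_form_coord:
  assumes "poly_form W n \<eta>" "w \<in> W"
  shows "\<eta> w = (\<Sum>i<length e. const (coord w i) * \<eta> (e ! i))"
proof -
  have "\<eta> w = \<eta> (\<Sum>i<length e. coord w i *s e ! i)" by (simp add: coord_expand assms)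
  also have "\<dots> = (\<Sum>i<length e. \<eta> (coord w i *s e ! i))"
    by (rule poly_form_sum[OF assms(1)]) simp
  finally show ?thesis by (simp add: poly_form_scale[OF assms(1)])
qed

lemma poly_form_diff:
  assumes "poly_form W n \<eta>" "u \<in> W" "v \<in> W" shows "\<eta> (u - v) = \<eta> u - \<eta> v"
  using poly_form_add[OF assms(1), of "u - v" v] assms(2,3) by simp

lemma poly_formI:
  assumes "\<And>i. i < length e \<Longrightarrow> g i \<in> polys n"
  shows "poly_form W n (\<lambda>w. \<Sum>i<length e. const (coord w i) * g i)"
  unfolding poly_form_def
proof (intro conjI ballI allI)
  fix u v assume "u \<in> W" "v \<in> W"
  then show "(\<Sum>i<length e. const (coord (u + v) i) * g i) =
      (\<Sum>i<length e. const (coord u i) * g i) + (\<Sum>i<length e. const (coord v i) * g i)"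
    by (simp add: coord_add const_add distrib_right sum.distrib)
next
  fix c u assume "u \<in> W"
  then show "(\<Sum>i<length e. const (coord (c *s u) i) * g i) = const c * (\<Sum>i<length e. const (coord u i) * g i)"
    by (simp add: coord_scale const_mult mult.assoc sum_distrib_left)
qed (use assms in \<open>intro polys_sum polys_mult polys_const; simp\<close>)

lemma exists_linear_form: "\<exists>\<alpha>. linear_form \<alpha> \<and> (\<forall>i<length e. \<alpha> (e ! i) = f i)"
proof -
  interpret K: vector_space "(*) :: 'a \<Rightarrow> 'a \<Rightarrow> 'a" by unfold_locales (simp_all add: algebra_simps)
  interpret pr: vector_space_pair scale "(*) :: 'a \<Rightarrow> 'a \<Rightarrow> 'a" ..
  obtain g where "Vector_Spaces.linear scale (*) g" "\<forall>x\<in>set e. g x = f (THE i. i < length e \<and> e ! i = x)"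
    using pr.linear_independent_extend[OF indep_e, of "\<lambda>x. f (THE i. i < length e \<and> e ! i = x)"] by blast
  moreover have "(THE j. j < length e \<and> e ! j = e ! i) = i" if "i < length e" for i
    using that distinct_e by (auto simp: nth_eq_iff_index_eq)
  ultimately show ?thesis unfolding linear_form_def by auto
qed

abbreviation lf :: "('b \<Rightarrow> 'a) \<Rightarrow> 'a mpoly" where "lf \<equiv> form_poly e"

lemma lf_in_polys [simp]: "lf \<alpha> \<in> polys (length e)"
  unfolding form_poly_def by (intro polys_sum polys_mult polys_const polys_var) auto

lemma lf_cong: "(\<And>i. i < length e \<Longrightarrow> \<alpha> (e ! i) = \<beta> (e ! i)) \<Longrightarrow> lf \<alpha> = lf \<beta>"
  by (simp add: form_poly_def)

lemma lf_combination: "lf (\<lambda>v. a * \<alpha> v + b * \<beta> v) = const a * lf \<alpha> + const b * lf \<beta>"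
  by (simp add: form_poly_def const_add const_mult algebra_simps sum.distrib sum_distrib_left)

lemma lf_cmult: "lf (\<lambda>v. a * \<alpha> v) = const a * lf \<alpha>"
  by (simp add: form_poly_def const_mult mult.assoc sum_distrib_left)

lemma lf_eq_0D:
  assumes "linear_form \<alpha>" "lf \<alpha> = 0" "w \<in> W"
  shows "\<alpha> w = 0"
proof -
  have "\<alpha> (e ! i) = 0" if i: "i < length e" for i
  proof -
    \<comment> \<open>Setting one variable to 1 and all others to 0 reads off a coefficient.\<close>
    have "0 = poly_subst (\<lambda>j. if j = i then 1 else 0) (lf \<alpha>)" by (simp add: assms(2))
    also have "\<dots> = (\<Sum>j<length e. if j = i then const (\<alpha> (e ! j)) else 0)"
      by (simp add: form_poly_def poly_subst_sum poly_subst_mult if_distrib cong: if_cong)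
    also have "\<dots> = const (\<alpha> (e ! i))" using i by simp
    finally show ?thesis by simp
  qed
  then show ?thesis using linear_form_coord[OF assms(1,3)] by simp
qed

text \<open>The substitution \<open>f \<mapsto> f \<circ> T\<close>; it only depends on the values of \<open>T\<close> on the basis.\<close>

definition pullback :: "('b \<Rightarrow> 'b) \<Rightarrow> 'a mpoly \<Rightarrow> 'a mpoly" where
  "pullback T = poly_subst (\<lambda>i. if i < length e then \<Sum>j<length e. const (coord (T (e ! j)) i) * var j else var i)"

lemma pullback_hom [simp]:
  "pullback T (p + q) = pullback T p + pullback T q"
  "pullback T (p - q) = pullback T p - pullback T q"
  "pullback T (p * q) = pullback T p * pullback T q"
  "pullback T (const c) = const c" "pullback T 0 = 0" "pullback T 1 = 1"
  "pullback T (\<Sum>i\<in>I. f i) = (\<Sum>i\<in>I. pullback T (f i))"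
  "pullback T (\<Prod>i\<in>I. f i) = (\<Prod>i\<in>I. pullback T (f i))"
  "pullback T (p ^ k) = pullback T p ^ k"
  by (simp_all add: pullback_def poly_subst_add poly_subst_diff poly_subst_mult poly_subst_sum
      poly_subst_prod poly_subst_power)

lemma pullback_in_polys [simp]: "p \<in> polys (length e) \<Longrightarrow> pullback T p \<in> polys (length e)"
  unfolding pullback_def
  by (erule poly_subst_in_polys) (auto intro!: polys_sum polys_mult polys_var)

lemma pullback_lf:
  assumes "linear_form \<alpha>" "\<And>i. i < length e \<Longrightarrow> T (e ! i) \<in> W"
  shows "pullback T (lf \<alpha>) = lf (\<lambda>v. \<alpha> (T v))"
proof -
  have "pullback T (lf \<alpha>) =
      (\<Sum>i<length e. const (\<alpha> (e ! i)) * (\<Sum>j<length e. const (coord (T (e ! j)) i) * var j))"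
    by (simp add: form_poly_def) (simp add: pullback_def)
  also have "\<dots> = (\<Sum>j<length e. const (\<Sum>i<length e. coord (T (e ! j)) i * \<alpha> (e ! i)) * var j)"
    by (simp add: sum_distrib_left sum_distrib_right const_sum const_mult mult_ac)
      (rule sum.swap)
  also have "\<dots> = lf (\<lambda>v. \<alpha> (T v))"
    unfolding form_poly_def by (intro sum.cong) (simp_all add: linear_form_coord[OF assms(1) assms(2), symmetric])
  finally show ?thesis .
qed

section \<open>Independent linear forms and the ideals they generate\<close>

definition dual_system :: "nat \<Rightarrow> (nat \<Rightarrow> 'b \<Rightarrow> 'a) \<Rightarrow> (nat \<Rightarrow> 'b) \<Rightarrow> bool" where
  "dual_system m p u \<longleftrightarrow> (\<forall>k<m. linear_form (p k) \<and> u k \<in> W) \<and>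
     (\<forall>j<m. \<forall>k<m. p j (u k) = (if j = k then 1 else 0))"

text \<open>Carrying dual vectors along with the forms makes the projection onto the common kernel
  explicit; composing polynomials with it is reduction modulo the forms.\<close>

definition proj :: "nat \<Rightarrow> (nat \<Rightarrow> 'b \<Rightarrow> 'a) \<Rightarrow> (nat \<Rightarrow> 'b) \<Rightarrow> 'b \<Rightarrow> 'b" where
  "proj m p u v = v - (\<Sum>k<m. p k v *s u k)"

lemma proj_in_W: "dual_system m p u \<Longrightarrow> v \<in> W \<Longrightarrow> proj m p u v \<in> W"
  unfolding proj_def dual_system_def by (auto intro!: W_closed sum_in_W)

lemma form_proj:
  assumes "dual_system m p u" "k < m"
  shows "p k (proj m p u v) = 0"
proof -
  have lin: "linear_form (p k)" using assms by (simp add: dual_system_def)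
  have "(\<Sum>j<m. p j v * p k (u j)) = (\<Sum>j<m. if j = k then p j v else 0)"
    using assms by (intro sum.cong) (auto simp: dual_system_def)
  then show ?thesis using assms(2) unfolding proj_def by (simp add: linear_form_simps[OF lin])
qed

lemma pullback_proj_lf:
  assumes "dual_system m p u" "linear_form \<alpha>"
  shows "pullback (proj m p u) (lf \<alpha>) = lf \<alpha> - (\<Sum>k<m. const (\<alpha> (u k)) * lf (p k))"
proof -
  have "pullback (proj m p u) (lf \<alpha>) = lf (\<lambda>v. \<alpha> (proj m p u v))"
    by (rule pullback_lf) (use assms proj_in_W in auto)
  also have "\<dots> = (\<Sum>i<length e. const (\<alpha> (e ! i) - (\<Sum>k<m. p k (e ! i) * \<alpha> (u k))) * var i)"
    by (simp add: form_poly_def proj_def linear_form_simps[OF assms(2)])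
  also have "\<dots> = lf \<alpha> - (\<Sum>i<length e. \<Sum>k<m. const (\<alpha> (u k)) * (const (p k (e ! i)) * var i))"
    by (simp add: form_poly_def const_diff const_sum const_mult left_diff_distrib right_diff_distrib sum_subtractf
        sum_distrib_right sum_distrib_left mult_ac)
  also have "(\<Sum>i<length e. \<Sum>k<m. const (\<alpha> (u k)) * (const (p k (e ! i)) * var i))
      = (\<Sum>k<m. const (\<alpha> (u k)) * lf (p k))"
    by (subst sum.swap) (simp add: form_poly_def sum_distrib_left)
  finally show ?thesis .
qed

lemma var_lf:
  assumes "i < length e"
  shows "\<exists>\<alpha>. linear_form \<alpha> \<and> lf \<alpha> = var i \<and> (\<forall>w\<in>W. \<alpha> w = coord w i)"
proof -
  obtain \<alpha> where \<alpha>: "linear_form \<alpha>" "\<forall>j<length e. \<alpha> (e ! j) = (if j = i then 1 else 0)"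
    using exists_linear_form[of "\<lambda>j. if j = i then 1 else 0"] by blast
  have "lf \<alpha> = (\<Sum>j<length e. if j = i then var j else 0)"
    unfolding form_poly_def using \<alpha>(2) by (intro sum.cong) auto
  then have "lf \<alpha> = var i" using assms by simp
  moreover have "\<alpha> w = coord w i" if "w \<in> W" for w
  proof -
    have "\<alpha> w = (\<Sum>j<length e. if j = i then coord w j else 0)"
      unfolding linear_form_coord[OF \<alpha>(1) that] using \<alpha>(2) by (intro sum.cong) auto
    then show ?thesis using assms by simp
  qed
  ultimately show ?thesis using \<alpha>(1) by blast
qed

text \<open>For linear forms this is \<open>pullback_proj_lf\<close>. Products inherit it through
  \<open>f1 * f2 - ?h f1 * ?h f2 = (f1 - ?h f1) * f2 + ?h f1 * (f2 - ?h f2)\<close>.\<close>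

lemma pullback_proj_diff:
  assumes d: "dual_system m p u"
  shows "\<exists>g. f - pullback (proj m p u) f = (\<Sum>k<m. lf (p k) * g k)"
proof (induction f rule: poly_induct)
  case (const c)
  show ?case by (rule exI[of _ "\<lambda>_. 0"]) simp
next
  case (var i)
  show ?case
  proof (cases "i < length e")
    case True
    then obtain \<alpha> where \<alpha>: "linear_form \<alpha>" "lf \<alpha> = var i" using var_lf by blast
    show ?thesis
      using pullback_proj_lf[OF d \<alpha>(1)] \<alpha>(2)
      by (intro exI[of _ "\<lambda>k. const (\<alpha> (u k))"]) (simp add: mult.commute)
  next
    case False
    then show ?thesis by (intro exI[of _ "\<lambda>_. 0"]) (simp add: pullback_def)
  qed
next
  case (add f1 f2)
  then obtain g1 g2 where g: "f1 - pullback (proj m p u) f1 = (\<Sum>k<m. lf (p k) * g1 k)"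
    "f2 - pullback (proj m p u) f2 = (\<Sum>k<m. lf (p k) * g2 k)" by blast
  have "f1 + f2 - pullback (proj m p u) (f1 + f2) =
      (f1 - pullback (proj m p u) f1) + (f2 - pullback (proj m p u) f2)" by simp
  also have "\<dots> = (\<Sum>k<m. lf (p k) * (g1 k + g2 k))" unfolding g by (simp add: distrib_left sum.distrib)
  finally show ?case by (rule exI[of _ "\<lambda>k. g1 k + g2 k"])
next
  case (mult f1 f2)
  let ?h = "pullback (proj m p u)"
  from mult obtain g1 g2 where g: "f1 - ?h f1 = (\<Sum>k<m. lf (p k) * g1 k)"
    "f2 - ?h f2 = (\<Sum>k<m. lf (p k) * g2 k)" by blast
  have "f1 * f2 - ?h (f1 * f2) = (f1 - ?h f1) * f2 + ?h f1 * (f2 - ?h f2)"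
    by (simp add: algebra_simps)
  also have "\<dots> = (\<Sum>k<m. lf (p k) * (g1 k * f2 + ?h f1 * g2 k))"
    unfolding g sum_distrib_left sum_distrib_right
    by (simp add: distrib_left sum.distrib mult_ac)
  finally show ?case by (rule exI[of _ "\<lambda>k. g1 k * f2 + ?h f1 * g2 k"])
qed

text \<open>Presents the ideal generated by independent linear forms as the kernel of an
  endomorphism of a domain, so that primality and regularity become properties of a
  homomorphism.\<close>

lemma pullback_proj_eq_0_iff:
  assumes d: "dual_system m p u"
  shows "pullback (proj m p u) f = 0 \<longleftrightarrow> (\<exists>g. f = (\<Sum>k<m. lf (p k) * g k))"
proof
  assume "pullback (proj m p u) f = 0"
  then show "\<exists>g. f = (\<Sum>k<m. lf (p k) * g k)" using pullback_proj_diff[OF d, of f] by simp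
next
  have 0: "pullback (proj m p u) (lf (p k)) = 0" if k: "k < m" for k
  proof -
    have lin: "linear_form (p k)" using d k by (simp add: dual_system_def)
    have "(\<Sum>j<m. const (p k (u j)) * lf (p j)) = (\<Sum>j<m. if j = k then lf (p j) else 0)"
      using d k by (intro sum.cong) (auto simp: dual_system_def)
    then show ?thesis using pullback_proj_lf[OF d lin] k by simp
  qed
  assume "\<exists>g. f = (\<Sum>k<m. lf (p k) * g k)"
  then show "pullback (proj m p u) f = 0" using 0 by auto
qed

lemma dual_system_1: "linear_form p \<Longrightarrow> u \<in> W \<Longrightarrow> p u = 1 \<Longrightarrow> dual_system 1 (\<lambda>_. p) (\<lambda>_. u)"
  by (simp add: dual_system_def)

lemma pullback_lf_dvd_iff:
  assumes "linear_form p" "u \<in> W" "p u = 1"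
  shows "pullback (proj 1 (\<lambda>_. p) (\<lambda>_. u)) f = 0 \<longleftrightarrow> lf p dvd f"
  unfolding pullback_proj_eq_0_iff[OF dual_system_1[OF assms]] dvd_def by auto

lemma prime_elem_lf:
  assumes "linear_form p" "u \<in> W" "p u = 1"
  shows "prime_elem (lf p)"
proof -
  note iff = pullback_lf_dvd_iff[OF assms, symmetric]
  have "lf p \<noteq> 0" using lf_eq_0D[OF assms(1) _ assms(2)] assms(3) by auto
  then show ?thesis unfolding prime_elem_def iff by simp
qed

text \<open>Reduction modulo \<open>lf p\<close> is composition with a projection that fixes the
  kernel of \<open>p\<close>, so \<open>q\<close> vanishes there.\<close>

lemma lf_dvd_lfD:
  assumes "linear_form p" "u \<in> W" "p u = 1" "linear_form q" "lf p dvd lf q" "w \<in> W" "p w = 0"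
  shows "q w = 0"
proof -
  let ?P = "proj 1 (\<lambda>_. p) (\<lambda>_. u)"
  have lin: "linear_form (\<lambda>v. q (?P v))"
    by (simp add: linear_form_iff proj_def linear_form_simps[OF assms(1)] linear_form_simps[OF assms(4)] algebra_simps)
  have "pullback ?P (lf q) = 0" using pullback_lf_dvd_iff[OF assms(1-3)] assms(5) by simp
  moreover have "pullback ?P (lf q) = lf (\<lambda>v. q (?P v))"
    using pullback_lf[OF assms(4), of ?P] proj_in_W[OF dual_system_1[OF assms(1-3)]] by simp
  ultimately have "q (?P w) = 0" using lf_eq_0D[OF lin _ assms(6)] by simp
  then show ?thesis using assms(7) by (simp add: proj_def)
qed

lemma dual_system_mono: "dual_system m p u \<Longrightarrow> k \<le> m \<Longrightarrow> dual_system k p u"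
  by (simp add: dual_system_def)

text \<open>\<open>p m\<close> vanishes on the first \<open>m\<close> dual vectors, so the
  projection along them fixes \<open>lf (p m)\<close>; being nonzero in a domain, it cancels modulo
  the first \<open>m\<close> forms.\<close>

lemma lf_regular:
  assumes d: "dual_system (Suc m) p u" and eq: "lf (p m) * f = (\<Sum>k<m. lf (p k) * g k)"
  shows "\<exists>g'. f = (\<Sum>k<m. lf (p k) * g' k)"
proof -
  have dm: "dual_system m p u" using dual_system_mono[OF d] by simp
  have lin: "linear_form (p m)" and u: "u m \<in> W" "p m (u m) = 1" using d by (simp_all add: dual_system_def)
  have "lf (p m) \<noteq> 0" using lf_eq_0D[OF lin _ u(1)] u(2) by auto
  moreover have "pullback (proj m p u) (lf (p m)) = lf (p m)"
    using pullback_proj_lf[OF dm lin] d by (simp add: dual_system_def)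
  moreover have "pullback (proj m p u) (lf (p m) * f) = 0"
    unfolding pullback_proj_eq_0_iff[OF dm] eq by (rule exI[of _ g]) (rule refl)
  ultimately have "pullback (proj m p u) f = 0" by simp
  then show ?thesis unfolding pullback_proj_eq_0_iff[OF dm] .
qed

section \<open>Contraction with the Euler derivation\<close>

definition euler :: "('b \<Rightarrow> 'a mpoly) \<Rightarrow> 'a mpoly" where
  "euler \<eta> = (\<Sum>i<length e. var i * \<eta> (e ! i))"

lemma euler_in_polys: "poly_form W (length e) \<eta> \<Longrightarrow> euler \<eta> \<in> polys (length e)"
  unfolding euler_def by (intro polys_sum polys_mult polys_var) (auto intro: poly_form_in_polys)

lemma euler_linear_form: "euler (\<lambda>w. const (p w) * f) = lf p * f"
  by (simp add: euler_def form_poly_def sum_distrib_right sum_distrib_left mult_ac)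

lemma euler_add: "euler (\<lambda>w. \<eta> w + \<zeta> w) = euler \<eta> + euler \<zeta>"
  and euler_diff: "euler (\<lambda>w. \<eta> w - \<zeta> w) = euler \<eta> - euler \<zeta>"
  and euler_cmult: "euler (\<lambda>w. f * \<eta> w) = f * euler \<eta>"
  by (simp_all add: euler_def algebra_simps sum.distrib sum_subtractf sum_distrib_left)

lemma euler_cong: "(\<And>w. w \<in> W \<Longrightarrow> \<eta> w = \<zeta> w) \<Longrightarrow> euler \<eta> = euler \<zeta>"
  by (simp add: euler_def)

text \<open>Splits each basis vector into its projection and its components along the
  \<open>u k\<close>. The first sum evaluates the form only on the common kernel of the
  \<open>p k\<close>, which is where logarithmic forms are divisible.\<close>

lemma euler_proj:
  assumes \<eta>: "poly_form W (length e) \<eta>" and d: "dual_system m p u"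
  shows "euler \<eta> = (\<Sum>i<length e. var i * \<eta> (proj m p u (e ! i))) + (\<Sum>k<m. lf (p k) * \<eta> (u k))"
proof -
  have u: "u k \<in> W" if "k < m" for k using d that by (simp add: dual_system_def)
  have "\<eta> (e ! i) = \<eta> (proj m p u (e ! i)) + (\<Sum>k<m. const (p k (e ! i)) * \<eta> (u k))" if "i < length e" for i
  proof -
    have s: "(\<Sum>k<m. p k (e ! i) *s u k) \<in> W" using u by (intro sum_in_W) simp
    have "\<eta> (proj m p u (e ! i)) = \<eta> (e ! i) - \<eta> (\<Sum>k<m. p k (e ! i) *s u k)"
      unfolding proj_def using that s by (intro poly_form_diff[OF \<eta>]) simp_all
    also have "\<eta> (\<Sum>k<m. p k (e ! i) *s u k) = (\<Sum>k<m. const (p k (e ! i)) * \<eta> (u k))"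
      using u by (subst poly_form_sum[OF \<eta>]) (simp_all add: poly_form_scale[OF \<eta>])
    finally show ?thesis by simp
  qed
  then have "euler \<eta> = (\<Sum>i<length e. var i * \<eta> (proj m p u (e ! i))) +
      (\<Sum>i<length e. \<Sum>k<m. const (p k (e ! i)) * var i * \<eta> (u k))"
    unfolding euler_def by (simp add: distrib_left sum.distrib sum_distrib_left mult_ac)
  also have "(\<Sum>i<length e. \<Sum>k<m. const (p k (e ! i)) * var i * \<eta> (u k)) = (\<Sum>k<m. lf (p k) * \<eta> (u k))"
    by (subst sum.swap) (simp add: form_poly_def sum_distrib_right)
  finally show ?thesis .
qed

lemma euler_proj_1:
  assumes "poly_form W (length e) \<eta>" "linear_form p" "u \<in> W" "p u = 1"
  shows "euler \<eta> = (\<Sum>i<length e. var i * \<eta> (e ! i - p (e ! i) *s u)) + lf p * \<eta> u"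
  using euler_proj[OF assms(1) dual_system_1[OF assms(2-4)]] by (simp add: proj_def)

end

section \<open>Logarithmic forms\<close>

lemma emb_simps [simp]:
  "emb (a + b) = emb a + emb b" "emb (a * b) = emb a * emb b" "emb (a - b) = emb a - emb b"
  "emb 0 = 0" "emb 1 = 1" "emb a = emb b \<longleftrightarrow> a = b"
  by (simp_all add: emb_def Zero_fract_def One_fract_def eq_fract)

lemma emb_eq_0_iff [simp]: "emb a = 0 \<longleftrightarrow> a = 0"
  using emb_simps(6)[of a 0] by simp

lemma emb_sum: "emb (\<Sum>i\<in>I. f i) = (\<Sum>i\<in>I. emb (f i))"
  by (induction I rule: infinite_finite_induct) simp_all

text \<open>A hyperplane is given by a form normalized at some vector rather than by its dimension;
  in this shape the assumption passes directly to localizations and to the restriction, where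
  \<open>W\<close> is H.\<close>

locale based_arrangement = based_space scale e W
  for scale :: "'a::field \<Rightarrow> 'b::ab_group_add \<Rightarrow> 'b" and e W +
  fixes A :: "'b set set"
  assumes finite_A: "finite A"
    and hyperplane: "L \<in> A \<Longrightarrow> \<exists>a u. linear_form a \<and> u \<in> W \<and> a u = 1 \<and> L = {w \<in> W. a w = 0}"
begin

abbreviation df :: "'b set \<Rightarrow> 'b \<Rightarrow> 'a" where "df \<equiv> defining_form W"

lemma df_linear: "L \<in> A \<Longrightarrow> linear_form (df L)"
  and df_kernel: "L \<in> A \<Longrightarrow> {w \<in> W. df L w = 0} = L"
proof -
  assume "L \<in> A"
  then have "\<exists>a. linear_form a \<and> {w \<in> W. a w = 0} = L" using hyperplane by metis
  then have "linear_form (df L) \<and> {w \<in> W. df L w = 0} = L"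
    unfolding defining_form_def by (rule someI_ex)
  then show "linear_form (df L)" "{w \<in> W. df L w = 0} = L" by blast+
qed

lemma df_eq_0_iff: "L \<in> A \<Longrightarrow> w \<in> W \<Longrightarrow> df L w = 0 \<longleftrightarrow> w \<in> L"
  using df_kernel by blast

lemma hyperplaneI: "L \<in> A \<Longrightarrow> w \<in> W \<Longrightarrow> df L w = 0 \<Longrightarrow> w \<in> L"
  using df_eq_0_iff by blast

lemma proj_in_hyperplane:
  assumes "L \<in> A" "u \<in> W" "df L u = 1" "w \<in> W" shows "w - df L w *s u \<in> L"
  by (rule hyperplaneI) (use assms in \<open>simp_all add: linear_form_simps[OF df_linear[OF assms(1)]]\<close>)

lemma hyperplane_subset: "L \<in> A \<Longrightarrow> L \<subseteq> W" using df_kernel by blast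

lemma df_normal:
  assumes "L \<in> A" obtains u where "u \<in> W" "df L u = 1"
proof -
  obtain a u where a: "linear_form a" "u \<in> W" "a u = 1" "L = {w \<in> W. a w = 0}"
    using hyperplane[OF assms] by blast
  then have "u \<notin> L" by simp
  then have "df L u \<noteq> 0" using df_eq_0_iff[OF assms a(2)] by simp
  then have "df L (inverse (df L u) *s u) = 1" by (simp add: linear_form_scale[OF df_linear[OF assms]])
  then show ?thesis using that a(2) by (meson subspace_scale[OF subspace_W])
qed

lemma prime_df: "L \<in> A \<Longrightarrow> prime_elem (lf (df L))"
  using df_normal prime_elem_lf df_linear by metis

lemma df_nonzero: "L \<in> A \<Longrightarrow> lf (df L) \<noteq> 0"
  using prime_df by (auto simp: prime_elem_def)

text \<open>\<open>df M\<close> vanishes on \<open>L\<close>, so it is a multiple of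
  \<open>df L\<close>, by a nonzero factor since \<open>df M\<close> takes the value 1.\<close>

lemma hyperplane_subset_eq:
  assumes "L \<in> A" "M \<in> A" "L \<subseteq> M" shows "L = M"
proof
  obtain u where u: "u \<in> W" "df L u = 1" using df_normal[OF assms(1)] .
  note lL = linear_form_simps[OF df_linear[OF assms(1)]] and lM = linear_form_simps[OF df_linear[OF assms(2)]]
  have *: "df M w = df L w * df M u" if "w \<in> W" for w
  proof -
    have "w - df L w *s u \<in> L" by (rule proj_in_hyperplane[OF assms(1) u that])
    then have "df M (w - df L w *s u) = 0" using df_eq_0_iff[OF assms(2)] that u assms(3) by auto
    then show ?thesis by (simp add: lM)
  qed
  obtain v where v: "v \<in> W" "df M v = 1" using df_normal[OF assms(2)] .
  have "df M u \<noteq> 0" using *[OF v(1)] v(2) by auto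
  show "M \<subseteq> L"
  proof
    fix w assume w: "w \<in> M"
    then have "w \<in> W" using hyperplane_subset[OF assms(2)] by blast
    moreover from this have "df M w = 0" using w df_eq_0_iff[OF assms(2)] by blast
    ultimately have "df L w = 0" using *[of w] \<open>df M u \<noteq> 0\<close> by simp
    then show "w \<in> L" by (rule hyperplaneI[OF assms(1) \<open>w \<in> W\<close>])
  qed
qed (rule assms)

lemma df_not_dvd:
  assumes "L \<in> A" "M \<in> A" "L \<noteq> M" shows "\<not> lf (df L) dvd lf (df M)"
proof
  assume dvd: "lf (df L) dvd lf (df M)"
  obtain u where u: "u \<in> W" "df L u = 1" using df_normal[OF assms(1)] .
  have "L \<subseteq> M"
    using lf_dvd_lfD[OF df_linear[OF assms(1)] u df_linear[OF assms(2)] dvd] hyperplane_subset[OF assms(1)]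
      df_eq_0_iff[OF assms(1)] df_eq_0_iff[OF assms(2)] by blast
  then show False using hyperplane_subset_eq assms by blast
qed

lemma sub_arrangement: "B \<subseteq> A \<Longrightarrow> based_arrangement scale e W B"
  by unfold_locales (use finite_A hyperplane finite_subset in \<open>blast+\<close>)

text \<open>\<open>Log\<close> is \<open>Q(A) \<Omega>\<^sup>1(A)\<close>: a form \<open>\<eta>\<close> is regarded as a linear map from \<open>W\<close> to polynomials, and the
  condition on \<open>\<eta> \<and> d\<alpha>\<^sub>L\<close> says that \<open>\<alpha>\<^sub>L\<close> divides the values of \<open>\<eta>\<close> on \<open>L = ker \<alpha>\<^sub>L\<close>.\<close>

definition Log :: "('b \<Rightarrow> 'a mpoly) set" where
  "Log = {\<eta>. poly_form W (length e) \<eta> \<and> (\<forall>L\<in>A. \<forall>w\<in>L. lf (df L) dvd \<eta> w)}"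

definition Q :: "'a mpoly" where "Q = (\<Prod>L\<in>A. lf (df L))"

lemma arr_poly_eq: "arr_poly e A = Q"
  by (simp add: arr_poly_def Q_def span_e)

lemma Q_in_polys [simp]: "Q \<in> polys (length e)" unfolding Q_def by (intro polys_prod lf_in_polys)

lemma Q_nonzero [simp]: "Q \<noteq> 0" unfolding Q_def using finite_A df_nonzero by auto

lemma Q_dvd:
  assumes "\<And>L. L \<in> A \<Longrightarrow> lf (df L) dvd f" shows "Q dvd f"
  unfolding Q_def using prod_prime_powers_dvd[of A "\<lambda>L. lf (df L)" "\<lambda>_. 1" f] finite_A prime_df df_not_dvd assms
  by simp

lemma Log_form: "\<eta> \<in> Log \<Longrightarrow> poly_form W (length e) \<eta>"
  and Log_dvd: "\<eta> \<in> Log \<Longrightarrow> L \<in> A \<Longrightarrow> w \<in> L \<Longrightarrow> lf (df L) dvd \<eta> w"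
  by (simp_all add: Log_def)

lemma Log_minus: "\<eta> \<in> Log \<Longrightarrow> \<zeta> \<in> Log \<Longrightarrow> (\<lambda>w. \<eta> w - \<zeta> w) \<in> Log"
  and Log_plus: "\<eta> \<in> Log \<Longrightarrow> \<zeta> \<in> Log \<Longrightarrow> (\<lambda>w. \<eta> w + \<zeta> w) \<in> Log"
  and Log_cmult: "\<eta> \<in> Log \<Longrightarrow> f \<in> polys (length e) \<Longrightarrow> (\<lambda>w. f * \<eta> w) \<in> Log"
  by (simp_all add: Log_def poly_form_minus poly_form_plus poly_form_cmult)

text \<open>Split the Euler derivation at each \<open>L\<close>: its tangential part evaluates the
  form on \<open>L\<close>, where \<open>lf (df L)\<close> divides, and its normal part carries that
  factor itself.\<close>

lemma euler_Log:
  assumes "\<eta> \<in> Log" shows "Q dvd euler \<eta>"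
proof (rule Q_dvd)
  fix L assume L: "L \<in> A"
  obtain u where u: "u \<in> W" "df L u = 1" using df_normal[OF L] .
  have "e ! i - df L (e ! i) *s u \<in> L" if "i < length e" for i
    by (rule proj_in_hyperplane[OF L u]) (use that in simp)
  then have "lf (df L) dvd (\<Sum>i<length e. var i * \<eta> (e ! i - df L (e ! i) *s u))"
    using Log_dvd[OF assms L] by (intro dvd_sum dvd_mult) auto
  then show "lf (df L) dvd euler \<eta>"
    unfolding euler_proj_1[OF Log_form[OF assms] df_linear[OF L] u] by (intro dvd_add) auto
qed

definition ratio_form :: "('b \<Rightarrow> 'a mpoly) \<Rightarrow> 'a form1" where
  "ratio_form \<eta> = (\<lambda>i. if i < length e then emb (\<eta> (e ! i)) / emb Q else 0)"

lemma ratio_form_in_log_forms: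
  assumes "\<eta> \<in> Log" shows "ratio_form \<eta> \<in> log_forms e A"
  unfolding log_forms_def arr_poly_eq span_e
proof (intro CollectI conjI ballI)
  have n: "\<eta> (e ! i) \<in> polys (length e)" if "i < length e" for i
    using poly_form_in_polys[OF Log_form[OF assms]] that by simp
  show "ratio_form \<eta> \<in> (\<lambda>\<eta> i. \<eta> i / emb Q) ` reg_forms1 (length e)"
    by (rule image_eqI[of _ _ "\<lambda>i. if i < length e then emb (\<eta> (e ! i)) else 0"])
      (auto simp: ratio_form_def reg_forms1_def n)
  fix L assume L: "L \<in> A"
  let ?a = "df L" and ?l = "lf (df L)"
  note lin = linear_form_simps[OF df_linear[OF L]]
  have "\<exists>t\<in>polys (length e). \<eta> (e ! i) * const (?a (e ! j)) - \<eta> (e ! j) * const (?a (e ! i)) = ?l * t"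
    if ij: "i < length e" "j < length e" for i j
  proof -
    \<comment> \<open>This vector lies in the kernel of \<open>?a\<close>, and its value under
      \<eta> is the coefficient of dx_i \<and> dx_j in \<eta> \<and> d\<alpha>_L.\<close>
    let ?w = "?a (e ! j) *s e ! i - ?a (e ! i) *s e ! j"
    have "?w \<in> L" by (rule hyperplaneI[OF L]) (use ij in \<open>simp_all add: lin mult.commute\<close>)
    then have "?l dvd \<eta> ?w" by (rule Log_dvd[OF assms L])
    also have "\<eta> ?w = \<eta> (e ! i) * const (?a (e ! j)) - \<eta> (e ! j) * const (?a (e ! i))"
      using ij by (simp add: poly_form_diff[OF Log_form[OF assms]] poly_form_scale[OF Log_form[OF assms]] mult.commute)
    finally show ?thesis
      using n ij df_nonzero[OF L] by (elim polys_dvdE[where n = "length e"]) auto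
  qed
  then obtain t where t: "\<And>i j. i < length e \<Longrightarrow> j < length e \<Longrightarrow> t i j \<in> polys (length e) \<and>
      \<eta> (e ! i) * const (?a (e ! j)) - \<eta> (e ! j) * const (?a (e ! i)) = ?l * t i j"
    by metis
  show "wedge (\<lambda>i. emb Q * ratio_form \<eta> i) (form_diff e ?a) \<in> (\<lambda>\<tau> i j. emb ?l * \<tau> i j) ` reg_forms2 (length e)"
  proof (rule image_eqI)
    let ?\<tau> = "\<lambda>i j. if i < j \<and> j < length e then emb (t i j) else 0"
    show "?\<tau> \<in> reg_forms2 (length e)" using t by (auto simp: reg_forms2_def)
    show "wedge (\<lambda>i. emb Q * ratio_form \<eta> i) (form_diff e ?a) = (\<lambda>i j. emb ?l * ?\<tau> i j)"
    proof (intro ext)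
      fix i j
      have "emb (\<eta> (e ! i)) * emb (const (?a (e ! j))) - emb (\<eta> (e ! j)) * emb (const (?a (e ! i))) = emb ?l * emb (t i j)"
        if "i < length e" "j < length e"
        using t[OF that] by (metis emb_simps(2,3))
      then show "wedge (\<lambda>i. emb Q * ratio_form \<eta> i) (form_diff e ?a) i j = emb ?l * ?\<tau> i j"
        by (auto simp: wedge_def ratio_form_def form_diff_def)
    qed
  qed
qed

lemma log_formsE:
  assumes "\<omega> \<in> log_forms e A" obtains \<eta> where "\<eta> \<in> Log" "\<omega> = ratio_form \<eta>"
proof -
  obtain \<omega>' where w': "\<omega>' \<in> reg_forms1 (length e)" "\<omega> = (\<lambda>i. \<omega>' i / emb Q)"
    using assms unfolding log_forms_def arr_poly_eq by blast
  have "\<forall>i. \<exists>g. i < length e \<longrightarrow> g \<in> polys (length e) \<and> \<omega>' i = emb g" using w'(1) by (auto simp: reg_forms1_def)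
  then obtain g where g: "\<And>i. i < length e \<Longrightarrow> g i \<in> polys (length e)" "\<And>i. i < length e \<Longrightarrow> \<omega>' i = emb (g i)"
    by metis
  define \<eta> where "\<eta> = (\<lambda>w. \<Sum>i<length e. const (coord w i) * g i)"
  have form: "poly_form W (length e) \<eta>" unfolding \<eta>_def using g(1) by (rule poly_formI)
  have \<eta>: "\<eta> (e ! i) = g i" if "i < length e" for i
  proof -
    have "\<eta> (e ! i) = (\<Sum>j<length e. if j = i then g j else 0)"
      unfolding \<eta>_def by (intro sum.cong) (auto simp: coord_nth[OF that])
    then show ?thesis using that by simp
  qed
  have "lf (df L) dvd \<eta> w" if L: "L \<in> A" and w: "w \<in> L" for L w
  proof -
    let ?a = "df L" and ?l = "lf (df L)"
    have "wedge (\<lambda>i. emb Q * \<omega> i) (form_diff e ?a) \<in> (\<lambda>\<tau> i j. emb ?l * \<tau> i j) ` reg_forms2 (length e)"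
      using assms L unfolding log_forms_def arr_poly_eq span_e by blast
    then obtain \<tau> where \<tau>: "\<tau> \<in> reg_forms2 (length e)"
        "wedge (\<lambda>i. emb Q * \<omega> i) (form_diff e ?a) = (\<lambda>i j. emb ?l * \<tau> i j)" by blast
    have lt: "?l dvd g i * const (?a (e ! j)) - g j * const (?a (e ! i))" if ij: "i < j" "j < length e" for i j
    proof -
      have "if i < j \<and> j < length e then \<tau> i j \<in> emb ` polys (length e) else \<tau> i j = 0"
        using \<tau>(1) unfolding reg_forms2_def by blast
      then obtain t where t: "\<tau> i j = emb t" using ij by auto
      have "wedge (\<lambda>i. emb Q * \<omega> i) (form_diff e ?a) i j = emb (g i * const (?a (e ! j)) - g j * const (?a (e ! i)))"
        using ij by (simp add: wedge_def form_diff_def w'(2) g(2))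
      then have "emb (g i * const (?a (e ! j)) - g j * const (?a (e ! i))) = emb (?l * t)"
        unfolding \<tau>(2) t by simp
      then show ?thesis unfolding emb_simps(6) by simp
    qed
    have all: "?l dvd g i * const (?a (e ! j)) - g j * const (?a (e ! i))" if ij: "i < length e" "j < length e" for i j
    proof -
      consider "i < j" | "i = j" | "j < i" by linarith
      then show ?thesis
      proof cases
        case 3
        have "?l dvd - (g j * const (?a (e ! i)) - g i * const (?a (e ! j)))"
          using lt[OF 3 ij(1)] by (rule dvd_minus_iff[THEN iffD2])
        then show ?thesis by simp
      qed (use lt ij in auto)
    qed
    have wW: "w \<in> W" using w hyperplane_subset[OF L] by blast
    obtain u where u: "u \<in> W" "?a u = 1" using df_normal[OF L] .
    have "\<exists>j<length e. ?a (e ! j) \<noteq> 0"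
      using linear_form_coord[OF df_linear[OF L] u(1)] u(2) by (metis (no_types, lifting) lessThan_iff mult_zero_right sum.neutral zero_neq_one)
    then obtain j where j: "j < length e" "?a (e ! j) \<noteq> 0" by blast
    have "0 = ?a w" using df_eq_0_iff[OF L wW] w by simp
    also have "\<dots> = (\<Sum>i<length e. coord w i * ?a (e ! i))" by (rule linear_form_coord[OF df_linear[OF L] wW])
    finally have z: "(\<Sum>i<length e. const (coord w i) * const (?a (e ! i))) = 0"
      by (metis (no_types, lifting) const_0 const_mult const_sum sum.cong)
    \<comment> \<open>Up to a multiple of \<open>?a w = 0\<close>, this combination of wedge
      coefficients is \<open>?a (e ! j)\<close> times the value at \<open>w\<close>; the index
      \<open>j\<close> was chosen to make that factor invertible.\<close>
    have "?l dvd (\<Sum>i<length e. const (coord w i) * (g i * const (?a (e ! j)) - g j * const (?a (e ! i))))"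
      using all j by (intro dvd_sum dvd_mult) auto
    also have "\<dots> = const (?a (e ! j)) * \<eta> w - g j * (\<Sum>i<length e. const (coord w i) * const (?a (e ! i)))"
      by (simp add: \<eta>_def right_diff_distrib sum_subtractf sum_distrib_left mult_ac)
    finally have "?l dvd const (?a (e ! j)) * \<eta> w" using z by simp
    then show ?thesis using dvd_const_mult_iff[OF j(2)] by blast
  qed
  then have "\<eta> \<in> Log" using form by (simp add: Log_def)
  moreover have "\<omega> = ratio_form \<eta>"
  proof
    fix i show "\<omega> i = ratio_form \<eta> i"
      using w'(1) by (auto simp: ratio_form_def w'(2) g(2) \<eta> reg_forms1_def)
  qed
  ultimately show ?thesis using that by blast
qed

section \<open>The module of logarithmic forms and its freeness\<close>

lemma log_forms_closed:
  "(\<lambda>i. 0) \<in> log_forms e A"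
  "x \<in> log_forms e A \<Longrightarrow> y \<in> log_forms e A \<Longrightarrow> (\<lambda>i. x i + y i) \<in> log_forms e A"
  "x \<in> log_forms e A \<Longrightarrow> f \<in> polys (length e) \<Longrightarrow> (\<lambda>i. emb f * x i) \<in> log_forms e A"
proof -
  have "(\<lambda>w. 0) \<in> Log" by (simp add: Log_def poly_form_def)
  from ratio_form_in_log_forms[OF this] show "(\<lambda>i. 0) \<in> log_forms e A" by (simp add: ratio_form_def cong: if_cong)
next
  assume "x \<in> log_forms e A" "y \<in> log_forms e A"
  then obtain \<eta> \<zeta> where *: "\<eta> \<in> Log" "\<zeta> \<in> Log" "x = ratio_form \<eta>" "y = ratio_form \<zeta>" using log_formsE by metis
  have "(\<lambda>i. x i + y i) = ratio_form (\<lambda>w. \<eta> w + \<zeta> w)"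
    by (auto simp: * ratio_form_def add_divide_distrib)
  then show "(\<lambda>i. x i + y i) \<in> log_forms e A" using ratio_form_in_log_forms[OF Log_plus] * by metis
next
  assume "x \<in> log_forms e A" "f \<in> polys (length e)"
  then obtain \<eta> where *: "\<eta> \<in> Log" "x = ratio_form \<eta>" using log_formsE by metis
  have "(\<lambda>i. emb f * x i) = ratio_form (\<lambda>w. f * \<eta> w)" by (auto simp: * ratio_form_def)
  then show "(\<lambda>i. emb f * x i) \<in> log_forms e A"
    using ratio_form_in_log_forms[OF Log_cmult] * \<open>f \<in> _\<close> by metis
qed

lemma finsum_log_module:
  assumes "finite F" "F \<subseteq> log_forms e A" "\<And>v. v \<in> F \<Longrightarrow> c v \<in> polys (length e)"
  shows "(\<Oplus>\<^bsub>log_module e A\<^esub>v\<in>F. c v \<odot>\<^bsub>log_module e A\<^esub> v) = (\<lambda>i. \<Sum>v\<in>F. emb (c v) * v i)"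
    and "(\<lambda>i. \<Sum>v\<in>F. emb (c v) * v i) \<in> log_forms e A"
proof -
  let ?M = "log_module e A"
  interpret abelian_monoid ?M
    by (rule abelian_monoidI) (auto simp: log_module_def log_forms_closed add_ac)
  have carr: "carrier ?M = log_forms e A" by (simp add: log_module_def)
  have smult: "f \<odot>\<^bsub>?M\<^esub> x = (\<lambda>i. emb f * x i)" for f x by (simp add: log_module_def)
  have "(\<Oplus>\<^bsub>?M\<^esub>v\<in>F. c v \<odot>\<^bsub>?M\<^esub> v) = (\<lambda>i. \<Sum>v\<in>F. emb (c v) * v i) \<and>
      (\<lambda>i. \<Sum>v\<in>F. emb (c v) * v i) \<in> log_forms e A"
    using assms
  proof (induction F)
    case empty
    then show ?case using log_forms_closed(1) by (simp add: finsum_empty) (simp add: log_module_def)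
  next
    case (insert x F)
    have "(\<lambda>v. c v \<odot>\<^bsub>?M\<^esub> v) \<in> F \<rightarrow> carrier ?M" "c x \<odot>\<^bsub>?M\<^esub> x \<in> carrier ?M"
      using insert.prems log_forms_closed(3) by (auto simp: smult carr)
    then have "(\<Oplus>\<^bsub>?M\<^esub>v\<in>insert x F. c v \<odot>\<^bsub>?M\<^esub> v) = c x \<odot>\<^bsub>?M\<^esub> x \<oplus>\<^bsub>?M\<^esub> (\<Oplus>\<^bsub>?M\<^esub>v\<in>F. c v \<odot>\<^bsub>?M\<^esub> v)"
      using insert.hyps by (intro finsum_insert) auto
    also have "\<dots> = (\<lambda>i. \<Sum>v\<in>insert x F. emb (c v) * v i)"
      using insert by (simp add: smult) (simp add: log_module_def)
    moreover have "(\<lambda>i. \<Sum>v\<in>insert x F. emb (c v) * v i) \<in> log_forms e A"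
      using log_forms_closed(2)[OF log_forms_closed(3)[of x "c x"], of "\<lambda>i. \<Sum>v\<in>F. emb (c v) * v i"] insert
      by simp
    ultimately show ?case by simp
  qed
  then show "(\<Oplus>\<^bsub>?M\<^esub>v\<in>F. c v \<odot>\<^bsub>?M\<^esub> v) = (\<lambda>i. \<Sum>v\<in>F. emb (c v) * v i)"
    "(\<lambda>i. \<Sum>v\<in>F. emb (c v) * v i) \<in> log_forms e A" by blast+
qed

lemma lf_regular_polys:
  assumes "dual_system 3 p u" "lf (p 2) * f = lf (p 0) * g + lf (p 1) * h" "f \<in> polys (length e)"
  shows "\<exists>s\<in>polys (length e). \<exists>t\<in>polys (length e). f = lf (p 0) * s + lf (p 1) * t"
proof -
  have 2: "{..<2::nat} = {0, 1}" by auto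
  have "\<exists>g'. f = (\<Sum>k<2. lf (p k) * g' k)"
    by (rule lf_regular[of 2 p u f "\<lambda>k. if k = 0 then g else h"]) (use assms 2 in \<open>simp_all add: numeral_3_eq_3 numeral_2_eq_2\<close>)
  then obtain g' where "f = (\<Sum>k<2. lf (p k) * g' k)" by blast
  then have "f = lf (p 0) * g' 0 + lf (p 1) * g' 1" by (simp add: 2)
  then have "trunc (length e) f = lf (p 0) * trunc (length e) (g' 0) + lf (p 1) * trunc (length e) (g' 1)"
    by (simp add: trunc_add trunc_mult trunc_id)
  then show ?thesis using trunc_id[OF assms(3)] trunc_in_polys by metis
qed

text \<open>The only consequence of freeness that is needed.\<close>

lemma free_regular:
  assumes free: "free_arrangement e A" and dual: "dual_system 3 p u"
    and v: "v \<in> Log" "v1 \<in> Log" "v2 \<in> Log"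
    and eq: "\<And>w. w \<in> W \<Longrightarrow> lf (p 2) * v w = lf (p 0) * v1 w + lf (p 1) * v2 w"
  shows "\<exists>s\<in>Log. \<exists>t\<in>Log. \<forall>w\<in>W. v w = lf (p 0) * s w + lf (p 1) * t w"
proof -
  let ?X = "log_forms e A" and ?P = "polys (length e) :: 'a mpoly set"
  define comb where "comb = (\<lambda>c F i. \<Sum>b\<in>F. emb (c b) * (b :: 'a form1) i)"
  obtain B where B: "B \<subseteq> ?X" and uniq: "\<And>x. x \<in> ?X \<Longrightarrow> \<exists>!c. c \<in> B \<rightarrow>\<^sub>E ?P \<and> finite {v \<in> B. c v \<noteq> 0} \<and>
      x = (\<Oplus>\<^bsub>log_module e A\<^esub>v \<in> {v \<in> B. c v \<noteq> 0}. c v \<odot>\<^bsub>log_module e A\<^esub> v)"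
    using free unfolding free_arrangement_def free_module_def
    by (auto simp: log_module_def)
  have fin: "(\<Oplus>\<^bsub>log_module e A\<^esub>v \<in> {v \<in> B. c v \<noteq> 0}. c v \<odot>\<^bsub>log_module e A\<^esub> v) = comb c F"
    if "c \<in> B \<rightarrow>\<^sub>E ?P" "finite F" "{v \<in> B. c v \<noteq> 0} \<subseteq> F" "F \<subseteq> B" for c F
  proof -
    have "(\<Oplus>\<^bsub>log_module e A\<^esub>v \<in> {v \<in> B. c v \<noteq> 0}. c v \<odot>\<^bsub>log_module e A\<^esub> v) = comb c {v \<in> B. c v \<noteq> 0}"
      unfolding comb_def using that B finite_subset by (intro finsum_log_module) blast+
    also have "\<dots> = comb c F"
      unfolding comb_def by (intro ext sum.mono_neutral_left) (use that in auto)
    finally show ?thesis .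
  qed
  have ex: "\<exists>c F. c \<in> B \<rightarrow>\<^sub>E ?P \<and> finite F \<and> {v \<in> B. c v \<noteq> 0} \<subseteq> F \<and> F \<subseteq> B \<and> x = comb c F" if x: "x \<in> ?X" for x
  proof -
    obtain c where c: "c \<in> B \<rightarrow>\<^sub>E ?P" "finite {v \<in> B. c v \<noteq> 0}"
      "x = (\<Oplus>\<^bsub>log_module e A\<^esub>v \<in> {v \<in> B. c v \<noteq> 0}. c v \<odot>\<^bsub>log_module e A\<^esub> v)"
      using uniq[OF x] by blast
    then show ?thesis using fin[OF c(1,2)] by (intro exI[of _ c] exI[of _ "{v \<in> B. c v \<noteq> 0}"]) auto
  qed
  obtain c F where c: "c \<in> B \<rightarrow>\<^sub>E ?P" "finite F" "{v \<in> B. c v \<noteq> 0} \<subseteq> F" "F \<subseteq> B" "ratio_form v = comb c F"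
    using ex[OF ratio_form_in_log_forms[OF v(1)]] by blast
  obtain c1 F1 where c1: "c1 \<in> B \<rightarrow>\<^sub>E ?P" "finite F1" "{v \<in> B. c1 v \<noteq> 0} \<subseteq> F1" "F1 \<subseteq> B" "ratio_form v1 = comb c1 F1"
    using ex[OF ratio_form_in_log_forms[OF v(2)]] by blast
  obtain c2 F2 where c2: "c2 \<in> B \<rightarrow>\<^sub>E ?P" "finite F2" "{v \<in> B. c2 v \<noteq> 0} \<subseteq> F2" "F2 \<subseteq> B" "ratio_form v2 = comb c2 F2"
    using ex[OF ratio_form_in_log_forms[OF v(3)]] by blast
  define G where "G = F \<union> F1 \<union> F2"
  have G: "finite G" "G \<subseteq> B" using c c1 c2 by (auto simp: G_def)
  have enlarge: "comb c' F' = comb c' G" if "{v \<in> B. c' v \<noteq> 0} \<subseteq> F'" "F' \<subseteq> G" for c' F'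
    unfolding comb_def by (intro ext sum.mono_neutral_left) (use that G in auto)
  have cG: "ratio_form v = comb c G" "ratio_form v1 = comb c1 G" "ratio_form v2 = comb c2 G"
    unfolding c(5) c1(5) c2(5) using c(3) c1(3) c2(3) by (intro enlarge; simp add: G_def; blast)+
  \<comment> \<open>The coordinates of \<open>lf (p 2) * v - lf (p 0) * v1 - lf (p 1) * v2\<close>,
    which is zero. Uniqueness of coordinates turns the relation between forms into one between
    coefficients, where the regularity of linear forms applies.\<close>
  define z where "z = (\<lambda>b\<in>B. lf (p 2) * c b - lf (p 0) * c1 b - lf (p 1) * c2 b)"
  have cP: "c b \<in> ?P" "c1 b \<in> ?P" "c2 b \<in> ?P" if "b \<in> B" for b
    using that c(1) c1(1) c2(1) by (auto simp: PiE_iff)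
  have zP: "z \<in> B \<rightarrow>\<^sub>E ?P" unfolding z_def using cP by auto
  have "comb z G = (\<lambda>i. emb (lf (p 2)) * comb c G i - emb (lf (p 0)) * comb c1 G i - emb (lf (p 1)) * comb c2 G i)"
    unfolding comb_def sum_distrib_left sum_subtractf[symmetric]
    by (intro ext sum.cong) (use G in \<open>auto simp: z_def algebra_simps\<close>)
  also have "\<dots> = (\<lambda>i. 0)"
  proof
    fix i
    have "emb (lf (p 2)) * ratio_form v i - emb (lf (p 0)) * ratio_form v1 i - emb (lf (p 1)) * ratio_form v2 i = 0"
    proof (cases "i < length e")
      case True
      have "emb (lf (p 2) * v (e ! i)) = emb (lf (p 0) * v1 (e ! i) + lf (p 1) * v2 (e ! i))"
        using eq[of "e ! i"] True by simp
      then have "emb (lf (p 2)) * emb (v (e ! i)) - emb (lf (p 0)) * emb (v1 (e ! i)) - emb (lf (p 1)) * emb (v2 (e ! i)) = 0"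
        by simp
      then show ?thesis using True by (simp add: ratio_form_def diff_divide_distrib[symmetric])
    qed (simp add: ratio_form_def)
    then show "emb (lf (p 2)) * comb c G i - emb (lf (p 0)) * comb c1 G i - emb (lf (p 1)) * comb c2 G i = 0"
      by (simp add: cG)
  qed
  finally have z0: "comb z G = (\<lambda>i. 0)" .
  have "{v \<in> B. z v \<noteq> 0} \<subseteq> G"
    using c(3) c1(3) c2(3) unfolding z_def G_def by (auto; metis (mono_tags, lifting) diff_0_right mem_Collect_eq mult_zero_right subsetD)
  then have 1: "finite {v \<in> B. z v \<noteq> 0}"
    "(\<lambda>i. 0) = (\<Oplus>\<^bsub>log_module e A\<^esub>v \<in> {v \<in> B. z v \<noteq> 0}. z v \<odot>\<^bsub>log_module e A\<^esub> v)"
    using fin[OF zP G(1) _ G(2)] z0 G finite_subset by auto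
  have nP: "(\<lambda>b\<in>B. 0) \<in> B \<rightarrow>\<^sub>E ?P" by auto
  have cz: "comb (\<lambda>b\<in>B. 0) G = (\<lambda>i. 0)" unfolding comb_def using G by (auto intro!: ext sum.neutral)
  have emp: "{v \<in> B. (\<lambda>b\<in>B. 0) v \<noteq> (0 :: 'a mpoly)} = {}" by auto
  have "{v \<in> B. (\<lambda>b\<in>B. 0) v \<noteq> (0 :: 'a mpoly)} \<subseteq> G" unfolding emp by (rule empty_subsetI)
  then have 2: "(\<lambda>i. 0) = (\<Oplus>\<^bsub>log_module e A\<^esub>v \<in> {v \<in> B. (\<lambda>b\<in>B. 0) v \<noteq> (0 :: 'a mpoly)}. (\<lambda>b\<in>B. 0) v \<odot>\<^bsub>log_module e A\<^esub> v)"
    by (rule trans[OF cz[symmetric] fin[OF nP G(1) _ G(2), symmetric]])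
  have "finite {v \<in> B. (\<lambda>b\<in>B. 0) v \<noteq> (0 :: 'a mpoly)}" unfolding emp by (rule finite.emptyI)
  note 2 = this 2
  define rep where "rep = (\<lambda>c. c \<in> B \<rightarrow>\<^sub>E ?P \<and> finite {v \<in> B. c v \<noteq> 0} \<and>
      (\<lambda>i. 0) = (\<Oplus>\<^bsub>log_module e A\<^esub>v \<in> {v \<in> B. c v \<noteq> 0}. c v \<odot>\<^bsub>log_module e A\<^esub> v))"
  have "\<exists>!c. rep c" unfolding rep_def by (rule uniq[OF log_forms_closed(1)])
  moreover have "rep z" unfolding rep_def by (intro conjI zP 1)
  moreover have "rep (\<lambda>b\<in>B. 0)" unfolding rep_def by (intro conjI nP 2)
  ultimately have z: "z = (\<lambda>b\<in>B. 0)" by blast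
  then have rel: "lf (p 2) * c b = lf (p 0) * c1 b + lf (p 1) * c2 b" if "b \<in> B" for b
  proof -
    have "lf (p 2) * c b - lf (p 0) * c1 b - lf (p 1) * c2 b = z b" using that by (simp add: z_def)
    also have "\<dots> = 0" using that by (simp add: z)
    finally show ?thesis by (simp add: algebra_simps)
  qed
  have "\<forall>b\<in>B. \<exists>st. fst st \<in> ?P \<and> snd st \<in> ?P \<and> c b = lf (p 0) * fst st + lf (p 1) * snd st"
    using lf_regular_polys[OF dual rel cP(1)] by fastforce
  then obtain st where st: "\<And>b. b \<in> B \<Longrightarrow> fst (st b) \<in> ?P \<and> snd (st b) \<in> ?P \<and> c b = lf (p 0) * fst (st b) + lf (p 1) * snd (st b)"
    unfolding bchoice_iff by blast
  have "comb (fst \<circ> st) G \<in> ?X" "comb (snd \<circ> st) G \<in> ?X"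
    unfolding comb_def using G B st by (intro finsum_log_module(2); auto)+
  then obtain s t where s: "s \<in> Log" "comb (fst \<circ> st) G = ratio_form s" and t: "t \<in> Log" "comb (snd \<circ> st) G = ratio_form t"
    using log_formsE by metis
  have "comb c G = (\<lambda>i. emb (lf (p 0)) * comb (fst \<circ> st) G i + emb (lf (p 1)) * comb (snd \<circ> st) G i)"
    unfolding comb_def sum_distrib_left sum.distrib[symmetric]
  proof (intro ext sum.cong refl)
    fix i b assume "b \<in> G"
    then have "c b = lf (p 0) * fst (st b) + lf (p 1) * snd (st b)" using st G by blast
    then show "emb (c b) * b i = emb (lf (p 0)) * (emb ((fst \<circ> st) b) * b i) + emb (lf (p 1)) * (emb ((snd \<circ> st) b) * b i)"
      by (simp add: algebra_simps)
  qed
  then have rf: "ratio_form v i = emb (lf (p 0)) * ratio_form s i + emb (lf (p 1)) * ratio_form t i" for i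
    using cG(1) s(2) t(2) by simp
  have basis: "v (e ! i) = lf (p 0) * s (e ! i) + lf (p 1) * t (e ! i)" if "i < length e" for i
  proof -
    have "emb (v (e ! i)) / emb Q = emb (lf (p 0) * s (e ! i) + lf (p 1) * t (e ! i)) / emb Q"
      using rf[of i] that by (simp add: ratio_form_def add_divide_distrib)
    then have "emb (v (e ! i)) = emb (lf (p 0) * s (e ! i) + lf (p 1) * t (e ! i))" by simp
    then show ?thesis by (simp only: emb_simps(6))
  qed
  have "v w = lf (p 0) * s w + lf (p 1) * t w" if "w \<in> W" for w
  proof -
    have "v w = (\<Sum>i<length e. const (coord w i) * (lf (p 0) * s (e ! i) + lf (p 1) * t (e ! i)))"
      using poly_form_coord[OF Log_form[OF v(1)] that] basis by simp
    also have "\<dots> = lf (p 0) * (\<Sum>i<length e. const (coord w i) * s (e ! i)) + lf (p 1) * (\<Sum>i<length e. const (coord w i) * t (e ! i))"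
      by (simp add: distrib_left sum.distrib sum_distrib_left mult_ac)
    finally show ?thesis
      using poly_form_coord[OF Log_form[OF s(1)] that] poly_form_coord[OF Log_form[OF t(1)] that] by simp
  qed
  then show ?thesis using s(1) t(1) by blast
qed

end

section \<open>Restriction and residues\<close>

lemma ex1_unique: "\<exists>!x. P x \<Longrightarrow> P a \<Longrightarrow> P b \<Longrightarrow> a = b" by blast

locale arr_restriction = based_arrangement scale e UNIV A
  for scale :: "'a::field \<Rightarrow> 'b::ab_group_add \<Rightarrow> 'b" and e A +
  fixes b :: "'b list" and H :: "'b set"
  assumes H_in_A: "H \<in> A" and ordered_basis_H: "ordered_basis b H"
begin

lemma restricted_hyperplane:
  assumes "Y \<in> arr_restrict A H"
  shows "\<exists>a u. linear_form a \<and> u \<in> H \<and> a u = 1 \<and> Y = {w \<in> H. a w = 0}"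
proof -
  obtain L where L: "Y = H \<inter> L" "L \<in> A" "L \<noteq> H" using assms unfolding arr_restrict_def by blast
  then obtain u where u: "u \<in> H" "u \<notin> L" using hyperplane_subset_eq[OF H_in_A L(2)] by blast
  then have nz: "df L u \<noteq> 0" using df_eq_0_iff[OF L(2)] by simp
  let ?a = "\<lambda>v. inverse (df L u) * df L v"
  have "linear_form ?a" by (rule linear_form_cmult[OF df_linear[OF L(2)]])
  moreover have "Y = {w \<in> H. ?a w = 0}" using nz df_eq_0_iff[OF L(2)] L(1) by auto
  ultimately show ?thesis using u nz by (intro exI[of _ ?a] exI[of _ u]) simp
qed

sublocale R: based_arrangement scale b H "arr_restrict A H"
proof unfold_locales
  have "arr_restrict A H \<subseteq> (\<inter>) H ` A" by (auto simp: arr_restrict_def)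
  then show "finite (arr_restrict A H)" using finite_A finite_surj by blast
qed (use ordered_basis_H restricted_hyperplane in auto)

abbreviation \<alpha> :: "'a mpoly" where "\<alpha> \<equiv> lf (df H)"

section \<open>Restricting polynomials to H and extending them from H\<close>

definition v0 :: 'b where "v0 = (SOME v. df H v = 1)"

lemma df_v0 [simp]: "df H v0 = 1"
proof -
  obtain u where "df H u = 1" using df_normal[OF H_in_A] .
  then show ?thesis unfolding v0_def by (rule someI)
qed

lemmas H_lin = linear_form_simps[OF df_linear[OF H_in_A]]

lemma mem_H_iff: "w \<in> H \<longleftrightarrow> df H w = 0" using df_eq_0_iff[OF H_in_A] by simp

definition pr :: "'b \<Rightarrow> 'b" where "pr v = v - df H v *s v0"

lemma pr_in_H [simp]: "pr v \<in> H" by (simp add: mem_H_iff pr_def H_lin)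
lemma pr_id: "w \<in> H \<Longrightarrow> pr w = w" by (simp add: pr_def mem_H_iff)
lemma pr_add: "pr (u + v) = pr u + pr v" and pr_scale: "pr (c *s v) = c *s pr v"
  by (simp_all add: pr_def H_lin algebra_simps)
lemma pr_v0 [simp]: "pr v0 = 0" by (simp add: pr_def)
lemma pr_sum: "pr (\<Sum>i\<in>I. f i) = (\<Sum>i\<in>I. pr (f i))"
  by (induction I rule: infinite_finite_induct) (simp_all add: pr_add pr_id mem_H_iff H_lin df_linear[OF H_in_A])
lemma linear_form_pr: "linear_form a \<Longrightarrow> linear_form (\<lambda>v. a (pr v))"
  by (simp add: linear_form_iff pr_add pr_scale)

definition \<rho> :: "'a mpoly \<Rightarrow> 'a mpoly" where "\<rho> = poly_restrict e b"

lemma \<rho>_hom [simp]: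
  "\<rho> (p + q) = \<rho> p + \<rho> q" "\<rho> (p - q) = \<rho> p - \<rho> q" "\<rho> (p * q) = \<rho> p * \<rho> q"
  "\<rho> (const c) = const c" "\<rho> 0 = 0" "\<rho> 1 = 1"
  "\<rho> (\<Sum>i\<in>I. f i) = (\<Sum>i\<in>I. \<rho> (f i))" "\<rho> (\<Prod>i\<in>I. f i) = (\<Prod>i\<in>I. \<rho> (f i))"
  by (simp_all add: \<rho>_def poly_restrict_def poly_subst_add poly_subst_diff poly_subst_mult
      poly_subst_sum poly_subst_prod)

lemma \<rho>_dvd: "p dvd q \<Longrightarrow> \<rho> p dvd \<rho> q" by (auto simp: dvd_def)

lemma \<rho>_in_polys [simp]: "p \<in> polys (length e) \<Longrightarrow> \<rho> p \<in> polys (length b)"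
  unfolding \<rho>_def poly_restrict_def by (erule poly_subst_in_polys) simp

lemma \<rho>_var: "i < length e \<Longrightarrow> \<rho> (var i) = (\<Sum>j<length b. const (coord (b ! j) i) * var j)"
  by (simp add: \<rho>_def poly_restrict_def form_poly_def coord_def)

lemma \<rho>_lf: "linear_form a \<Longrightarrow> \<rho> (lf a) = R.lf a"
proof -
  assume a: "linear_form a"
  have "\<rho> (lf a) = (\<Sum>i<length e. const (a (e ! i)) * (\<Sum>j<length b. const (coord (b ! j) i) * var j))"
    unfolding form_poly_def by (simp add: \<rho>_var)
  also have "\<dots> = (\<Sum>j<length b. const (\<Sum>i<length e. coord (b ! j) i * a (e ! i)) * var j)"
    by (simp add: sum_distrib_left sum_distrib_right const_sum const_mult mult_ac) (rule sum.swap)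
  also have "\<dots> = R.lf a"
    by (simp add: form_poly_def linear_form_coord[OF a UNIV_I, symmetric])
  finally show ?thesis .
qed

lemma \<rho>_\<alpha> [simp]: "\<rho> \<alpha> = 0"
proof -
  have "df H (b ! i) = 0" if "i < length b" for i using R.nth_in_W[OF that] by (simp only: mem_H_iff)
  then have "R.lf (df H) = 0" unfolding form_poly_def by (intro sum.neutral) simp
  then show ?thesis using \<rho>_lf[OF df_linear[OF H_in_A]] by simp
qed

text \<open>Composition with the projection \<open>pr\<close> onto H: a section of \<rho> by a ring
  homomorphism, used to multiply forms on V by polynomials on H.\<close>

definition \<sigma> :: "'a mpoly \<Rightarrow> 'a mpoly" where
  "\<sigma> = poly_subst (\<lambda>i. \<Sum>j<length e. const (R.coord (pr (e ! j)) i) * var j)"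

lemma \<sigma>_hom [simp]:
  "\<sigma> (p + q) = \<sigma> p + \<sigma> q" "\<sigma> (p - q) = \<sigma> p - \<sigma> q" "\<sigma> (p * q) = \<sigma> p * \<sigma> q"
  "\<sigma> (const c) = const c" "\<sigma> 0 = 0" "\<sigma> 1 = 1" "\<sigma> (\<Sum>i\<in>I. f i) = (\<Sum>i\<in>I. \<sigma> (f i))"
  by (simp_all add: \<sigma>_def poly_subst_add poly_subst_diff poly_subst_mult poly_subst_sum)

lemma \<sigma>_in_polys [simp]: "p \<in> polys (length b) \<Longrightarrow> \<sigma> p \<in> polys (length e)"
  unfolding \<sigma>_def by (erule poly_subst_in_polys) (auto intro!: polys_sum polys_mult polys_var)

lemma \<sigma>_lf:
  assumes a: "linear_form a" shows "\<sigma> (R.lf a) = lf (\<lambda>v. a (pr v))"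
proof -
  have "\<sigma> (R.lf a) = (\<Sum>i<length b. const (a (b ! i)) * (\<Sum>j<length e. const (R.coord (pr (e ! j)) i) * var j))"
    by (simp add: form_poly_def) (simp add: \<sigma>_def)
  also have "\<dots> = (\<Sum>j<length e. const (\<Sum>i<length b. R.coord (pr (e ! j)) i * a (b ! i)) * var j)"
    by (simp add: sum_distrib_left sum_distrib_right const_sum const_mult mult_ac) (rule sum.swap)
  also have "\<dots> = lf (\<lambda>v. a (pr v))"
    by (simp add: form_poly_def R.linear_form_coord[OF a pr_in_H, symmetric])
  finally show ?thesis .
qed

lemma \<rho>_\<sigma>:
  assumes "p \<in> polys (length b)" shows "\<rho> (\<sigma> p) = p"
proof -
  have "\<rho> (\<sigma> p) = poly_subst (\<lambda>i. \<rho> (\<sigma> (var i))) p"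
    by (simp add: \<rho>_def \<sigma>_def poly_restrict_def poly_subst_poly_subst)
  also have "\<dots> = poly_subst var p"
  proof (rule poly_subst_cong[OF assms])
    fix i assume "i < length b"
    then obtain a where a: "linear_form a" "R.lf a = var i" using R.var_lf by blast
    have "\<rho> (\<sigma> (R.lf a)) = R.lf (\<lambda>v. a (pr v))"
      unfolding \<sigma>_lf[OF a(1)] by (rule \<rho>_lf[OF linear_form_pr[OF a(1)]])
    also have "\<dots> = R.lf a" by (rule R.lf_cong) (simp add: pr_id)
    finally show "\<rho> (\<sigma> (var i)) = var i" using a(2) by simp
  qed
  finally show ?thesis by (simp add: poly_subst_var_id)
qed

text \<open>\<open>\<sigma> \<circ> \<rho>\<close> is composition with \<open>pr\<close>, and the
  kernel of that is generated by \<alpha>.\<close>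

lemma \<rho>_eq_0_iff:
  assumes "f \<in> polys (length e)" shows "\<rho> f = 0 \<longleftrightarrow> \<alpha> dvd f"
proof
  assume "\<alpha> dvd f" then show "\<rho> f = 0" by (auto simp: dvd_def)
next
  assume 0: "\<rho> f = 0"
  let ?T = "proj 1 (\<lambda>_. df H) (\<lambda>_. v0)"
  have T: "?T = pr" by (auto simp: proj_def pr_def)
  have "\<sigma> (\<rho> f) = poly_subst (\<lambda>i. \<sigma> (\<rho> (var i))) f"
    by (simp add: \<rho>_def \<sigma>_def poly_restrict_def poly_subst_poly_subst)
  also have "\<dots> = poly_subst (\<lambda>i. pullback ?T (var i)) f"
  proof (rule poly_subst_cong[OF assms])
    fix i assume "i < length e"
    then obtain a where a: "linear_form a" "lf a = var i" using var_lf by blast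
    have "\<sigma> (\<rho> (lf a)) = lf (\<lambda>v. a (pr v))" by (simp add: \<rho>_lf a(1) \<sigma>_lf)
    also have "\<dots> = pullback ?T (lf a)" unfolding T by (rule pullback_lf[symmetric]) (use a in auto)
    finally show "\<sigma> (\<rho> (var i)) = pullback ?T (var i)" by (simp only: a(2))
  qed
  also have "\<dots> = pullback ?T f" by (simp add: pullback_def)
  finally have "pullback ?T f = 0" using 0 by simp
  then show "\<alpha> dvd f" using pullback_lf_dvd_iff[OF df_linear[OF H_in_A], of v0] by simp
qed

text \<open>The coefficient of d\<alpha>_H in a basis of linear forms is the value of \<eta> at the
  vector dual to \<alpha>_H. For a logarithmic form this value has the same restriction to H as the
  value at \<open>v0\<close>, so no basis enters here.\<close>

definition J :: "'a mpoly set" where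
  "J = {r \<in> polys (length b). \<exists>\<eta>\<in>Log. \<rho> (\<eta> v0) = R.Q * r}"

lemma Log_H: "\<eta> \<in> Log \<Longrightarrow> w \<in> H \<Longrightarrow> \<alpha> dvd \<eta> w" by (rule Log_dvd[OF _ H_in_A])

lemma \<rho>_Log_normal:
  assumes "\<eta> \<in> Log" "df H v = 1" shows "\<rho> (\<eta> v) = \<rho> (\<eta> v0)"
proof -
  have "v - v0 \<in> H" by (simp add: mem_H_iff H_lin assms(2))
  then have "\<alpha> dvd \<eta> (v - v0)" by (rule Log_H[OF assms(1)])
  then have "\<rho> \<alpha> dvd \<rho> (\<eta> (v - v0))" by (rule \<rho>_dvd)
  then show ?thesis by (simp add: poly_form_diff[OF Log_form[OF assms(1)]])
qed

text \<open>\<open>dual_basis\<close> speaks of forms only. The vector is read off the expansions of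
  the coordinate functions in the given forms; expanding each given form through the coordinates and
  comparing with its trivial expansion yields the required values.\<close>

lemma dual_basis_vector:
  assumes "dual_basis UNIV (a # as)"
  shows "\<exists>v. a v = 1 \<and> (\<forall>j<length as. (as ! j) v = 0)"
proof -
  let ?l = "a # as"
  have lin: "linear_form (?l ! k)" if "k < length ?l" for k
    using assms nth_mem[OF that] unfolding dual_basis_def by blast
  define rep where "rep = (\<lambda>\<beta> c. c \<in> {..<length ?l} \<rightarrow>\<^sub>E UNIV \<and> (\<forall>w\<in>UNIV. \<beta> w = (\<Sum>i<length ?l. c i * (?l ! i) w)))"
  have uniq: "linear_form \<beta> \<Longrightarrow> \<exists>!c. rep \<beta> c" for \<beta>
    unfolding rep_def by (rule conjunct2[OF assms[unfolded dual_basis_def], rule_format])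
  have "\<forall>i\<in>{..<length e}. \<exists>c. \<forall>w. coord w i = (\<Sum>k<length ?l. c k * (?l ! k) w)"
  proof
    fix i assume "i \<in> {..<length e}"
    then obtain x where x: "linear_form x" "\<forall>w\<in>UNIV. x w = coord w i" using var_lf by blast
    obtain c where "rep x c" using uniq[OF x(1)] by blast
    then have "\<forall>w. coord w i = (\<Sum>k<length ?l. c k * (?l ! k) w)" unfolding rep_def using x(2) by simp
    then show "\<exists>c. \<forall>w. coord w i = (\<Sum>k<length ?l. c k * (?l ! k) w)" by (rule exI[of _ c])
  qed
  then obtain C where C: "\<And>i w. i < length e \<Longrightarrow> coord w i = (\<Sum>k<length ?l. C i k * (?l ! k) w)"
    unfolding bchoice_iff by auto
  define v where "v = (\<Sum>i<length e. C i 0 *s e ! i)"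
  have val: "(?l ! k) v = (if k = 0 then 1 else 0)" if k: "k < length ?l" for k
  proof -
    let ?\<beta> = "?l ! k"
    let ?c = "\<lambda>j\<in>{..<length ?l}. \<Sum>i<length e. ?\<beta> (e ! i) * C i j" and ?d = "\<lambda>j\<in>{..<length ?l}. if j = k then 1 else 0"
    have 1: "?\<beta> w = (\<Sum>j<length ?l. ?c j * (?l ! j) w)" for w
    proof -
      have "?\<beta> w = (\<Sum>i<length e. coord w i * ?\<beta> (e ! i))" by (rule linear_form_coord[OF lin[OF k] UNIV_I])
      also have "\<dots> = (\<Sum>i<length e. \<Sum>j<length ?l. ?\<beta> (e ! i) * C i j * (?l ! j) w)"
        by (intro sum.cong refl) (simp only: C lessThan_iff sum_distrib_right sum_distrib_left mult_ac)
      also have "\<dots> = (\<Sum>j<length ?l. \<Sum>i<length e. ?\<beta> (e ! i) * C i j * (?l ! j) w)" by (rule sum.swap)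
      also have "\<dots> = (\<Sum>j<length ?l. ?c j * (?l ! j) w)"
        by (intro sum.cong refl) (simp only: restrict_apply' sum_distrib_right)
      finally show ?thesis .
    qed
    have 2: "?\<beta> w = (\<Sum>j<length ?l. ?d j * (?l ! j) w)" for w
    proof -
      have "(\<Sum>j<length ?l. ?d j * (?l ! j) w) = (\<Sum>j<length ?l. if j = k then (?l ! j) w else 0)"
        by (intro sum.cong refl) (simp only: restrict_apply', simp)
      also have "\<dots> = ?\<beta> w" using k by (simp only: sum.delta finite_lessThan lessThan_iff if_True)
      finally show ?thesis by simp
    qed
    have mem: "restrict h {..<length ?l} \<in> {..<length ?l} \<rightarrow>\<^sub>E UNIV" for h :: "nat \<Rightarrow> 'a"
      by (simp add: restrict_PiE_iff)
    have "rep ?\<beta> ?c" unfolding rep_def by (rule conjI[OF mem ballI]) (rule 1)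
    moreover have "rep ?\<beta> ?d" unfolding rep_def by (rule conjI[OF mem ballI]) (rule 2)
    ultimately have "?c = ?d" by (rule ex1_unique[OF uniq[OF lin[OF k]]])
    then have "?c 0 = ?d 0" by (rule fun_cong)
    moreover have "?\<beta> v = (\<Sum>i<length e. ?\<beta> (e ! i) * C i 0)"
      unfolding v_def by (simp add: linear_form_simps[OF lin[OF k]] mult.commute)
    ultimately show ?thesis by auto
  qed
  show ?thesis using val[of 0] val[of "Suc _"] by (intro exI[of _ v]) auto
qed

text \<open>The dual vectors of this basis are \<open>v0\<close> and the members of
  \<open>b\<close>, which determines the coefficients of every linear form.\<close>

lemma exists_dual_basis:
  obtains as where "dual_basis UNIV (df H # as)" "length as = length b"
    "\<And>j w. j < length b \<Longrightarrow> (as ! j) w = R.coord (pr w) j"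
proof -
  have "\<forall>j\<in>{..<length b}. \<exists>a. linear_form a \<and> (\<forall>w\<in>H. a w = R.coord w j)" using R.var_lf by blast
  then obtain a where a: "\<And>j. j < length b \<Longrightarrow> linear_form (a j)" "\<And>j w. j < length b \<Longrightarrow> w \<in> H \<Longrightarrow> a j w = R.coord w j"
    unfolding bchoice_iff by auto
  define as where "as = map (\<lambda>j w. a j (pr w)) [0..<length b]"
  have len: "length as = length b" by (simp add: as_def)
  have val: "(as ! j) w = R.coord (pr w) j" if "j < length b" for j w
    using that a(2) by (simp add: as_def)
  have lin: "linear_form \<beta>" if "\<beta> \<in> set (df H # as)" for \<beta>
    using that a(1) linear_form_pr df_linear[OF H_in_A] by (auto simp: as_def)
  have sum: "(\<Sum>i<length (df H # as). c i * ((df H # as) ! i) w) = c 0 * df H w + (\<Sum>j<length b. c (Suc j) * R.coord (pr w) j)" for c w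
    by (simp add: sum.lessThan_Suc_shift len val del: sum.lessThan_Suc)
  have "\<exists>!c. c \<in> {..<length (df H # as)} \<rightarrow>\<^sub>E UNIV \<and> (\<forall>w\<in>UNIV. \<beta> w = (\<Sum>i<length (df H # as). c i * ((df H # as) ! i) w))"
    if \<beta>: "linear_form \<beta>" for \<beta>
  proof (rule ex1I)
    define c where "c = (\<lambda>i\<in>{..<length (df H # as)}. case i of 0 \<Rightarrow> \<beta> v0 | Suc j \<Rightarrow> \<beta> (b ! j))"
    have c: "c 0 = \<beta> v0" "\<And>j. j < length b \<Longrightarrow> c (Suc j) = \<beta> (b ! j)" by (simp_all add: c_def len)
    show "c \<in> {..<length (df H # as)} \<rightarrow>\<^sub>E UNIV \<and> (\<forall>w\<in>UNIV. \<beta> w = (\<Sum>i<length (df H # as). c i * ((df H # as) ! i) w))"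
    proof (intro conjI ballI)
      show "c \<in> {..<length (df H # as)} \<rightarrow>\<^sub>E UNIV" by (simp add: c_def)
      fix w
      have "\<beta> w = \<beta> (pr w) + df H w * \<beta> v0" by (simp add: pr_def linear_form_simps[OF \<beta>])
      also have "\<beta> (pr w) = (\<Sum>j<length b. R.coord (pr w) j * \<beta> (b ! j))" by (rule R.linear_form_coord[OF \<beta> pr_in_H])
      finally show "\<beta> w = (\<Sum>i<length (df H # as). c i * ((df H # as) ! i) w)"
        unfolding sum by (simp add: c mult.commute)
    qed
    fix d assume d: "d \<in> {..<length (df H # as)} \<rightarrow>\<^sub>E UNIV \<and> (\<forall>w\<in>UNIV. \<beta> w = (\<Sum>i<length (df H # as). d i * ((df H # as) ! i) w))"
    then have dw: "\<beta> w = d 0 * df H w + (\<Sum>j<length b. d (Suc j) * R.coord (pr w) j)" for w unfolding sum by blast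
    have "R.coord 0 j = 0" for j by (simp add: R.coord_def representation_zero)
    then have "d 0 = \<beta> v0" using dw[of v0] by simp
    moreover have "d (Suc j) = \<beta> (b ! j)" if "j < length b" for j
    proof -
      have "df H (b ! j) = 0" using that by (simp add: mem_H_iff[symmetric])
      then have "\<beta> (b ! j) = (\<Sum>k<length b. if k = j then d (Suc k) else 0)"
        using dw[of "b ! j"] that by (simp add: pr_id R.coord_nth if_distrib cong: if_cong)
      then show ?thesis using that by simp
    qed
    ultimately have "d i = c i" if "i < length (df H # as)" for i
      using that c len by (cases i) auto
    moreover have "c \<in> {..<length (df H # as)} \<rightarrow>\<^sub>E UNIV" by (simp add: c_def)
    ultimately show "d = c" using d by (intro PiE_ext[of d "{..<length (df H # as)}" "\<lambda>_. UNIV"]) auto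
  qed
  then have "dual_basis UNIV (df H # as)" unfolding dual_basis_def using lin by blast
  then show ?thesis using that len val by blast
qed

text \<open>Evaluation at the vector dual to \<open>df H\<close> isolates \<open>f 0\<close> and
  identifies \<open>g\<close> with a value of \<eta>. Conversely, in the basis of
  \<open>exists_dual_basis\<close> that vector is \<open>v0\<close>.\<close>

theorem residue_ideal_eq: "residue_ideal e b A H = J"
proof (intro equalityI subsetI)
  fix r assume "r \<in> residue_ideal e b A H"
  then obtain \<omega> as f g where w: "\<omega> \<in> log_forms e A" and db: "dual_basis UNIV (df H # as)"
    and w_eq: "\<omega> = (\<lambda>i. f 0 * form_diff e (df H) i + (\<Sum>j<length as. f (Suc j) * form_diff e (as ! j) i))"
    and g: "g \<in> polys (length e)" "r \<in> polys (length b)" "emb g = emb Q * f 0"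
    and r: "emb r = emb (\<rho> g) / emb R.Q"
    unfolding residue_ideal_def is_residue_def span_e arr_poly_eq R.arr_poly_eq \<rho>_def by blast
  obtain \<eta> where \<eta>: "\<eta> \<in> Log" "\<omega> = ratio_form \<eta>" using log_formsE[OF w] .
  obtain v where v: "df H v = 1" "\<And>j. j < length as \<Longrightarrow> (as ! j) v = 0" using dual_basis_vector[OF db] by blast
  have lin: "linear_form (as ! j)" if "j < length as" for j
    using db nth_mem[OF that] unfolding dual_basis_def by simp
  have diff: "(\<Sum>i<length e. emb (const (coord v i)) * form_diff e a i) = emb (const (a v))" if "linear_form a" for a
  proof -
    have "(\<Sum>i<length e. emb (const (coord v i)) * form_diff e a i) = emb (const (\<Sum>i<length e. coord v i * a (e ! i)))"
      by (simp add: form_diff_def const_sum emb_sum const_mult)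
    then show ?thesis using linear_form_coord[OF that UNIV_I, of v] by simp
  qed
  have "emb (\<eta> v) = (\<Sum>i<length e. emb (const (coord v i)) * emb (\<eta> (e ! i)))"
    unfolding poly_form_coord[OF Log_form[OF \<eta>(1)] UNIV_I, of v] by (simp add: emb_sum)
  also have "\<dots> = (\<Sum>i<length e. emb (const (coord v i)) * (emb Q * \<omega> i))"
    by (intro sum.cong refl) (simp add: \<eta>(2) ratio_form_def)
  also have "\<dots> = emb Q * (\<Sum>i<length e. emb (const (coord v i)) * \<omega> i)"
    by (simp add: sum_distrib_left mult_ac)
  also have "(\<Sum>i<length e. emb (const (coord v i)) * \<omega> i) = f 0 * (\<Sum>i<length e. emb (const (coord v i)) * form_diff e (df H) i)
      + (\<Sum>i<length e. \<Sum>j<length as. f (Suc j) * (emb (const (coord v i)) * form_diff e (as ! j) i))"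
    unfolding w_eq by (simp add: distrib_left sum.distrib sum_distrib_left mult_ac)
  also have "(\<Sum>i<length e. \<Sum>j<length as. f (Suc j) * (emb (const (coord v i)) * form_diff e (as ! j) i))
      = (\<Sum>j<length as. f (Suc j) * (\<Sum>i<length e. emb (const (coord v i)) * form_diff e (as ! j) i))"
    by (subst sum.swap) (simp add: sum_distrib_left)
  also have "\<dots> = 0" by (intro sum.neutral ballI) (simp add: diff lin v)
  finally have "emb (\<eta> v) = emb g" using g(3) by (simp add: diff df_linear[OF H_in_A] v)
  then have "\<eta> v = g" by (simp only: emb_simps(6))
  moreover have "\<rho> g = R.Q * r"
  proof -
    have "emb (\<rho> g) = emb (R.Q * r)" using r by (simp add: divide_simps mult.commute)
    then show ?thesis by (simp only: emb_simps(6))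
  qed
  ultimately show "r \<in> J" using \<rho>_Log_normal[OF \<eta>(1) v(1)] \<eta>(1) g(2) by (auto simp: J_def)
next
  fix r assume "r \<in> J"
  then obtain \<eta> where r: "r \<in> polys (length b)" and \<eta>: "\<eta> \<in> Log" "\<rho> (\<eta> v0) = R.Q * r" by (auto simp: J_def)
  obtain as where db: "dual_basis UNIV (df H # as)" and len: "length as = length b"
    and val: "\<And>j w. j < length b \<Longrightarrow> (as ! j) w = R.coord (pr w) j" by (rule exists_dual_basis) blast
  note form = Log_form[OF \<eta>(1)]
  have formH: "poly_form H (length e) \<eta>" using form by (auto simp: poly_form_def)
  define f where "f = (\<lambda>k. case k of 0 \<Rightarrow> emb (\<eta> v0) / emb Q | Suc j \<Rightarrow> emb (\<eta> (b ! j)) / emb Q)"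
  have eq: "ratio_form \<eta> = (\<lambda>i. f 0 * form_diff e (df H) i + (\<Sum>j<length as. f (Suc j) * form_diff e (as ! j) i))"
  proof
    fix i
    show "ratio_form \<eta> i = f 0 * form_diff e (df H) i + (\<Sum>j<length as. f (Suc j) * form_diff e (as ! j) i)"
    proof (cases "i < length e")
      case True
      let ?w = "e ! i"
      have "\<eta> ?w = \<eta> (pr ?w + df H ?w *s v0)" by (simp add: pr_def)
      also have "\<dots> = \<eta> (pr ?w) + const (df H ?w) * \<eta> v0" by (simp add: poly_form_add[OF form] poly_form_scale[OF form])
      also have "\<eta> (pr ?w) = (\<Sum>j<length b. const (R.coord (pr ?w) j) * \<eta> (b ! j))"
        by (rule R.poly_form_coord[OF formH pr_in_H])
      finally have "emb (\<eta> ?w) = (\<Sum>j<length b. emb (const (R.coord (pr ?w) j)) * emb (\<eta> (b ! j))) + emb (const (df H ?w)) * emb (\<eta> v0)"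
        by (simp add: emb_sum)
      then show ?thesis using True
        by (simp add: ratio_form_def f_def form_diff_def len val add_divide_distrib sum_divide_distrib mult_ac)
    qed (simp add: ratio_form_def form_diff_def)
  qed
  have "is_residue e b A H (ratio_form \<eta>) r"
    unfolding is_residue_def span_e arr_poly_eq R.arr_poly_eq \<rho>_def[symmetric]
  proof (intro exI conjI)
    show "emb (\<eta> v0) = emb Q * f 0" by (simp add: f_def)
    show "emb r = emb (\<rho> (\<eta> v0)) / emb R.Q" by (simp add: \<eta>(2))
    show "\<eta> v0 \<in> polys (length e)" by (rule poly_form_in_polys[OF form UNIV_I])
  qed (use db eq r in auto)
  then show "r \<in> residue_ideal e b A H"
    unfolding residue_ideal_def using ratio_form_in_log_forms[OF \<eta>(1)] by blast
qed

end

section \<open>The multirestriction\<close>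

lemma (in based_space) dual_system_extend:
  assumes d: "dual_system m p u" and q: "linear_form q" "w \<in> W" "q w \<noteq> 0" "\<And>k. k < m \<Longrightarrow> p k w = 0"
  shows "\<exists>u'. dual_system (Suc m) (p(m := q)) u'"
proof -
  define x where "x = inverse (q w) *s w"
  have x: "x \<in> W" "q x = 1" "\<And>k. k < m \<Longrightarrow> p k x = 0"
    using q d by (simp_all add: x_def linear_form_simps[OF q(1)] dual_system_def linear_form_scale)
  \<comment> \<open>The old dual vectors are corrected by multiples of \<open>x\<close> to make
    \<open>q\<close> vanish on them; the forms \<open>p k\<close> vanish at \<open>x\<close>, so
    their values do not change.\<close>
  define u' where "u' = (\<lambda>k. if k = m then x else u k - q (u k) *s x)"
  have "dual_system (Suc m) (p(m := q)) u'"
    unfolding dual_system_def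
  proof (intro conjI allI impI)
    fix k assume "k < Suc m"
    then show "linear_form ((p(m := q)) k)" "u' k \<in> W"
      using d q x by (auto simp: u'_def dual_system_def less_Suc_eq)
  next
    fix j k assume "j < Suc m" "k < Suc m"
    moreover have "linear_form (p j)" if "j < m" using d that by (simp add: dual_system_def)
    ultimately show "(p(m := q)) j (u' k) = (if j = k then 1 else 0)"
      using d x q by (auto simp: u'_def dual_system_def less_Suc_eq linear_form_simps)
  qed
  then show ?thesis by blast
qed

lemma (in based_arrangement) dual_system_pair:
  assumes "L \<in> A" "M \<in> A" "L \<noteq> M"
  shows "\<exists>u. dual_system 2 ((\<lambda>_. df L)(1 := df M)) u"
proof -
  obtain u where u: "u \<in> W" "df L u = 1" using df_normal[OF assms(1)] .
  obtain w where w: "w \<in> L" "w \<notin> M" using hyperplane_subset_eq[OF assms(1,2)] assms(3) by blast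
  have wW: "w \<in> W" using hyperplane_subset[OF assms(1)] w by blast
  show ?thesis
    using dual_system_extend[OF dual_system_1[OF df_linear[OF assms(1)] u] df_linear[OF assms(2)] wW]
      df_eq_0_iff[OF assms(1) wW] df_eq_0_iff[OF assms(2) wW] w by (simp add: numeral_2_eq_2)
qed

lemma prod_const_mult:
  assumes "finite I" "\<And>i. i \<in> I \<Longrightarrow> \<exists>c. c \<noteq> 0 \<and> f i = const c * g i"
  shows "\<exists>c. c \<noteq> 0 \<and> prod f I = const c * prod g I"
  using assms
proof (induction I)
  case empty
  show ?case by (intro exI[of _ 1]) simp
next
  case (insert i I)
  then obtain c d where "c \<noteq> 0" "prod f I = const c * prod g I" "d \<noteq> 0" "f i = const d * g i" by blast
  then show ?case using insert.hyps by (intro exI[of _ "d * c"]) (simp add: const_mult mult_ac)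
qed

text \<open>Used in place of associated primes: if a product of \<open>f\<^sub>i\<close> kills \<open>h\<close> modulo an ideal \<open>M\<close>, some nonzero
  multiple of \<open>h\<close> is killed by a single \<open>f\<^sub>i\<close>.\<close>

lemma exists_last_factor:
  fixes f :: "'i \<Rightarrow> 'k::field mpoly"
  assumes "finite I" "\<And>i. i \<in> I \<Longrightarrow> f i \<in> polys n" "M (h * (\<Prod>i\<in>I. f i ^ k i))" "\<not> M h"
  shows "\<exists>c\<in>polys n. \<exists>i\<in>I. \<not> M (h * c) \<and> M (h * c * f i)"
  using assms
proof (induction I arbitrary: h)
  case (insert j I)
  show ?case
  proof (cases "M (h * f j ^ k j)")
    case True
    \<comment> \<open>The exponent just before the least one that kills \<open>h\<close> gives the
      multiplier, and \<open>f j\<close> is the single factor.\<close>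
    define r where "r = (LEAST r. M (h * f j ^ r))"
    have r: "M (h * f j ^ r)" unfolding r_def by (rule LeastI) (rule True)
    then obtain s where s: "r = Suc s" using insert.prems(3) by (cases r) auto
    have "\<not> M (h * f j ^ s)" using not_less_Least[of s "\<lambda>r. M (h * f j ^ r)"] s by (simp add: r_def)
    moreover have "M (h * f j ^ s * f j)" using r by (simp add: s mult_ac)
    ultimately show ?thesis using insert.prems(1) by (intro bexI[of _ "f j ^ s"] bexI[of _ j]) auto
  next
    case False
    have "M (h * f j ^ k j * (\<Prod>i\<in>I. f i ^ k i))" using insert.prems(2) insert.hyps by (simp add: mult.assoc)
    then obtain c i where "c \<in> polys n" "i \<in> I" "\<not> M (h * f j ^ k j * c)" "M (h * f j ^ k j * c * f i)"
      using insert.IH[of "h * f j ^ k j"] insert.prems(1) False by blast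
    then show ?thesis using insert.prems(1)
      by (intro bexI[of _ "f j ^ k j * c"] bexI[of _ i]) (auto simp: mult.assoc)
  qed
qed simp

context arr_restriction
begin

section \<open>Multiplicities on the restriction and the multirestriction\<close>

abbreviation AH :: "'b set set" where "AH \<equiv> arr_restrict A H"
abbreviation ry :: "'b set \<Rightarrow> 'a mpoly" where "ry Y \<equiv> R.lf (R.df Y)"

definition mu :: "'b set \<Rightarrow> nat" where "mu Y = card {L \<in> A. L \<noteq> H \<and> H \<inter> L = Y}"

text \<open>A lift of \<open>pw T\<close> to V, up to the nonzero scalar in
  \<open>\<rho>_part\<close>; the scalars arise because defining forms are chosen independently on V
  and on H.\<close>

definition part :: "'b set set \<Rightarrow> 'a mpoly" where
  "part T = (\<Prod>L\<in>{L \<in> A. L \<noteq> H \<and> H \<inter> L \<in> T}. lf (df L))"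

definition pw :: "'b set set \<Rightarrow> 'a mpoly" where "pw T = (\<Prod>Y\<in>T. ry Y ^ mu Y)"

lemma restrict_mem: "L \<in> A \<Longrightarrow> L \<noteq> H \<Longrightarrow> H \<inter> L \<in> AH" by (auto simp: arr_restrict_def)

lemma mu_pos: "Y \<in> AH \<Longrightarrow> 0 < mu Y"
  unfolding mu_def using finite_A by (subst card_gt_0_iff) (auto simp: arr_restrict_def)

lemma part_in_polys [simp]: "part T \<in> polys (length e)" unfolding part_def by (intro polys_prod lf_in_polys)
lemma pw_in_polys [simp]: "pw T \<in> polys (length b)" unfolding pw_def by (intro polys_prod polys_power R.lf_in_polys)

lemma Q_eq: "Q = \<alpha> * part AH"
proof -
  have "{L \<in> A. L \<noteq> H \<and> H \<inter> L \<in> AH} = A - {H}" using restrict_mem by blast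
  then show ?thesis unfolding Q_def part_def by (simp add: prod.remove[OF finite_A H_in_A])
qed

lemma df_dvd_part: "L \<in> A \<Longrightarrow> L \<noteq> H \<Longrightarrow> H \<inter> L \<in> T \<Longrightarrow> lf (df L) dvd part T"
  unfolding part_def by (rule dvd_prodI) (use finite_A in auto)

lemma \<rho>_df:
  assumes L: "L \<in> A" "L \<noteq> H" shows "\<exists>c. c \<noteq> 0 \<and> \<rho> (lf (df L)) = const c * ry (H \<inter> L)"
proof -
  let ?Y = "H \<inter> L"
  have Y: "?Y \<in> AH" using L by (rule restrict_mem)
  obtain u where u: "u \<in> H" "R.df ?Y u = 1" using R.df_normal[OF Y] .
  have "u \<notin> L" using u R.df_eq_0_iff[OF Y u(1)] by auto
  then have nz: "df L u \<noteq> 0" using df_eq_0_iff[OF L(1)] by simp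
  have *: "df L w = df L u * R.df ?Y w" if "w \<in> H" for w
  proof -
    have "w - R.df ?Y w *s u \<in> L" using R.proj_in_hyperplane[OF Y u that] by blast
    then have "df L (w - R.df ?Y w *s u) = 0" using df_eq_0_iff[OF L(1)] by simp
    then show ?thesis by (simp add: linear_form_simps[OF df_linear[OF L(1)]])
  qed
  have "\<rho> (lf (df L)) = R.lf (df L)" by (rule \<rho>_lf[OF df_linear[OF L(1)]])
  also have "\<dots> = R.lf (\<lambda>w. df L u * R.df ?Y w)" by (rule R.lf_cong) (simp add: *)
  also have "\<dots> = const (df L u) * ry ?Y" by (rule R.lf_cmult)
  finally show ?thesis using nz by blast
qed

lemma \<rho>_part:
  assumes "T \<subseteq> AH" shows "\<exists>c. c \<noteq> 0 \<and> \<rho> (part T) = const c * pw T"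
proof -
  let ?S = "{L \<in> A. L \<noteq> H \<and> H \<inter> L \<in> T}"
  have fin: "finite ?S" "finite T" using finite_A R.finite_A assms finite_subset by auto
  have "\<exists>c. c \<noteq> 0 \<and> (\<Prod>L\<in>?S. \<rho> (lf (df L))) = const c * (\<Prod>L\<in>?S. ry (H \<inter> L))"
    by (rule prod_const_mult[OF fin(1)]) (use \<rho>_df in auto)
  moreover have "(\<Prod>L\<in>?S. ry (H \<inter> L)) = pw T"
  proof -
    have "(\<Prod>L\<in>?S. ry (H \<inter> L)) = (\<Prod>Y\<in>T. \<Prod>L\<in>{L \<in> ?S. H \<inter> L = Y}. ry (H \<inter> L))"
      by (rule prod.group[symmetric]) (use fin in auto)
    also have "\<dots> = pw T"
      unfolding pw_def
    proof (intro prod.cong refl)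
      fix Y assume "Y \<in> T"
      then have "{L \<in> ?S. H \<inter> L = Y} = {L \<in> A. L \<noteq> H \<and> H \<inter> L = Y}" by auto
      moreover have "(\<Prod>L\<in>{L \<in> A. L \<noteq> H \<and> H \<inter> L = Y}. ry (H \<inter> L)) = ry Y ^ mu Y"
        unfolding mu_def by (subst prod_constant[symmetric], intro prod.cong) auto
      ultimately show "(\<Prod>L\<in>{L \<in> ?S. H \<inter> L = Y}. ry (H \<inter> L)) = ry Y ^ mu Y" by simp
    qed
    finally show ?thesis .
  qed
  ultimately show ?thesis by (simp add: part_def)
qed

definition \<beta> :: "'a mpoly" where "\<beta> = (\<Prod>Y\<in>AH. ry Y ^ (mu Y - 1))"

lemma \<beta>_in_polys [simp]: "\<beta> \<in> polys (length b)" unfolding \<beta>_def by (intro polys_prod polys_power R.lf_in_polys)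

lemma Q_\<beta>: "R.Q * \<beta> = pw AH"
  unfolding R.Q_def \<beta>_def pw_def prod.distrib[symmetric]
  by (intro prod.cong refl) (metis mu_pos power_eq_if less_not_refl3 neq0_conv)

lemma \<rho>_part_AH: "\<exists>c. c \<noteq> 0 \<and> \<rho> (part AH) = const c * (R.Q * \<beta>)"
  using \<rho>_part[of AH] by (simp add: Q_\<beta>)

text \<open>The forms of the Ziegler multirestriction of \<open>A\<close> to \<open>H\<close>, which gives \<open>Y\<close> the multiplicity \<open>mu Y\<close>.\<close>

definition Wm :: "('b \<Rightarrow> 'a mpoly) set" where
  "Wm = {\<xi>. poly_form H (length b) \<xi> \<and> (\<forall>Y\<in>AH. \<forall>w\<in>Y. ry Y ^ mu Y dvd \<xi> w)}"

lemma Wm_form: "\<xi> \<in> Wm \<Longrightarrow> poly_form H (length b) \<xi>"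
  and Wm_dvd: "\<xi> \<in> Wm \<Longrightarrow> Y \<in> AH \<Longrightarrow> w \<in> Y \<Longrightarrow> ry Y ^ mu Y dvd \<xi> w"
  by (simp_all add: Wm_def)

lemma Wm_plus: "\<xi> \<in> Wm \<Longrightarrow> \<zeta> \<in> Wm \<Longrightarrow> (\<lambda>w. \<xi> w + \<zeta> w) \<in> Wm"
  and Wm_minus: "\<xi> \<in> Wm \<Longrightarrow> \<zeta> \<in> Wm \<Longrightarrow> (\<lambda>w. \<xi> w - \<zeta> w) \<in> Wm"
  and Wm_cmult: "\<xi> \<in> Wm \<Longrightarrow> f \<in> polys (length b) \<Longrightarrow> (\<lambda>w. f * \<xi> w) \<in> Wm"
  by (simp_all add: Wm_def poly_form_plus poly_form_minus poly_form_cmult)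

text \<open>\<open>R.euler \<xi>\<close> is the contraction of \<open>\<xi>\<close> with the Euler derivation of \<open>H\<close>. Up to multiples of \<open>\<beta>\<close> and sign, the
  residue of a form is this contraction, applied to its image in \<open>Wm\<close> and divided by \<open>R.Q\<close>.\<close>

definition J' :: "'a mpoly set" where
  "J' = {g \<in> polys (length b). \<exists>\<xi>\<in>Wm. R.euler \<xi> = R.Q * g}"

lemma J'_add: "f \<in> J' \<Longrightarrow> g \<in> J' \<Longrightarrow> f + g \<in> J'"
proof -
  assume "f \<in> J'" "g \<in> J'"
  then obtain \<xi> \<zeta> where *: "\<xi> \<in> Wm" "\<zeta> \<in> Wm" "R.euler \<xi> = R.Q * f" "R.euler \<zeta> = R.Q * g"
    "f \<in> polys (length b)" "g \<in> polys (length b)" by (auto simp: J'_def)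
  have "R.euler (\<lambda>w. \<xi> w + \<zeta> w) = R.Q * (f + g)" by (simp add: R.euler_add * distrib_left)
  then show ?thesis using Wm_plus[OF *(1,2)] *(5,6) unfolding J'_def by (intro CollectI conjI bexI) auto
qed

lemma J'_mult: "g \<in> J' \<Longrightarrow> f \<in> polys (length b) \<Longrightarrow> f * g \<in> J'"
proof -
  assume "g \<in> J'" and f: "f \<in> polys (length b)"
  then obtain \<xi> where *: "\<xi> \<in> Wm" "R.euler \<xi> = R.Q * g" "g \<in> polys (length b)" by (auto simp: J'_def)
  have "R.euler (\<lambda>w. f * \<xi> w) = R.Q * (f * g)" by (simp add: R.euler_cmult * mult_ac)
  then show ?thesis using Wm_cmult[OF *(1) f] *(3) f unfolding J'_def by (intro CollectI conjI bexI) auto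
qed

lemma J_add: "f \<in> J \<Longrightarrow> g \<in> J \<Longrightarrow> f + g \<in> J"
proof -
  assume "f \<in> J" "g \<in> J"
  then obtain \<xi> \<zeta> where *: "\<xi> \<in> Log" "\<zeta> \<in> Log" "\<rho> (\<xi> v0) = R.Q * f" "\<rho> (\<zeta> v0) = R.Q * g"
    "f \<in> polys (length b)" "g \<in> polys (length b)" by (auto simp: J_def)
  have "\<rho> (\<xi> v0 + \<zeta> v0) = R.Q * (f + g)" by (simp add: * distrib_left)
  then show ?thesis using Log_plus[OF *(1,2)] *(5,6) unfolding J_def by (intro CollectI conjI bexI) auto
qed

lemma J_mult: "g \<in> J \<Longrightarrow> f \<in> polys (length b) \<Longrightarrow> f * g \<in> J"
proof -
  assume "g \<in> J" and f: "f \<in> polys (length b)"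
  then obtain \<xi> where *: "\<xi> \<in> Log" "\<rho> (\<xi> v0) = R.Q * g" "g \<in> polys (length b)" by (auto simp: J_def)
  have "\<rho> (\<sigma> f * \<xi> v0) = R.Q * (f * g)" by (simp add: * \<rho>_\<sigma> f mult_ac)
  then show ?thesis using Log_cmult[OF *(1) \<sigma>_in_polys[OF f]] *(3) f unfolding J_def
    by (intro CollectI conjI bexI) auto
qed

text \<open>The form d\<alpha>_Y vanishes on Y, so only the other hyperplanes constrain
  \<open>F\<close>.\<close>

lemma linear_form_in_Wm:
  assumes Y: "Y \<in> AH" and F: "F \<in> polys (length b)" "\<And>Z. Z \<in> AH \<Longrightarrow> Z \<noteq> Y \<Longrightarrow> ry Z ^ mu Z dvd F"
  shows "(\<lambda>w. const (R.df Y w) * F) \<in> Wm"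
  unfolding Wm_def
proof (intro CollectI conjI ballI)
  show "poly_form H (length b) (\<lambda>w. const (R.df Y w) * F)" by (rule poly_form_linear_form[OF R.df_linear[OF Y] F(1)])
  fix Z w assume Z: "Z \<in> AH" "w \<in> Z"
  show "ry Z ^ mu Z dvd const (R.df Y w) * F"
  proof (cases "Z = Y")
    case True
    then have "R.df Y w = 0" using R.df_kernel[OF Y] Z by blast
    then show ?thesis by simp
  qed (use F Z in simp)
qed

lemma RQ_factor:
  assumes Y: "Y \<in> AH" obtains q where "q \<in> polys (length b)" "R.Q = ry Y * q"
proof -
  have "ry Y dvd R.Q" unfolding R.Q_def by (rule dvd_prodI[OF R.finite_A Y])
  then obtain q where q: "R.Q = ry Y * q" by (auto elim: dvdE)
  have "q \<in> polys (length b)" by (rule polys_divide[of "ry Y"]) (use R.df_nonzero[OF Y] q[symmetric] in simp_all)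
  then show ?thesis using q that by blast
qed

text \<open>The form is \<open>R.Q * \<beta>\<close> times d\<alpha>_Y / \<alpha>_Y; contraction
  with the Euler derivation turns d\<alpha>_Y into \<alpha>_Y.\<close>

lemma \<beta>_form:
  assumes Y: "Y \<in> AH"
  shows "\<exists>F\<in>polys (length b). (\<lambda>w. const (R.df Y w) * F) \<in> Wm \<and> ry Y * F = R.Q * \<beta>"
proof -
  obtain q where q: "q \<in> polys (length b)" "R.Q = ry Y * q" by (rule RQ_factor[OF Y])
  have "(\<lambda>w. const (R.df Y w) * (q * \<beta>)) \<in> Wm"
  proof (rule linear_form_in_Wm[OF Y])
    show "q * \<beta> \<in> polys (length b)" using q by simp
    fix Z assume Z: "Z \<in> AH" "Z \<noteq> Y"
    have "ry Z ^ mu Z dvd ry Y * (q * \<beta>)"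
      unfolding mult.assoc[symmetric] q(2)[symmetric] Q_\<beta> pw_def by (rule dvd_prodI[OF R.finite_A Z(1)])
    then show "ry Z ^ mu Z dvd q * \<beta>"
      by (rule prime_elem_power_dvd_cancel[OF R.prime_df[OF Z(1)] R.df_not_dvd[OF Z(1) Y Z(2)]])
  qed
  then show ?thesis using q by (intro bexI[of _ "q * \<beta>"]) (simp_all add: mult.assoc)
qed

lemma \<beta>_in_J':
  assumes "Y \<in> AH" shows "\<beta> \<in> J'"
proof -
  obtain F where F: "(\<lambda>w. const (R.df Y w) * F) \<in> Wm" "ry Y * F = R.Q * \<beta>" using \<beta>_form[OF assms] by blast
  have "R.euler (\<lambda>w. const (R.df Y w) * F) = R.Q * \<beta>" unfolding R.euler_linear_form by (rule F(2))
  then show ?thesis using F(1) unfolding J'_def by auto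
qed

text \<open>For every \<open>Y\<close> this is an element of \<open>J'\<close> prime to \<alpha>_Y.
  It serves to find a linear form different from a given one, both in the last factor arguments and
  in primes containing \<open>J'\<close>.\<close>

lemma pw_in_J':
  assumes Y: "Y \<in> AH" shows "pw (AH - {Y}) \<in> J'"
proof -
  obtain q where q: "q \<in> polys (length b)" "R.Q = ry Y * q" by (rule RQ_factor[OF Y])
  let ?\<xi> = "\<lambda>w. const (R.df Y w) * (q * pw (AH - {Y}))"
  have "?\<xi> \<in> Wm"
  proof (rule linear_form_in_Wm[OF Y])
    show "q * pw (AH - {Y}) \<in> polys (length b)" using q by simp
    fix Z assume Z: "Z \<in> AH" "Z \<noteq> Y"
    have "ry Z ^ mu Z dvd pw (AH - {Y})"
      unfolding pw_def by (rule dvd_prodI) (use R.finite_A Z in auto)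
    then show "ry Z ^ mu Z dvd q * pw (AH - {Y})" by (rule dvd_mult)
  qed
  moreover have "R.euler ?\<xi> = R.Q * pw (AH - {Y})" unfolding R.euler_linear_form q(2) by (simp only: mult.assoc)
  ultimately show ?thesis unfolding J'_def by auto
qed

text \<open>\<open>\<eta> / \<alpha>\<close> restricts to \<open>\<xi>\<close> on \<open>H\<close>.\<close>

definition lifts :: "('b \<Rightarrow> 'a mpoly) \<Rightarrow> ('b \<Rightarrow> 'a mpoly) \<Rightarrow> bool" where
  "lifts \<eta> \<xi> \<longleftrightarrow> (\<exists>\<zeta>. poly_form H (length e) \<zeta> \<and> (\<forall>w\<in>H. \<eta> w = \<alpha> * \<zeta> w \<and> \<rho> (\<zeta> w) = \<xi> w))"

lemma df_not_dvd_\<alpha>: "L \<in> A \<Longrightarrow> L \<noteq> H \<Longrightarrow> \<not> lf (df L) dvd \<alpha>"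
  using df_not_dvd H_in_A by blast

lemma df_dvd_cancel: "L \<in> A \<Longrightarrow> L \<noteq> H \<Longrightarrow> lf (df L) dvd \<alpha> * f \<Longrightarrow> lf (df L) dvd f"
  using df_not_dvd_\<alpha> prime_df by (metis prime_elem_dvd_mult_iff)

lemma \<alpha>_nonzero [simp]: "\<alpha> \<noteq> 0" by (rule df_nonzero[OF H_in_A])

lemma Log_divide:
  assumes "\<eta> \<in> Log"
  obtains \<zeta> where "poly_form H (length e) \<zeta>" "\<And>w. w \<in> H \<Longrightarrow> \<eta> w = \<alpha> * \<zeta> w"
proof (rule poly_form_divide[of H "length e" \<eta> \<alpha>])
  show "poly_form H (length e) \<eta>" using Log_form[OF assms] by (auto simp: poly_form_def)
qed (use that R.subspace_W Log_H[OF assms] in auto)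

text \<open>The \<open>mu Y\<close> hyperplanes of \<open>A\<close> that cut out \<open>Y\<close>
  have non-associate prime forms, all dividing the quotient on \<open>Y\<close>. Restricted to H
  these forms coincide up to scalars, which produces the power.\<close>

lemma Log_lifts:
  assumes "\<eta> \<in> Log" shows "\<exists>\<xi>\<in>Wm. lifts \<eta> \<xi>"
proof -
  obtain \<zeta> where z: "poly_form H (length e) \<zeta>" "\<And>w. w \<in> H \<Longrightarrow> \<eta> w = \<alpha> * \<zeta> w"
    by (rule Log_divide[OF assms]) blast
  have "(\<lambda>w. \<rho> (\<zeta> w)) \<in> Wm"
    unfolding Wm_def
  proof (intro CollectI conjI ballI)
    show "poly_form H (length b) (\<lambda>w. \<rho> (\<zeta> w))" using z(1) by (auto simp: poly_form_def)
    fix Y w assume Y: "Y \<in> AH" "w \<in> Y"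
    let ?S = "{L \<in> A. L \<noteq> H \<and> H \<inter> L \<in> {Y}}"
    have wH: "w \<in> H" using R.hyperplane_subset[OF Y(1)] Y(2) by blast
    have "part {Y} dvd \<zeta> w"
    proof -
      have "(\<Prod>L\<in>?S. lf (df L) ^ 1) dvd \<zeta> w"
      proof (rule prod_prime_powers_dvd)
        fix L assume L: "L \<in> ?S"
        then have "lf (df L) dvd \<eta> w" using Y(2) by (intro Log_dvd[OF assms]) auto
        then have "lf (df L) dvd \<alpha> * \<zeta> w" unfolding z(2)[OF wH] .
        then have "lf (df L) dvd \<zeta> w" by (rule df_dvd_cancel[rotated 2]) (use L in auto)
        then show "lf (df L) ^ 1 dvd \<zeta> w" unfolding power_one_right .
      qed (use finite_A prime_df df_not_dvd in auto)
      then show ?thesis by (simp add: part_def)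
    qed
    then have "\<rho> (part {Y}) dvd \<rho> (\<zeta> w)" by (rule \<rho>_dvd)
    moreover obtain c where "c \<noteq> 0" "\<rho> (part {Y}) = const c * pw {Y}" using \<rho>_part[of "{Y}"] Y(1) by auto
    ultimately show "ry Y ^ mu Y dvd \<rho> (\<zeta> w)" by (simp add: pw_def const_mult_dvd_iff)
  qed
  moreover have "lifts \<eta> (\<lambda>w. \<rho> (\<zeta> w))" unfolding lifts_def using z by blast
  ultimately show ?thesis by blast
qed

text \<open>The Euler derivation does not depend on a basis: every vector of H is the combination of
  the vectors \<open>pr (e ! i)\<close> whose coefficients are its coordinates in \<open>e\<close>,
  and these are the linear functions \<open>\<rho> (var i)\<close>.\<close>

lemma euler_restrict:
  assumes "poly_form H (length b) \<xi>"
  shows "(\<Sum>i<length e. \<rho> (var i) * \<xi> (pr (e ! i))) = R.euler \<xi>"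
proof -
  have "(\<Sum>i<length e. \<rho> (var i) * \<xi> (pr (e ! i))) =
      (\<Sum>i<length e. \<Sum>j<length b. var j * (const (coord (b ! j) i) * \<xi> (pr (e ! i))))"
    by (simp add: \<rho>_var sum_distrib_right sum_distrib_left mult_ac)
  also have "\<dots> = (\<Sum>j<length b. var j * (\<Sum>i<length e. const (coord (b ! j) i) * \<xi> (pr (e ! i))))"
    by (subst sum.swap) (simp add: sum_distrib_left)
  also have "\<dots> = R.euler \<xi>"
    unfolding R.euler_def
  proof (intro sum.cong refl)
    fix j assume "j \<in> {..<length b}"
    then have bj: "b ! j \<in> H" by simp
    have "(\<Sum>i<length e. const (coord (b ! j) i) * \<xi> (pr (e ! i))) = (\<Sum>i<length e. \<xi> (coord (b ! j) i *s pr (e ! i)))"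
      by (simp add: poly_form_scale[OF assms])
    also have "\<dots> = \<xi> (\<Sum>i<length e. coord (b ! j) i *s pr (e ! i))"
      by (rule R.poly_form_sum[OF assms, symmetric]) (simp add: subspace_scale[OF R.subspace_W])
    also have "(\<Sum>i<length e. coord (b ! j) i *s pr (e ! i)) = pr (\<Sum>i<length e. coord (b ! j) i *s e ! i)"
      by (simp add: pr_sum pr_scale)
    also have "\<dots> = b ! j" by (simp add: coord_expand pr_id bj)
    finally show "var j * (\<Sum>i<length e. const (coord (b ! j) i) * \<xi> (pr (e ! i))) = var j * \<xi> (b ! j)" by simp
  qed
  finally show ?thesis .
qed

lemma euler_Log_pr:
  assumes "\<eta> \<in> Log" shows "euler \<eta> = (\<Sum>i<length e. var i * \<eta> (pr (e ! i))) + \<alpha> * \<eta> v0"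
  using euler_proj_1[OF Log_form[OF assms] df_linear[OF H_in_A], of v0] by (simp add: pr_def)

text \<open>Divide \<open>euler_Log_pr\<close> by \<alpha> and restrict to H. Since
  \<open>\<rho> (part AH)\<close> is a scalar multiple of \<open>R.Q * \<beta>\<close>, contraction
  and residue are opposite modulo \<beta>.\<close>

lemma lifts_euler:
  assumes \<eta>: "\<eta> \<in> Log" and "lifts \<eta> \<xi>" and \<xi>: "poly_form H (length b) \<xi>" and f: "euler \<eta> = Q * f"
  shows "R.euler \<xi> + \<rho> (\<eta> v0) = \<rho> (part AH) * \<rho> f"
proof -
  obtain \<zeta> where z: "\<And>w. w \<in> H \<Longrightarrow> \<eta> w = \<alpha> * \<zeta> w" "\<And>w. w \<in> H \<Longrightarrow> \<rho> (\<zeta> w) = \<xi> w"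
    using assms(2) unfolding lifts_def by blast
  have "\<alpha> * ((\<Sum>i<length e. var i * \<zeta> (pr (e ! i))) + \<eta> v0) = euler \<eta>"
    unfolding euler_Log_pr[OF \<eta>] by (simp add: z(1) sum_distrib_left distrib_left mult_ac)
  also have "\<dots> = \<alpha> * (part AH * f)" by (simp add: f Q_eq mult.assoc)
  finally have "(\<Sum>i<length e. var i * \<zeta> (pr (e ! i))) + \<eta> v0 = part AH * f" by simp
  then have "\<rho> ((\<Sum>i<length e. var i * \<zeta> (pr (e ! i))) + \<eta> v0) = \<rho> (part AH * f)" by (rule arg_cong)
  then show ?thesis using euler_restrict[OF \<xi>] by (simp add: z(2))
qed

theorem J_subset_J':
  assumes Y: "Y \<in> AH" shows "J \<subseteq> J'"
proof
  fix r assume "r \<in> J"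
  then obtain \<eta> where r: "r \<in> polys (length b)" and \<eta>: "\<eta> \<in> Log" "\<rho> (\<eta> v0) = R.Q * r" by (auto simp: J_def)
  obtain \<xi> where \<xi>: "\<xi> \<in> Wm" "lifts \<eta> \<xi>" using Log_lifts[OF \<eta>(1)] by blast
  obtain f where f: "f \<in> polys (length e)" "euler \<eta> = Q * f"
    using euler_Log[OF \<eta>(1)] euler_in_polys[OF Log_form[OF \<eta>(1)]] by (elim polys_dvdE[where n = "length e"]) auto
  obtain c where c: "c \<noteq> 0" "\<rho> (part AH) = const c * (R.Q * \<beta>)" using \<rho>_part_AH by blast
  have "R.euler \<xi> = R.Q * (const c * \<rho> f * \<beta> - r)"
    using lifts_euler[OF \<eta>(1) \<xi>(2) Wm_form[OF \<xi>(1)] f(2)] by (simp add: c(2) \<eta>(2) algebra_simps)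
  then have 1: "const c * \<rho> f * \<beta> - r \<in> J'" unfolding J'_def using \<xi>(1) r f(1) by auto
  have "const c * \<rho> f * \<beta> + (- 1) * (const c * \<rho> f * \<beta> - r) \<in> J'"
    by (intro J'_add J'_mult \<beta>_in_J'[OF Y] 1) (use f(1) in \<open>auto intro: polys_uminus\<close>)
  then show "r \<in> J'" by simp
qed

section \<open>Lifting forms from H when A is free\<close>

lemma lifts_cong: "lifts \<eta> \<xi> \<Longrightarrow> (\<And>w. w \<in> H \<Longrightarrow> \<xi> w = \<xi>' w) \<Longrightarrow> lifts \<eta> \<xi>'"
  unfolding lifts_def by auto

lemma lifts_cmult:
  assumes "lifts \<eta> \<xi>" "f \<in> polys (length b)"
  shows "lifts (\<lambda>w. \<sigma> f * \<eta> w) (\<lambda>w. f * \<xi> w)"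
proof -
  obtain \<zeta> where z: "poly_form H (length e) \<zeta>" "\<And>w. w \<in> H \<Longrightarrow> \<eta> w = \<alpha> * \<zeta> w" "\<And>w. w \<in> H \<Longrightarrow> \<rho> (\<zeta> w) = \<xi> w"
    using assms(1) unfolding lifts_def by blast
  have "poly_form H (length e) (\<lambda>w. \<sigma> f * \<zeta> w)" by (rule poly_form_cmult[OF z(1)]) (simp add: assms(2))
  then show ?thesis
    unfolding lifts_def by (intro exI[of _ "\<lambda>w. \<sigma> f * \<zeta> w"]) (simp add: z \<rho>_\<sigma>[OF assms(2)] mult_ac)
qed

lemma poly_form_pr:
  "poly_form H (length b) s \<Longrightarrow> poly_form W' (length e) (\<lambda>v. \<sigma> (s (pr v)))"
  unfolding poly_form_def by (simp add: pr_add pr_scale)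

text \<open>The explicit form used here generates, together with the regular forms, the logarithmic forms of the
  rank two localization at \<open>Y\<close>.\<close>

lemma lifts_part:
  assumes \<xi>: "\<xi> \<in> Wm" and Y: "Y \<in> AH"
  shows "\<exists>\<eta>\<in>Log. lifts \<eta> (\<lambda>w. \<rho> (part (AH - {Y})) * \<xi> w)"
proof -
  note \<xi>f = Wm_form[OF \<xi>]
  obtain u where u: "u \<in> H" "R.df Y u = 1" using R.df_normal[OF Y] .
  note linY = R.df_linear[OF Y]
  define a where "a = (\<lambda>v. R.df Y (pr v))"
  have a: "linear_form a" unfolding a_def by (rule linear_form_pr[OF linY])
  obtain c where c: "c \<noteq> 0" "\<rho> (part {Y}) = const c * pw {Y}" using \<rho>_part[of "{Y}"] Y by auto
  have dvd: "\<rho> (part {Y}) dvd \<xi> (w - R.df Y w *s u)" if "w \<in> H" for w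
    using Wm_dvd[OF \<xi> Y R.proj_in_hyperplane[OF Y u that]] c by (simp add: pw_def const_mult_dvd_iff)
  have nz: "\<rho> (part {Y}) \<noteq> 0" using c R.df_nonzero[OF Y] by (simp add: pw_def)
  have form: "poly_form H (length b) (\<lambda>w. \<xi> w - const (R.df Y w) * \<xi> u)"
    by (intro poly_form_minus \<xi>f poly_form_linear_form linY poly_form_in_polys[OF \<xi>f u(1)])
  have eq: "\<xi> (w - R.df Y w *s u) = \<xi> w - const (R.df Y w) * \<xi> u" if "w \<in> H" for w
    using that u(1) subspace_scale[OF R.subspace_W u(1)]
    by (simp add: R.poly_form_diff[OF \<xi>f] poly_form_scale[OF \<xi>f])
  \<comment> \<open>The left side is \<xi> at the projection of \<open>w\<close> to
    \<open>Y\<close>, hence divisible by the full power of \<alpha>_Y.\<close>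
  obtain s where s: "poly_form H (length b) s" "\<And>w. w \<in> H \<Longrightarrow> \<xi> w - const (R.df Y w) * \<xi> u = \<rho> (part {Y}) * s w"
    by (rule poly_form_divide[OF form R.subspace_W, of "\<rho> (part {Y})"]) (use dvd eq nz in auto)
  define C where "C = part (AH - {Y})"
  define q where "q = part {Y}"
  have Cq: "C \<in> polys (length e)" "q \<in> polys (length e)" by (simp_all add: C_def q_def)
  define x where "x = \<sigma> (\<xi> u)"
  have x: "x \<in> polys (length e)" "\<rho> x = \<xi> u"
    unfolding x_def using poly_form_in_polys[OF \<xi>f u(1)] by (simp_all add: \<rho>_\<sigma>)
  \<comment> \<open>The difference is \<open>C * x\<close> times \<open>\<alpha>\<close> da -
    \<open>lf a\<close> d\<alpha>_H, which is logarithmic along every hyperplane of \<open>A\<close>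
    containing \<open>Y\<close>, since their forms are combinations of \<open>a\<close> and
    \<alpha>_H. The last summand lifts the remainder \<open>s\<close>, with \<open>q\<close>
    providing divisibility along the same hyperplanes; \<open>C\<close> takes care of all
    others.\<close>
  define \<eta> where "\<eta> = (\<lambda>v. (const (a v) * (C * x * \<alpha>) - const (df H v) * (C * x * lf a)) + (C * q * \<alpha>) * \<sigma> (s (pr v)))"
  define \<zeta> where "\<zeta> = (\<lambda>v. const (a v) * (C * x) + (C * q) * \<sigma> (s (pr v)))"
  have \<eta>f: "poly_form UNIV (length e) \<eta>"
    unfolding \<eta>_def using Cq x
    by (intro poly_form_plus poly_form_minus poly_form_linear_form poly_form_cmult poly_form_pr s(1) a
        df_linear[OF H_in_A]) simp_all
  have \<zeta>f: "poly_form H (length e) \<zeta>"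
    unfolding \<zeta>_def using Cq x
    by (intro poly_form_plus poly_form_linear_form poly_form_cmult poly_form_pr s(1) a) simp_all
  have \<eta>\<zeta>: "\<eta> w = \<alpha> * \<zeta> w" if "w \<in> H" for w
    using that unfolding \<eta>_def \<zeta>_def by (simp add: mem_H_iff algebra_simps)
  have "\<rho> (\<zeta> w) = \<rho> (part (AH - {Y})) * \<xi> w" if w: "w \<in> H" for w
  proof -
    have "\<rho> (\<zeta> w) = \<rho> C * (const (R.df Y w) * \<xi> u + \<rho> q * s w)"
      using poly_form_in_polys[OF s(1) w] by (simp add: \<zeta>_def a_def pr_id w x \<rho>_\<sigma> algebra_simps)
    also have "\<dots> = \<rho> C * \<xi> w" using s(2)[OF w] by (simp add: q_def algebra_simps)
    finally show ?thesis by (simp add: C_def)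
  qed
  then have "lifts \<eta> (\<lambda>w. \<rho> (part (AH - {Y})) * \<xi> w)" unfolding lifts_def using \<zeta>f \<eta>\<zeta> by blast
  moreover have "\<eta> \<in> Log"
    unfolding Log_def
  proof (intro CollectI conjI \<eta>f ballI)
    fix L w assume L: "L \<in> A" "w \<in> L"
    consider "L = H" | "L \<noteq> H" "H \<inter> L = Y" | "L \<noteq> H" "H \<inter> L \<noteq> Y" by blast
    then show "lf (df L) dvd \<eta> w"
    proof cases
      case 1
      then show ?thesis using \<eta>\<zeta> L(2) by simp
    next
      case 2
      note linL = linear_form_simps[OF df_linear[OF L(1)]]
      define l t where "l = df L u" and "t = df L v0"
      have "u \<notin> L" using u R.df_eq_0_iff[OF Y u(1)] 2 by auto
      then have l0: "l \<noteq> 0" using df_eq_0_iff[OF L(1)] by (simp add: l_def)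
      have dfL: "df L v = l * a v + t * df H v" for v
      proof -
        have "pr v - R.df Y (pr v) *s u \<in> L" using R.proj_in_hyperplane[OF Y u pr_in_H] 2 by blast
        then have "df L (pr v - R.df Y (pr v) *s u) = 0" using df_eq_0_iff[OF L(1)] by simp
        then have "df L (pr v) = l * a v" by (simp add: linL l_def a_def)
        then show ?thesis by (simp add: pr_def linL t_def algebra_simps)
      qed
      have lfL: "lf (df L) = const l * lf a + const t * \<alpha>"
        unfolding lf_combination[symmetric] by (rule lf_cong) (rule dfL)
      have "l * a w + t * df H w = 0" using dfL[of w] df_eq_0_iff[OF L(1), of w] L(2) by simp
      then have aw: "const l * const (a w) = - (const t * const (df H w))"
        by (metis const_minus const_mult eq_neg_iff_add_eq_0)
      have "const l * (const (a w) * (C * x * \<alpha>) - const (df H w) * (C * x * lf a))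
          = (const l * const (a w)) * (C * x * \<alpha>) - const (df H w) * (C * x * (const l * lf a))"
        by (simp add: algebra_simps)
      also have "\<dots> = - const (df H w) * (C * x) * lf (df L)" unfolding aw lfL by (simp add: algebra_simps)
      finally have "lf (df L) dvd const l * (const (a w) * (C * x * \<alpha>) - const (df H w) * (C * x * lf a))"
        by (metis dvd_triv_right)
      then have 1: "lf (df L) dvd const (a w) * (C * x * \<alpha>) - const (df H w) * (C * x * lf a)"
        using dvd_const_mult_iff[OF l0] by blast
      have "lf (df L) dvd q" unfolding q_def by (rule df_dvd_part) (use L 2 in auto)
      then have "lf (df L) dvd (C * q * \<alpha>) * \<sigma> (s (pr w))" by (simp add: dvd_mult dvd_mult2)
      then show ?thesis unfolding \<eta>_def by (rule dvd_add[OF 1])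
    next
      case 3
      have "lf (df L) dvd C" unfolding C_def by (rule df_dvd_part) (use L 3 restrict_mem in auto)
      then show ?thesis unfolding \<eta>_def by (intro dvd_add dvd_diff dvd_mult2 dvd_mult[of _ "C * x * _"]) (simp_all add: dvd_mult2)
    qed
  qed
  ultimately show ?thesis by blast
qed

text \<open>The correction is a polynomial multiple of \<open>Q\<close> times d\<alpha>_H /
  \<alpha>_H. It is logarithmic and vanishes on H, so it does not affect what is lifted, while its
  contraction can be any multiple of \<open>Q\<close>.\<close>

lemma euler_free_lift:
  assumes "\<eta> \<in> Log" "lifts \<eta> \<xi>"
  shows "\<exists>\<eta>'\<in>Log. lifts \<eta>' \<xi> \<and> euler \<eta>' = 0"
proof -
  obtain f where f: "f \<in> polys (length e)" "euler \<eta> = Q * f"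
    using euler_Log[OF assms(1)] euler_in_polys[OF Log_form[OF assms(1)]] by (elim polys_dvdE[where n = "length e"]) auto
  define \<eta>' where "\<eta>' = (\<lambda>w. \<eta> w - const (df H w) * (part AH * f))"
  have "poly_form UNIV (length e) \<eta>'"
    unfolding \<eta>'_def by (intro poly_form_minus Log_form[OF assms(1)] poly_form_linear_form df_linear[OF H_in_A]) (simp add: f)
  moreover have "lf (df L) dvd \<eta>' w" if L: "L \<in> A" "w \<in> L" for L w
  proof (cases "L = H")
    case True
    then show ?thesis using Log_dvd[OF assms(1) L] L(2) by (simp add: \<eta>'_def mem_H_iff)
  next
    case False
    then have "lf (df L) dvd part AH" using L restrict_mem by (intro df_dvd_part) auto
    then show ?thesis unfolding \<eta>'_def using Log_dvd[OF assms(1) L] by (intro dvd_diff) (simp_all add: dvd_mult dvd_mult2)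
  qed
  ultimately have "\<eta>' \<in> Log" by (simp add: Log_def)
  moreover have "lifts \<eta>' \<xi>" using assms(2) unfolding lifts_def \<eta>'_def by (simp add: mem_H_iff)
  moreover have "euler \<eta>' = 0" unfolding \<eta>'_def by (simp add: euler_diff euler_linear_form f Q_eq mult.assoc)
  ultimately show ?thesis by blast
qed

lemma lifts_divide:
  assumes free: "free_arrangement e A" and d: "R.dual_system 2 p u"
    and l0: "\<eta>0 \<in> Log" "lifts \<eta>0 (\<lambda>w. R.lf (p 0) * \<xi> w)" and l1: "\<eta>1 \<in> Log" "lifts \<eta>1 (\<lambda>w. R.lf (p 1) * \<xi> w)"
  shows "\<exists>\<eta>\<in>Log. lifts \<eta> \<xi>"
proof -
  obtain \<theta>0 where t0: "\<theta>0 \<in> Log" "lifts \<theta>0 (\<lambda>w. R.lf (p 0) * \<xi> w)" "euler \<theta>0 = 0"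
    using euler_free_lift[OF l0] by blast
  obtain \<theta>1 where t1: "\<theta>1 \<in> Log" "lifts \<theta>1 (\<lambda>w. R.lf (p 1) * \<xi> w)" "euler \<theta>1 = 0"
    using euler_free_lift[OF l1] by blast
  obtain z0 where z0: "\<And>w. w \<in> H \<Longrightarrow> z0 w \<in> polys (length e)" "\<And>w. w \<in> H \<Longrightarrow> \<theta>0 w = \<alpha> * z0 w" "\<And>w. w \<in> H \<Longrightarrow> \<rho> (z0 w) = R.lf (p 0) * \<xi> w"
    using t0(2) unfolding lifts_def by (blast dest: poly_form_in_polys)
  obtain z1 where z1: "\<And>w. w \<in> H \<Longrightarrow> z1 w \<in> polys (length e)" "\<And>w. w \<in> H \<Longrightarrow> \<theta>1 w = \<alpha> * z1 w" "\<And>w. w \<in> H \<Longrightarrow> \<rho> (z1 w) = R.lf (p 1) * \<xi> w"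
    using t1(2) unfolding lifts_def by (blast dest: poly_form_in_polys)
  have lin: "linear_form (p 0)" "linear_form (p 1)" and uH: "u 0 \<in> H" "u 1 \<in> H"
    and pu: "p 0 (u 0) = 1" "p 0 (u 1) = 0" "p 1 (u 0) = 0" "p 1 (u 1) = 1"
    using d by (simp_all add: R.dual_system_def)
  \<comment> \<open>Cross-multiplied, both lifts restrict to the same form, so on H their difference
    is divisible by the square of \<alpha>.\<close>
  define Z where "Z = (\<lambda>w. lf (p 1) * \<theta>0 w - lf (p 0) * \<theta>1 w)"
  have Z: "Z \<in> Log" unfolding Z_def by (intro Log_minus Log_cmult t0(1) t1(1) lf_in_polys)
  note Zf = Log_form[OF Z]
  have ZH: "\<alpha> * \<alpha> dvd Z w" if w: "w \<in> H" for w
  proof -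
    have "\<rho> (lf (p 1) * z0 w - lf (p 0) * z1 w) = 0"
      unfolding \<rho>_hom \<rho>_lf[OF lin(1)] \<rho>_lf[OF lin(2)] z0(3)[OF w] z1(3)[OF w] by (simp add: mult_ac)
    then have "\<alpha> dvd lf (p 1) * z0 w - lf (p 0) * z1 w" by (subst (asm) \<rho>_eq_0_iff) (simp_all add: z0(1)[OF w] z1(1)[OF w])
    then have "\<alpha> * \<alpha> dvd \<alpha> * (lf (p 1) * z0 w - lf (p 0) * z1 w)" by simp
    then show ?thesis by (simp add: Z_def z0(2)[OF w] z1(2)[OF w] algebra_simps)
  qed
  \<comment> \<open>This is why the lifts were normalized to have contraction zero: \<alpha> times
    the normal value \<open>Z v0\<close> is now expressed by values on H, and \<open>Z\<close> is
    divisible by \<alpha> everywhere.\<close>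
  have "euler Z = 0" unfolding Z_def by (simp add: euler_diff euler_cmult t0(3) t1(3))
  then have "\<alpha> * Z v0 = - (\<Sum>i<length e. var i * Z (pr (e ! i)))"
    using euler_Log_pr[OF Z] by (simp add: add.commute eq_neg_iff_add_eq_0)
  moreover have "\<alpha> * \<alpha> dvd (\<Sum>i<length e. var i * Z (pr (e ! i)))"
    by (intro dvd_sum dvd_mult ZH pr_in_H)
  ultimately have "\<alpha> * \<alpha> dvd \<alpha> * Z v0" by simp
  then have Zv0: "\<alpha> dvd Z v0" by simp
  have "\<alpha> dvd Z v" for v
  proof -
    have "Z v = Z (pr v + df H v *s v0)" by (simp add: pr_def)
    also have "\<dots> = Z (pr v) + const (df H v) * Z v0" by (simp add: poly_form_add[OF Zf] poly_form_scale[OF Zf])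
    finally show ?thesis using ZH[OF pr_in_H, of v] Zv0 by (metis dvd_add dvd_mult dvd_mult_left)
  qed
  then obtain \<eta>' where e': "poly_form UNIV (length e) \<eta>'" "\<And>w. Z w = \<alpha> * \<eta>' w"
    using poly_form_divide[OF Zf subspace_W, of \<alpha>] by auto
  have "lf (df L) dvd \<eta>' w" if L: "L \<in> A" "w \<in> L" for L w
  proof (cases "L = H")
    case True
    then show ?thesis using ZH[of w] L(2) e'(2)[of w] by simp
  next
    case False
    show ?thesis by (rule df_dvd_cancel[OF L(1) False]) (use Log_dvd[OF Z L] e'(2)[of w] in simp)
  qed
  then have e'L: "\<eta>' \<in> Log" using e'(1) by (simp add: Log_def)
  have uH0: "df H (u 0) = 0" "df H (u 1) = 0" using uH by (simp_all add: mem_H_iff)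
  let ?p1 = "(\<lambda>_ :: nat. df H)(1 := p 0)" and ?p = "((\<lambda>_ :: nat. df H)(1 := p 0))(2 := p 1)"
  obtain u1 where "dual_system (Suc 1) ?p1 u1"
    using dual_system_extend[OF dual_system_1[OF df_linear[OF H_in_A] UNIV_I df_v0] lin(1), of "u 0"] uH0 pu by auto
  moreover have "?p1 k (u 1) = 0" if "k < Suc 1" for k using that uH0 pu by (auto simp: less_Suc_eq)
  ultimately obtain u2 where u2: "dual_system (Suc (Suc 1)) (?p1(Suc 1 := p 1)) u2"
    using dual_system_extend[of "Suc 1" ?p1 u1 "p 1" "u 1"] lin(2) pu by auto
  have dual: "dual_system 3 ?p u2" using u2 by (simp add: numeral_3_eq_3 numeral_2_eq_2)
  \<comment> \<open>Regularity of \<open>lf (p 1)\<close> modulo \<alpha> and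
    \<open>lf (p 0)\<close> makes \<open>\<theta>0\<close> a combination of these two; the cofactor
    of \<open>lf (p 0)\<close> is the desired lift, as the multiple of \<alpha> disappears on
    H.\<close>
  have "\<exists>s\<in>Log. \<exists>t\<in>Log. \<forall>w\<in>UNIV. \<theta>0 w = lf (?p 0) * s w + lf (?p 1) * t w"
  proof (rule free_regular[OF free dual t0(1) e'L t1(1)])
    fix w
    have "lf (p 1) * \<theta>0 w - lf (p 0) * \<theta>1 w = \<alpha> * \<eta>' w" using e'(2)[of w] by (simp add: Z_def)
    then show "lf (?p 2) * \<theta>0 w = lf (?p 0) * \<eta>' w + lf (?p 1) * \<theta>1 w" by (simp add: algebra_simps)
  qed
  then obtain t s where ts: "t \<in> Log" "s \<in> Log" "\<And>w. \<theta>0 w = \<alpha> * t w + lf (p 0) * s w" by auto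
  obtain s' where s': "poly_form H (length e) s'" "\<And>w. w \<in> H \<Longrightarrow> s w = \<alpha> * s' w"
    by (rule Log_divide[OF ts(2)]) blast
  obtain t' where t': "poly_form H (length e) t'" "\<And>w. w \<in> H \<Longrightarrow> t w = \<alpha> * t' w"
    by (rule Log_divide[OF ts(1)]) blast
  have p0: "R.lf (p 0) \<noteq> 0" using R.lf_eq_0D[OF lin(1) _ uH(1)] pu by auto
  have "\<rho> (s' w) = \<xi> w" if w: "w \<in> H" for w
  proof -
    have "\<alpha> * z0 w = \<alpha> * (\<alpha> * t' w + lf (p 0) * s' w)"
      using ts(3)[of w] by (simp add: z0(2)[OF w] s'(2)[OF w] t'(2)[OF w] algebra_simps)
    then have "z0 w = \<alpha> * t' w + lf (p 0) * s' w" by simp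
    then have "\<rho> (z0 w) = R.lf (p 0) * \<rho> (s' w)" by (simp add: \<rho>_lf lin)
    then show ?thesis using p0 by (simp add: z0(3)[OF w])
  qed
  then have "lifts s \<xi>" unfolding lifts_def using s' by blast
  then show ?thesis using ts(2) by blast
qed

text \<open>\<open>M\<close> is the ideal of polynomials whose product with \<xi> lifts. By
  \<open>lifts_part\<close> it contains, for every \<open>Z\<close>, the product of powers avoiding
  \<open>Z\<close>; two last factor steps give a multiple of \<xi> that does not lift although its
  products with two different forms do, against \<open>lifts_divide\<close>.\<close>

lemma free_lifts:
  assumes free: "free_arrangement e A" and Y: "Y \<in> AH" and \<xi>: "\<xi> \<in> Wm"
  shows "\<exists>\<eta>\<in>Log. lifts \<eta> \<xi>"
proof (rule ccontr)
  define M where "M = (\<lambda>c. c \<in> polys (length b) \<and> (\<exists>\<eta>\<in>Log. lifts \<eta> (\<lambda>w. c * \<xi> w)))"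
  have mult: "M (f * c)" if Mc: "M c" and f: "f \<in> polys (length b)" for f c
  proof -
    obtain \<eta> where "\<eta> \<in> Log" "lifts \<eta> (\<lambda>w. c * \<xi> w)" using Mc by (auto simp: M_def)
    then have "(\<lambda>w. \<sigma> f * \<eta> w) \<in> Log" "lifts (\<lambda>w. \<sigma> f * \<eta> w) (\<lambda>w. f * c * \<xi> w)"
      using lifts_cmult[of \<eta> "\<lambda>w. c * \<xi> w" f] f by (auto intro: Log_cmult simp: mult.assoc)
    then show ?thesis using Mc f by (auto simp: M_def)
  qed
  assume "\<not> (\<exists>\<eta>\<in>Log. lifts \<eta> \<xi>)"
  then have M1: "\<not> M 1" by (simp add: M_def)
  have Mpw: "M (pw (AH - {Z}))" if "Z \<in> AH" for Z
  proof -
    obtain c where c: "c \<noteq> 0" "\<rho> (part (AH - {Z})) = const c * pw (AH - {Z})" using \<rho>_part[of "AH - {Z}"] by auto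
    have "M (\<rho> (part (AH - {Z})))" using lifts_part[OF \<xi> that] by (simp add: M_def)
    then have "M (const (inverse c) * \<rho> (part (AH - {Z})))" by (rule mult) simp
    also have "const (inverse c) * \<rho> (part (AH - {Z})) = (const c * const (inverse c)) * pw (AH - {Z})"
      unfolding c(2) by (simp only: mult_ac)
    finally show ?thesis by (simp only: const_mult_inverse[OF c(1)] mult_1)
  qed
  have step: "\<exists>c\<in>polys (length b). \<exists>Z'\<in>AH - {Z}. \<not> M (h * c) \<and> M (h * c * ry Z')"
    if "Z \<in> AH" "h \<in> polys (length b)" "\<not> M h" for Z h
    by (rule exists_last_factor[of "AH - {Z}" ry _ M h mu])
      (use that R.finite_A mult[OF Mpw[OF that(1)] that(2)] in \<open>simp_all add: pw_def\<close>)
  obtain c1 Y1 where 1: "c1 \<in> polys (length b)" "Y1 \<in> AH" "\<not> M c1" "M (c1 * ry Y1)"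
    using step[OF Y polys_1 M1] by auto
  obtain c2 Y2 where 2: "c2 \<in> polys (length b)" "Y2 \<in> AH" "Y1 \<noteq> Y2" "\<not> M (c1 * c2)" "M (c1 * c2 * ry Y2)"
    using step[OF 1(2,1,3)] by auto
  have 3: "M (c1 * c2 * ry Y1)" using mult[OF 1(4) 2(1)] by (simp only: mult_ac)
  obtain u where u: "R.dual_system 2 ((\<lambda>_. R.df Y1)(1 := R.df Y2)) u" using R.dual_system_pair[OF 1(2) 2(2,3)] by blast
  obtain \<eta>0 where e0: "\<eta>0 \<in> Log" "lifts \<eta>0 (\<lambda>w. c1 * c2 * ry Y1 * \<xi> w)" using 3 by (auto simp: M_def)
  obtain \<eta>1 where e1: "\<eta>1 \<in> Log" "lifts \<eta>1 (\<lambda>w. c1 * c2 * ry Y2 * \<xi> w)" using 2(5) by (auto simp: M_def)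
  have "\<exists>\<eta>\<in>Log. lifts \<eta> (\<lambda>w. c1 * c2 * \<xi> w)"
    by (rule lifts_divide[OF free u e0(1) _ e1(1)])
      (rule lifts_cong[OF e0(2)] lifts_cong[OF e1(2)], simp add: mult_ac)+
  then show False using 2(1,4) 1(1) by (simp add: M_def)
qed

text \<open>The residue of the logarithmic form d\<alpha>_H / \<alpha>_H is \<beta> up to a
  scalar.\<close>

lemma \<beta>_in_J: "\<beta> \<in> J"
proof -
  obtain c where c: "c \<noteq> 0" "\<rho> (part AH) = const c * (R.Q * \<beta>)" using \<rho>_part_AH by blast
  let ?\<eta> = "\<lambda>w. const (df H w) * part AH"
  have "lf (df L) dvd ?\<eta> w" if L: "L \<in> A" "w \<in> L" for L w
  proof (cases "L = H")
    case True
    then show ?thesis using L(2) by (simp add: mem_H_iff)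
  next
    case False
    then show ?thesis using L restrict_mem df_dvd_part[of L AH] by simp
  qed
  then have "?\<eta> \<in> Log" using poly_form_linear_form[OF df_linear[OF H_in_A]] by (simp add: Log_def)
  then have "const c * \<beta> \<in> J" unfolding J_def using c by (auto intro!: bexI[of _ ?\<eta>] simp: mult_ac)
  then have "const (inverse c) * (const c * \<beta>) \<in> J" by (rule J_mult) simp
  also have "const (inverse c) * (const c * \<beta>) = (const c * const (inverse c)) * \<beta>" by (simp only: mult_ac)
  finally show ?thesis by (simp only: const_mult_inverse[OF c(1)] mult_1)
qed

theorem free_J'_eq_J:
  assumes free: "free_arrangement e A" and Y: "Y \<in> AH" shows "J' = J"
proof
  show "J \<subseteq> J'" by (rule J_subset_J'[OF Y])
  show "J' \<subseteq> J"
  proof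
    fix g assume "g \<in> J'"
    then obtain \<xi> where g: "g \<in> polys (length b)" and \<xi>: "\<xi> \<in> Wm" "R.euler \<xi> = R.Q * g" by (auto simp: J'_def)
    obtain \<eta> where \<eta>: "\<eta> \<in> Log" "lifts \<eta> \<xi>" using free_lifts[OF free Y \<xi>(1)] by blast
    obtain f where f: "f \<in> polys (length e)" "euler \<eta> = Q * f"
      using euler_Log[OF \<eta>(1)] euler_in_polys[OF Log_form[OF \<eta>(1)]] by (elim polys_dvdE[where n = "length e"]) auto
    obtain c where c: "c \<noteq> 0" "\<rho> (part AH) = const c * (R.Q * \<beta>)" using \<rho>_part_AH by blast
    have "R.Q * g + \<rho> (\<eta> v0) = const c * (R.Q * \<beta>) * \<rho> f"
      using lifts_euler[OF \<eta> Wm_form[OF \<xi>(1)] f(2)] \<xi>(2) c(2) by simp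
    then have "\<rho> (\<eta> v0) = R.Q * (const c * \<rho> f * \<beta> - g)" by (simp add: algebra_simps)
    then have 1: "const c * \<rho> f * \<beta> - g \<in> J" unfolding J_def using \<eta>(1) f(1) g by auto
    have "const c * \<rho> f * \<beta> + (- 1) * (const c * \<rho> f * \<beta> - g) \<in> J"
      by (intro J_add J_mult \<beta>_in_J 1) (use f(1) in \<open>auto intro: polys_uminus\<close>)
    then show "g \<in> J" by simp
  qed
qed

end

section \<open>Syzygies when the restriction is free\<close>

context arr_restriction
begin

lemma \<beta>_split:
  assumes "Y \<in> AH" obtains b' where "\<beta> = ry Y ^ (mu Y - 1) * b'" "\<not> ry Y dvd b'"
proof
  let ?b = "\<Prod>Z\<in>AH - {Y}. ry Z ^ (mu Z - 1)"
  show "\<beta> = ry Y ^ (mu Y - 1) * ?b" unfolding \<beta>_def by (rule prod.remove[OF R.finite_A assms])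
  show "\<not> ry Y dvd ?b"
  proof
    assume "ry Y dvd ?b"
    then obtain Z where Z: "Z \<in> AH - {Y}" "ry Y dvd ry Z ^ (mu Z - 1)"
      using prime_elem_dvd_prodD[OF R.prime_df[OF assms] finite_Diff[OF R.finite_A]] by blast
    then have "ry Y dvd ry Z" using prime_elem_dvd_powerD[OF R.prime_df[OF assms]] by blast
    then show False using R.df_not_dvd[OF assms, of Z] Z by blast
  qed
qed

lemma mu_Suc: "Y \<in> AH \<Longrightarrow> ry Y ^ mu Y = ry Y * ry Y ^ (mu Y - 1)"
  using mu_pos[of Y] by (metis power_eq_if less_not_refl3)

lemma \<beta>_Log_in_Wm:
  assumes "s \<in> R.Log" shows "(\<lambda>w. \<beta> * s w) \<in> Wm"
  unfolding Wm_def
proof (intro CollectI conjI ballI)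
  show "poly_form H (length b) (\<lambda>w. \<beta> * s w)" by (rule poly_form_cmult[OF R.Log_form[OF assms]]) simp
  fix Y w assume Y: "Y \<in> AH" "w \<in> Y"
  obtain b' where "\<beta> = ry Y ^ (mu Y - 1) * b'" by (rule \<beta>_split[OF Y(1)])
  then have "ry Y ^ (mu Y - 1) dvd \<beta>" by simp
  then have "ry Y * ry Y ^ (mu Y - 1) dvd s w * \<beta>" by (rule mult_dvd_mono[OF R.Log_dvd[OF assms Y]])
  then show "ry Y ^ mu Y dvd \<beta> * s w" by (simp only: mu_Suc[OF Y(1)] mult.commute[of \<beta>])
qed

text \<open>Zero contraction equates \<alpha>_Y times the normal value with a tangential sum
  divisible by the full power, so the normal value lacks at most one factor \<alpha>_Y. On
  \<open>Y\<close> the full power is present, and the factor left after division by \<beta> is the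
  logarithmic condition.\<close>

lemma Wm_euler_free:
  assumes N: "N \<in> Wm" "R.euler N = 0"
  shows "\<exists>v\<in>R.Log. \<forall>w\<in>H. N w = \<beta> * v w"
proof -
  note Nf = Wm_form[OF N(1)]
  have dvd: "ry Y ^ (mu Y - 1) dvd N w" if Y: "Y \<in> AH" and w: "w \<in> H" for Y w
  proof -
    obtain u where u: "u \<in> H" "R.df Y u = 1" using R.df_normal[OF Y] .
    have "ry Y ^ mu Y dvd (\<Sum>i<length b. var i * N (b ! i - R.df Y (b ! i) *s u))"
      by (intro dvd_sum dvd_mult Wm_dvd[OF N(1) Y] R.proj_in_hyperplane[OF Y u]) simp
    moreover have "ry Y * N u = - (\<Sum>i<length b. var i * N (b ! i - R.df Y (b ! i) *s u))"
      using R.euler_proj_1[OF Nf R.df_linear[OF Y] u] N(2) by (simp add: add.commute eq_neg_iff_add_eq_0)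
    ultimately have "ry Y ^ mu Y dvd ry Y * N u" by simp
    then have "ry Y * ry Y ^ (mu Y - 1) dvd ry Y * N u" by (simp only: mu_Suc[OF Y])
    then have 1: "ry Y ^ (mu Y - 1) dvd N u" using R.df_nonzero[OF Y] by simp
    have uH: "R.df Y w *s u \<in> H" by (rule subspace_scale[OF R.subspace_W u(1)])
    have "ry Y * ry Y ^ (mu Y - 1) dvd N (w - R.df Y w *s u)"
      unfolding mu_Suc[OF Y, symmetric] by (rule Wm_dvd[OF N(1) Y R.proj_in_hyperplane[OF Y u w]])
    then have 2: "ry Y ^ (mu Y - 1) dvd N (w - R.df Y w *s u)" by (rule dvd_mult_right)
    have "N w = N (w - R.df Y w *s u) + const (R.df Y w) * N u"
      using w uH by (simp add: R.poly_form_diff[OF Nf] poly_form_scale[OF Nf u(1)])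
    then show ?thesis using 1 2 by (simp add: dvd_add dvd_mult)
  qed
  have "\<beta> dvd N w" if w: "w \<in> H" for w
    unfolding \<beta>_def by (rule prod_prime_powers_dvd[OF R.finite_A R.prime_df R.df_not_dvd dvd[OF _ w]])
  moreover have nz: "\<beta> \<noteq> 0" unfolding \<beta>_def using R.finite_A R.df_nonzero by simp
  ultimately obtain v where v: "poly_form H (length b) v" "\<And>w. w \<in> H \<Longrightarrow> N w = \<beta> * v w"
    using poly_form_divide[OF Nf R.subspace_W \<beta>_in_polys] by blast
  have "ry Y dvd v w" if Y: "Y \<in> AH" "w \<in> Y" for Y w
  proof -
    obtain b' where b': "\<beta> = ry Y ^ (mu Y - 1) * b'" "\<not> ry Y dvd b'" by (rule \<beta>_split[OF Y(1)])
    have wH: "w \<in> H" using R.hyperplane_subset[OF Y(1)] Y(2) by blast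
    have "ry Y ^ (mu Y - 1) * ry Y dvd ry Y ^ (mu Y - 1) * (b' * v w)"
      using Wm_dvd[OF N(1) Y] by (simp only: mu_Suc[OF Y(1)] v(2)[OF wH] b'(1) mult_ac)
    then have "ry Y dvd b' * v w" using R.df_nonzero[OF Y(1)] by simp
    then show ?thesis using b'(2) R.prime_df[OF Y(1)] by (simp add: prime_elem_dvd_mult_iff)
  qed
  then have "v \<in> R.Log" using v(1) by (simp add: R.Log_def)
  then show ?thesis using v(2) by blast
qed

text \<open>Otherwise both forms vanish on \<open>Y\<close>; but the plane of \<open>u 0\<close> and
  \<open>u 1\<close> meets \<open>Y\<close> in a nonzero vector, where one of them is nonzero. It
  follows that a power of \<alpha>_Y dividing both multiples of a polynomial divides the polynomial
  itself.\<close>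

lemma not_both_dvd:
  assumes Y: "Y \<in> AH" and d: "R.dual_system 3 p u"
  shows "\<not> ry Y dvd R.lf (p 0) \<or> \<not> ry Y dvd R.lf (p 1)"
proof (rule ccontr)
  assume "\<not> ?thesis"
  then have dvd: "ry Y dvd R.lf (p 0)" "ry Y dvd R.lf (p 1)" by simp_all
  have lin: "linear_form (p 0)" "linear_form (p 1)" and uH: "u 0 \<in> H" "u 1 \<in> H"
    and pu: "p 0 (u 0) = 1" "p 0 (u 1) = 0" "p 1 (u 0) = 0" "p 1 (u 1) = 1"
    using d by (simp_all add: R.dual_system_def)
  obtain x where x: "x \<in> H" "R.df Y x = 1" using R.df_normal[OF Y] .
  note vanish = R.lf_dvd_lfD[OF R.df_linear[OF Y] x]
  let ?a = "R.df Y (u 1)" and ?b = "R.df Y (u 0)"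
  let ?w = "?a *s u 0 - ?b *s u 1"
  have w: "?w \<in> H" using uH by (intro R.W_closed) auto
  have w0: "R.df Y ?w = 0" by (simp add: linear_form_simps[OF R.df_linear[OF Y]])
  have "?a = p 0 ?w" unfolding linear_form_simps[OF lin(1)] pu by simp
  moreover have "- ?b = p 1 ?w" unfolding linear_form_simps[OF lin(2)] pu by simp
  ultimately have "?b = 0" using vanish[OF lin(2) dvd(2) w w0] by simp
  then have "p 0 (u 0) = 0" by (rule vanish[OF lin(1) dvd(1) uH(1)])
  then show False using pu by simp
qed

text \<open>A Koszul argument. For \<open>\<xi> k\<close> with contraction
  \<open>R.Q * (R.lf (p k) * g)\<close>, the cross differences are \<beta> times forms
  \<open>v j k\<close>, which satisfy the Koszul relation. Regularity solves it, and the solution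
  corrects \<open>\<xi> 0\<close> and \<open>\<xi> 1\<close> to multiples \<open>?p 0 * U\<close>
  and \<open>?p 1 * U\<close> of one form, whose contraction is \<open>R.Q * g\<close> up to a
  multiple of \<open>R.Q * \<beta>\<close>.\<close>

lemma free_J'_regular:
  assumes free: "free_arrangement b AH" and Y0: "Y0 \<in> AH" and d: "R.dual_system 3 p u"
    and g: "g \<in> polys (length b)" "\<And>k. k < 3 \<Longrightarrow> R.lf (p k) * g \<in> J'"
  shows "g \<in> J'"
proof -
  have "\<forall>k\<in>{..<3}. \<exists>\<xi>. \<xi> \<in> Wm \<and> R.euler \<xi> = R.Q * (R.lf (p k) * g)" using g(2) by (auto simp: J'_def)
  then obtain \<xi> where \<xi>: "\<And>k. k < 3 \<Longrightarrow> \<xi> k \<in> Wm" "\<And>k. k < 3 \<Longrightarrow> R.euler (\<xi> k) = R.Q * (R.lf (p k) * g)"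
    unfolding bchoice_iff by auto
  let ?p = "\<lambda>k. R.lf (p k)"
  have "\<exists>v\<in>R.Log. \<forall>w\<in>H. ?p j * \<xi> k w - ?p k * \<xi> j w = \<beta> * v w" if "j < 3" "k < 3" for j k
  proof (rule Wm_euler_free)
    show "(\<lambda>w. ?p j * \<xi> k w - ?p k * \<xi> j w) \<in> Wm" by (intro Wm_minus Wm_cmult \<xi>(1) that R.lf_in_polys)
    show "R.euler (\<lambda>w. ?p j * \<xi> k w - ?p k * \<xi> j w) = 0"
      by (simp add: R.euler_diff R.euler_cmult \<xi>(2) that)
  qed
  then obtain v where v: "\<And>j k. j < 3 \<Longrightarrow> k < 3 \<Longrightarrow> v j k \<in> R.Log"
    "\<And>j k w. j < 3 \<Longrightarrow> k < 3 \<Longrightarrow> w \<in> H \<Longrightarrow> ?p j * \<xi> k w - ?p k * \<xi> j w = \<beta> * v j k w" by metis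
  have \<beta>0: "\<beta> \<noteq> 0" unfolding \<beta>_def using R.finite_A R.df_nonzero by simp
  have "\<exists>s\<in>R.Log. \<exists>t\<in>R.Log. \<forall>w\<in>H. v 0 1 w = ?p 0 * s w + ?p 1 * t w"
  proof (rule R.free_regular[OF free d])
    show "v 0 1 \<in> R.Log" by (simp add: v(1))
    show "(\<lambda>w. (- 1) * v 1 2 w) \<in> R.Log" by (intro R.Log_cmult v(1) polys_uminus polys_1) simp_all
    show "v 0 2 \<in> R.Log" by (simp add: v(1))
    fix w assume w: "w \<in> H"
    have a01: "?p 0 * \<xi> 1 w - ?p 1 * \<xi> 0 w = \<beta> * v 0 1 w" by (rule v(2)) (use w in simp_all)
    have a02: "?p 0 * \<xi> 2 w - ?p 2 * \<xi> 0 w = \<beta> * v 0 2 w" by (rule v(2)) (use w in simp_all)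
    have a12: "?p 1 * \<xi> 2 w - ?p 2 * \<xi> 1 w = \<beta> * v 1 2 w" by (rule v(2)) (use w in simp_all)
    have "\<beta> * (?p 2 * v 0 1 w) = ?p 2 * (?p 0 * \<xi> 1 w - ?p 1 * \<xi> 0 w)" unfolding a01 by (simp only: mult_ac)
    also have "\<dots> = ?p 1 * (?p 0 * \<xi> 2 w - ?p 2 * \<xi> 0 w) - ?p 0 * (?p 1 * \<xi> 2 w - ?p 2 * \<xi> 1 w)"
      by (simp add: algebra_simps)
    also have "\<dots> = \<beta> * (?p 0 * ((- 1) * v 1 2 w) + ?p 1 * v 0 2 w)"
      unfolding a02 a12 by (simp add: algebra_simps)
    finally show "?p 2 * v 0 1 w = ?p 0 * ((- 1) * v 1 2 w) + ?p 1 * v 0 2 w" using \<beta>0 by simp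
  qed
  then obtain s t where st: "s \<in> R.Log" "t \<in> R.Log" "\<And>w. w \<in> H \<Longrightarrow> v 0 1 w = ?p 0 * s w + ?p 1 * t w" by blast
  \<comment> \<open>The signs are chosen to make the cross difference of the corrected forms
    vanish.\<close>
  define N0 N1 where "N0 = (\<lambda>w. \<xi> 0 w + \<beta> * t w)" and "N1 = (\<lambda>w. \<xi> 1 w - \<beta> * s w)"
  have N: "N0 \<in> Wm" "N1 \<in> Wm" unfolding N0_def N1_def
    using \<xi>(1) st by (intro Wm_plus Wm_minus \<beta>_Log_in_Wm; simp)+
  have N01: "?p 0 * N1 w = ?p 1 * N0 w" if w: "w \<in> H" for w
  proof -
    have "?p 0 * \<xi> 1 w - ?p 1 * \<xi> 0 w = \<beta> * (?p 0 * s w + ?p 1 * t w)"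
      using v(2)[of 0 1 w] st(3)[OF w] w by simp
    then show ?thesis by (simp add: N0_def N1_def algebra_simps)
  qed
  have lin: "linear_form (p 0)" "linear_form (p 1)" and uH: "u 0 \<in> H" "u 1 \<in> H"
    and pu: "p 0 (u 0) = 1" "p 0 (u 1) = 0" "p 1 (u 0) = 0" "p 1 (u 1) = 1"
    using d by (simp_all add: R.dual_system_def)
  have prime1: "prime_elem (?p 1)" by (rule R.prime_elem_lf[OF lin(2) uH(2) pu(4)])
  have n10: "\<not> ?p 1 dvd ?p 0"
    using R.lf_dvd_lfD[OF lin(2) uH(2) pu(4) lin(1) _ uH(1) pu(3)] pu(1) by auto
  have p0: "?p 0 \<noteq> 0" "?p 1 \<noteq> 0" using R.lf_eq_0D[OF lin(1) _ uH(1)] R.lf_eq_0D[OF lin(2) _ uH(2)] pu by auto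
  have "?p 1 dvd N1 w" if w: "w \<in> H" for w
  proof -
    have "?p 1 dvd ?p 0 * N1 w" using N01[OF w] by simp
    then show ?thesis using prime1 n10 by (simp add: prime_elem_dvd_mult_iff)
  qed
  then obtain U where U: "poly_form H (length b) U" "\<And>w. w \<in> H \<Longrightarrow> N1 w = ?p 1 * U w"
    using poly_form_divide[OF Wm_form[OF N(2)] R.subspace_W R.lf_in_polys p0(2)] by blast
  have U0: "N0 w = ?p 0 * U w" if w: "w \<in> H" for w
  proof -
    have "?p 1 * N0 w = ?p 0 * (?p 1 * U w)" unfolding N01[OF w, symmetric] U(2)[OF w] ..
    also have "\<dots> = ?p 1 * (?p 0 * U w)" by (simp only: mult_ac)
    finally have "?p 1 * N0 w = ?p 1 * (?p 0 * U w)" .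
    then show ?thesis using p0 by simp
  qed
  have UW: "U \<in> Wm"
    unfolding Wm_def
  proof (intro CollectI conjI ballI U(1))
    fix Y w assume Y: "Y \<in> AH" "w \<in> Y"
    then have wH: "w \<in> H" using R.hyperplane_subset[OF Y(1)] by blast
    have 0: "ry Y ^ mu Y dvd ?p 0 * U w" using Wm_dvd[OF N(1) Y] U0[OF wH] by simp
    have 1: "ry Y ^ mu Y dvd ?p 1 * U w" using Wm_dvd[OF N(2) Y] U(2)[OF wH] by simp
    from not_both_dvd[OF Y(1) d] show "ry Y ^ mu Y dvd U w"
      using prime_elem_power_dvd_cancel[OF R.prime_df[OF Y(1)] _ 0]
        prime_elem_power_dvd_cancel[OF R.prime_df[OF Y(1)] _ 1] by blast
  qed
  obtain fs where fs: "R.euler s = R.Q * fs" "fs \<in> polys (length b)"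
    using R.euler_Log[OF st(1)] R.euler_in_polys[OF R.Log_form[OF st(1)]] by (elim polys_dvdE[where n = "length b"]) auto
  obtain ft where ft: "R.euler t = R.Q * ft"
    using R.euler_Log[OF st(2)] by (auto elim: dvdE)
  have e1: "?p 1 * R.euler U = R.Q * (?p 1 * g) - \<beta> * (R.Q * fs)"
  proof -
    have "?p 1 * R.euler U = R.euler (\<lambda>w. ?p 1 * U w)" by (simp add: R.euler_cmult)
    also have "\<dots> = R.euler N1" by (rule R.euler_cong) (simp add: U(2))
    finally show ?thesis by (simp add: N1_def R.euler_diff R.euler_cmult \<xi>(2) fs(1))
  qed
  have e0: "?p 0 * R.euler U = R.Q * (?p 0 * g) + \<beta> * (R.Q * ft)"
  proof -
    have "?p 0 * R.euler U = R.euler (\<lambda>w. ?p 0 * U w)" by (simp add: R.euler_cmult)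
    also have "\<dots> = R.euler N0" by (rule R.euler_cong) (simp add: U0)
    finally show ?thesis by (simp add: N0_def R.euler_add R.euler_cmult \<xi>(2) ft)
  qed
  have f1: "\<beta> * (R.Q * fs) = R.Q * (?p 1 * g) - ?p 1 * R.euler U" using e1 by (simp add: algebra_simps)
  have f0: "R.Q * (?p 0 * g) - ?p 0 * R.euler U = - (\<beta> * (R.Q * ft))" using e0 by (simp add: algebra_simps)
  \<comment> \<open>Eliminating \<open>R.euler U\<close> from both identities shows that
    \<open>?p 1\<close> divides \<open>fs\<close>, after which \<open>?p 1\<close> can be cancelled
    in \<open>e1\<close>.\<close>
  have "\<beta> * R.Q * (?p 0 * fs) = ?p 0 * (\<beta> * (R.Q * fs))" by (simp only: mult_ac)
  also have "\<dots> = ?p 1 * (R.Q * (?p 0 * g) - ?p 0 * R.euler U)" unfolding f1 by (simp add: algebra_simps)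
  also have "\<dots> = \<beta> * R.Q * (?p 1 * (- ft))" unfolding f0 by (simp add: mult_ac)
  finally have "?p 0 * fs = ?p 1 * (- ft)" using \<beta>0 R.Q_nonzero by (metis mult_cancel_left no_zero_divisors)
  then have "?p 1 dvd ?p 0 * fs" by simp
  then have "?p 1 dvd fs" using prime1 n10 by (simp add: prime_elem_dvd_mult_iff)
  then obtain k where k: "k \<in> polys (length b)" "fs = ?p 1 * k"
    using fs(2) p0 by (elim polys_dvdE[where n = "length b"]) auto
  have "?p 1 * R.euler U = ?p 1 * (R.Q * (g - k * \<beta>))" unfolding e1 k(2) by (simp add: algebra_simps)
  then have "R.euler U = R.Q * (g - k * \<beta>)" using p0 by simp
  then have "g - k * \<beta> \<in> J'" unfolding J'_def using UW g(1) k(1) by auto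
  then have "(g - k * \<beta>) + k * \<beta> \<in> J'" by (intro J'_add J'_mult \<beta>_in_J'[OF Y0] k(1))
  then show ?thesis by simp
qed

end

section \<open>Localization\<close>

locale arr_localization = arr_restriction scale e A b H
  for scale :: "'a::field \<Rightarrow> 'b::ab_group_add \<Rightarrow> 'b" and e A b H +
  fixes X :: "'b set"
  assumes X_subset: "X \<subseteq> H"
begin

abbreviation B :: "'b set set" where "B \<equiv> arr_localize A X"

lemma B_subset: "B \<subseteq> A" by (auto simp: arr_localize_def)

sublocale B: arr_restriction scale e B b H
proof -
  interpret Ba: based_arrangement scale e UNIV B by (rule sub_arrangement[OF B_subset])
  show "arr_restriction scale e B b H"
    by unfold_locales (use H_in_A X_subset ordered_basis_H in \<open>auto simp: arr_localize_def\<close>)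
qed

abbreviation BH :: "'b set set" where "BH \<equiv> arr_restrict B H"

lemma BH_iff: "Y \<in> BH \<longleftrightarrow> Y \<in> AH \<and> X \<subseteq> Y"
  using X_subset unfolding arr_restrict_def arr_localize_def by auto

lemma BH_subset: "BH \<subseteq> AH" using BH_iff by blast

lemma B_mu: "Y \<in> BH \<Longrightarrow> B.mu Y = mu Y"
proof -
  assume "Y \<in> BH"
  then have "{L \<in> B. L \<noteq> H \<and> H \<inter> L = Y} = {L \<in> A. L \<noteq> H \<and> H \<inter> L = Y}"
    using BH_iff unfolding arr_localize_def by blast
  then show ?thesis unfolding B.mu_def mu_def by simp
qed

definition E :: "'a mpoly" where "E = (\<Prod>Y\<in>AH - BH. ry Y)"

lemma E_in_polys [simp]: "E \<in> polys (length b)" unfolding E_def by (intro polys_prod R.lf_in_polys)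

lemma RQ_split: "R.Q = E * B.R.Q"
  unfolding R.Q_def B.R.Q_def E_def by (rule prod.subset_diff[OF BH_subset R.finite_A])

lemma localize_mult:
  assumes "r \<in> B.J" shows "pw (AH - BH) * r \<in> J"
proof -
  obtain \<eta> where r: "r \<in> polys (length b)" and \<eta>: "\<eta> \<in> B.Log" "\<rho> (\<eta> v0) = B.R.Q * r"
    using assms by (auto simp: B.J_def)
  let ?D = "part (AH - BH)"
  obtain c where c: "c \<noteq> 0" "\<rho> ?D = const c * pw (AH - BH)" using \<rho>_part[of "AH - BH"] by auto
  \<comment> \<open>\<open>?D\<close> makes the form logarithmic along the hyperplanes outside the
    localization, and \<open>E\<close> makes up for the larger denominator \<open>R.Q\<close> of the
    residue.\<close>
  let ?\<eta> = "\<lambda>w. ?D * \<sigma> E * \<eta> w"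
  have "lf (df L) dvd ?\<eta> w" if L: "L \<in> A" "w \<in> L" for L w
  proof (cases "L \<in> B")
    case True
    show ?thesis by (rule dvd_mult[OF B.Log_dvd[OF \<eta>(1) True L(2)]])
  next
    case False
    then have "L \<noteq> H" "\<not> X \<subseteq> L" using L B.H_in_A by (auto simp: arr_localize_def)
    then have "H \<inter> L \<in> AH - BH" using restrict_mem[OF L(1)] BH_iff by auto
    then have "lf (df L) dvd ?D" by (rule df_dvd_part[OF L(1) \<open>L \<noteq> H\<close>])
    then show ?thesis by (simp add: dvd_mult2)
  qed
  then have Log: "?\<eta> \<in> Log" using poly_form_cmult[OF B.Log_form[OF \<eta>(1)]] by (simp add: Log_def)
  have "\<rho> (?\<eta> v0) = R.Q * (const c * (pw (AH - BH) * r))"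
    by (simp add: \<eta>(2) c(2) \<rho>_\<sigma> RQ_split mult_ac)
  then have "const c * (pw (AH - BH) * r) \<in> J" unfolding J_def using r Log by (intro CollectI conjI bexI[of _ ?\<eta>]) simp_all
  then have "const (inverse c) * (const c * (pw (AH - BH) * r)) \<in> J" by (rule J_mult) simp
  also have "const (inverse c) * (const c * (pw (AH - BH) * r)) = (const c * const (inverse c)) * (pw (AH - BH) * r)"
    by (simp only: mult_ac)
  finally show ?thesis by (simp only: const_mult_inverse[OF c(1)] mult_1)
qed

lemma E_mult_localize:
  assumes "r \<in> J" shows "E * r \<in> B.J"
proof -
  obtain \<eta> where r: "r \<in> polys (length b)" and \<eta>: "\<eta> \<in> Log" "\<rho> (\<eta> v0) = R.Q * r"
    using assms by (auto simp: J_def)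
  have "\<eta> \<in> B.Log" using \<eta>(1) B_subset unfolding Log_def B.Log_def by blast
  moreover have "\<rho> (\<eta> v0) = B.R.Q * (E * r)" by (simp add: \<eta>(2) RQ_split mult_ac)
  ultimately show ?thesis unfolding B.J_def using r by auto
qed

lemma \<rho>_pullback:
  assumes d: "linear_form d" "w0 \<in> H" "d w0 = 1" and f: "f \<in> polys (length e)"
  shows "\<rho> (pullback (proj 1 (\<lambda>_. d) (\<lambda>_. w0)) f) = R.pullback (R.proj 1 (\<lambda>_. d) (\<lambda>_. w0)) (\<rho> f)"
proof -
  let ?S = "pullback (proj 1 (\<lambda>_. d) (\<lambda>_. w0))" and ?T = "R.pullback (R.proj 1 (\<lambda>_. d) (\<lambda>_. w0))"
  have "\<rho> (?S f) = poly_subst (\<lambda>i. \<rho> (?S (var i))) f"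
    by (simp add: \<rho>_def poly_restrict_def pullback_def poly_subst_poly_subst)
  also have "\<dots> = poly_subst (\<lambda>i. ?T (\<rho> (var i))) f"
  proof (rule poly_subst_cong[OF f])
    fix i assume "i < length e"
    then obtain a where a: "linear_form a" "lf a = var i" using var_lf by blast
    have "\<rho> (?S (lf a)) = R.lf a - const (a w0) * R.lf d"
      using pullback_proj_lf[OF dual_system_1[OF d(1) UNIV_I d(3)] a(1)] by (simp add: \<rho>_lf a(1) d(1))
    also have "\<dots> = ?T (\<rho> (lf a))"
      using R.pullback_proj_lf[OF R.dual_system_1[OF d] a(1)] by (simp add: \<rho>_lf a(1))
    finally show "\<rho> (?S (var i)) = ?T (\<rho> (var i))" by (simp only: a(2))
  qed
  also have "\<dots> = ?T (\<rho> f)"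
    by (simp add: \<rho>_def poly_restrict_def R.pullback_def poly_subst_poly_subst)
  finally show ?thesis .
qed

text \<open>The localization only involves linear forms vanishing on \<open>X\<close>, so a linear form that is nonzero on
  \<open>X\<close> behaves like a variable which does not occur.\<close>

lemma localize_cancel:
  assumes d: "linear_form d" "w0 \<in> X" "d w0 = 1" and g: "g \<in> polys (length b)" "R.lf d * g \<in> B.J"
  shows "g \<in> B.J"
proof -
  obtain \<eta> where \<eta>: "\<eta> \<in> B.Log" "\<rho> (\<eta> v0) = B.R.Q * (R.lf d * g)" using g by (auto simp: B.J_def)
  note \<eta>f = B.Log_form[OF \<eta>(1)]
  have w0: "w0 \<in> H" using d(2) X_subset by blast
  note dual = dual_system_1[OF d(1) UNIV_I d(3)] and Rdual = R.dual_system_1[OF d(1) w0 d(3)]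
  \<comment> \<open>\<open>?S\<close> sets \<open>d\<close> to zero and fixes the defining forms of
    the localization, so dividing \<open>\<eta> - ?S \<eta>\<close> by \<open>lf d\<close> gives a
    logarithmic form again. As the residue of \<eta> is a multiple of \<open>R.lf d\<close>, which
    is sent to zero, the quotient has residue \<open>g\<close>.\<close>
  let ?S = "pullback (proj 1 (\<lambda>_. d) (\<lambda>_. w0))"
  have form: "poly_form UNIV (length e) (\<lambda>v. \<eta> v - ?S (\<eta> v))"
    using \<eta>f by (intro poly_form_minus) (auto simp: poly_form_def)
  have d0: "lf d \<noteq> 0" "R.lf d \<noteq> 0" using lf_eq_0D[OF d(1) _ UNIV_I] R.lf_eq_0D[OF d(1) _ w0] d(3) by fastforce+
  have "lf d dvd \<eta> v - ?S (\<eta> v)" for v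
    using pullback_proj_diff[OF dual, of "\<eta> v"] by (auto simp: dvd_def)
  then obtain \<theta> where \<theta>: "poly_form UNIV (length e) \<theta>" "\<And>v. \<eta> v - ?S (\<eta> v) = lf d * \<theta> v"
    using poly_form_divide[OF form subspace_W lf_in_polys d0(1)] by auto
  have "lf (df L) dvd \<theta> w" if L: "L \<in> B" "w \<in> L" for L w
  proof -
    have LA: "L \<in> A" using L B_subset by blast
    have L0: "df L w0 = 0" using L(1) d(2) df_eq_0_iff[OF LA UNIV_I, of w0] by (auto simp: arr_localize_def)
    have "?S (lf (df L)) = lf (df L)" using pullback_proj_lf[OF dual df_linear[OF LA]] L0 by simp
    moreover have dvd: "lf (df L) dvd \<eta> w" by (rule B.Log_dvd[OF \<eta>(1) L])
    moreover have "?S (lf (df L)) dvd ?S (\<eta> w)" using poly_subst_dvd[OF dvd] by (simp add: pullback_def)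
    ultimately have "lf (df L) dvd lf d * \<theta> w" unfolding \<theta>(2)[symmetric] by (simp add: dvd_diff)
    moreover have "\<not> lf (df L) dvd lf d"
    proof
      assume dv: "lf (df L) dvd lf d"
      obtain x where x: "df L x = 1" using df_normal[OF LA] .
      show False using lf_dvd_lfD[OF df_linear[OF LA] UNIV_I x d(1) dv UNIV_I L0] d(3) by simp
    qed
    ultimately show ?thesis using prime_df[OF LA] by (simp add: prime_elem_dvd_mult_iff)
  qed
  then have \<theta>L: "\<theta> \<in> B.Log" using \<theta>(1) by (simp add: B.Log_def)
  have "\<rho> (?S (\<eta> v0)) = 0"
    unfolding \<rho>_pullback[OF d(1) w0 d(3) poly_form_in_polys[OF \<eta>f UNIV_I]] \<eta>(2)
    using R.pullback_proj_lf[OF Rdual d(1)] d(3) by simp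
  then have "\<rho> (lf d * \<theta> v0) = B.R.Q * (R.lf d * g)" unfolding \<theta>(2)[symmetric] by (simp add: \<eta>(2))
  then have "R.lf d * \<rho> (\<theta> v0) = R.lf d * (B.R.Q * g)" by (simp add: \<rho>_lf d(1) mult_ac)
  then have "\<rho> (\<theta> v0) = B.R.Q * g" using d0(2) by simp
  then show ?thesis unfolding B.J_def using \<theta>L g(1) by auto
qed

text \<open>The last factor argument reduces the product to one hyperplane not containing
  \<open>X\<close>. Its form is nonzero at a point of \<open>X\<close> and, scaled to the value 1
  there, is cancelled by \<open>localize_cancel\<close>.\<close>

lemma localize_cancel_prod:
  assumes g: "g \<in> polys (length b)" "g * (\<Prod>Y\<in>AH - BH. ry Y ^ k Y) \<in> B.J" shows "g \<in> B.J"
proof (rule ccontr)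
  assume "g \<notin> B.J"
  then obtain c Y where c: "c \<in> polys (length b)" "Y \<in> AH - BH" "g * c \<notin> B.J" "g * c * ry Y \<in> B.J"
    using exists_last_factor[of "AH - BH" ry "length b" "\<lambda>f. f \<in> B.J" g k] g(2) R.finite_A by auto
  then have Y: "Y \<in> AH" "\<not> X \<subseteq> Y" using BH_iff by auto
  then obtain x where x: "x \<in> X" "x \<notin> Y" by blast
  then have nz: "R.df Y x \<noteq> 0" using R.df_eq_0_iff[OF Y(1)] X_subset by blast
  let ?d = "\<lambda>v. inverse (R.df Y x) * R.df Y v"
  have "g * c \<in> B.J"
  proof (rule localize_cancel[of ?d x])
    show "linear_form ?d" by (rule linear_form_cmult[OF R.df_linear[OF Y(1)]])
    have "const (inverse (R.df Y x)) * (g * c * ry Y) \<in> B.J" by (rule B.J_mult[OF c(4)]) simp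
    then show "R.lf ?d * (g * c) \<in> B.J" unfolding R.lf_cmult by (simp only: mult_ac)
  qed (use x nz g c in auto)
  then show False using c(3) by blast
qed

text \<open>A form that is logarithmic for \<open>A\<close> is so for the localization, but its
  residue there has a smaller denominator, which costs the factor \<open>E\<close>. The factors of
  \<open>E\<close> do not vanish identically on \<open>X\<close>, so \<open>E\<close>
  cancels.\<close>

lemma J_subset_localize: "J \<subseteq> B.J"
proof
  fix r assume r: "r \<in> J"
  then have "r \<in> polys (length b)" by (simp add: J_def)
  moreover have "r * (\<Prod>Y\<in>AH - BH. ry Y ^ 1) \<in> B.J" using E_mult_localize[OF r] by (simp add: E_def mult.commute)
  ultimately show "r \<in> B.J" by (rule localize_cancel_prod)
qed

text \<open>Freeness of \<open>A\<close> serves the localization as well: multiplied by the missing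
  powers and by \<open>E\<close>, a form of the localized multirestriction becomes one for
  \<open>A\<close> and can be lifted; the extra powers are then cancelled in
  \<open>B.J\<close>.\<close>

lemma localize_J'_subset:
  assumes free: "free_arrangement e A" and Y: "Y \<in> AH" shows "B.J' \<subseteq> B.J"
proof
  fix g assume "g \<in> B.J'"
  then obtain \<xi> where g: "g \<in> polys (length b)" and \<xi>: "\<xi> \<in> B.Wm" "R.euler \<xi> = B.R.Q * g" by (auto simp: B.J'_def)
  let ?k = "pw (AH - BH)"
  let ?\<xi> = "\<lambda>w. ?k * E * \<xi> w"
  have "ry Z ^ mu Z dvd ?\<xi> w" if Z: "Z \<in> AH" "w \<in> Z" for Z w
  proof (cases "Z \<in> BH")
    case True
    then show ?thesis using B.Wm_dvd[OF \<xi>(1) True Z(2)] B_mu[OF True] by (simp add: dvd_mult)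
  next
    case False
    then have "ry Z ^ mu Z dvd ?k" unfolding pw_def by (intro dvd_prodI) (use R.finite_A Z in auto)
    then show ?thesis by (simp add: dvd_mult2)
  qed
  then have "?\<xi> \<in> Wm" using poly_form_cmult[OF B.Wm_form[OF \<xi>(1)]] by (simp add: Wm_def)
  moreover have "R.euler ?\<xi> = R.Q * (g * ?k)" unfolding R.euler_cmult by (simp add: \<xi>(2) RQ_split mult_ac)
  ultimately have "g * ?k \<in> J'" unfolding J'_def using g by auto
  then have "g * ?k \<in> B.J" using free_J'_eq_J[OF free Y] J_subset_localize by blast
  then show "g \<in> B.J" unfolding pw_def by (rule localize_cancel_prod[OF g])
qed

end

section \<open>Intersecting the residue ideals of the localizations\<close>

context arr_restriction
begin

theorem inter_localize_subset:
  assumes free: "free_arrangement e A" "free_arrangement b AH" and Y0: "Y0 \<in> AH"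
    and g: "g \<in> polys (length b)"
    and loc: "\<And>Y Z. Y \<in> AH \<Longrightarrow> Z \<in> AH \<Longrightarrow> Y \<noteq> Z \<Longrightarrow> g \<in> residue_ideal e b (arr_localize A (Y \<inter> Z)) H"
  shows "g \<in> J"
proof (rule ccontr)
  assume gJ: "g \<notin> J"
  note JJ = free_J'_eq_J[OF free(1) Y0]
  have step: "\<exists>c\<in>polys (length b). \<exists>Z\<in>T. h * c \<notin> J \<and> h * c * ry Z \<in> J"
    if "T \<subseteq> AH" "h * pw T \<in> J" "h \<notin> J" for T h
    by (rule exists_last_factor[of T ry _ "\<lambda>f. f \<in> J" h mu])
      (use that R.finite_A finite_subset in \<open>auto simp: pw_def\<close>)
  have pwY: "h * pw (AH - {Y}) \<in> J" if "Y \<in> AH" "h \<in> polys (length b)" for Y h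
    using J_mult[of "pw (AH - {Y})" h] pw_in_J'[OF that(1)] JJ that(2) by simp
  obtain c1 Y1 where 1: "c1 \<in> polys (length b)" "Y1 \<in> AH" "g * c1 \<notin> J" "g * c1 * ry Y1 \<in> J"
    using step[OF _ pwY[OF Y0 g] gJ] by blast
  have g1: "g * c1 \<in> polys (length b)" using g 1 by simp
  obtain c2 Y2 where 2: "c2 \<in> polys (length b)" "Y2 \<in> AH" "Y1 \<noteq> Y2" "g * c1 * c2 \<notin> J" "g * c1 * c2 * ry Y2 \<in> J"
    using step[OF _ pwY[OF 1(2) g1] 1(3)] by blast
  have "Y1 \<inter> Y2 \<subseteq> H" using R.hyperplane_subset[OF 1(2)] by blast
  then interpret L: arr_localization scale e A b H "Y1 \<inter> Y2" by unfold_locales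
  \<comment> \<open>Membership at \<open>Y1 \<inter> Y2\<close> provides an annihilator composed of
    forms that do not vanish identically on this flat, so the third form is independent of the first
    two.\<close>
  have "g \<in> L.B.J" using loc[OF 1(2) 2(2,3)] L.B.residue_ideal_eq by simp
  then have "pw (AH - L.BH) * g \<in> J" by (rule L.localize_mult)
  then have "c1 * c2 * (pw (AH - L.BH) * g) \<in> J" by (rule J_mult) (use 1 2 in simp)
  then have "g * c1 * c2 * pw (AH - L.BH) \<in> J" by (simp only: mult_ac)
  then obtain c3 Y3 where 3: "c3 \<in> polys (length b)" "Y3 \<in> AH - L.BH" "g * c1 * c2 * c3 \<notin> J" "g * c1 * c2 * c3 * ry Y3 \<in> J"
    using step[of "AH - L.BH" "g * c1 * c2"] 2(4) by blast
  let ?h = "g * c1 * c2 * c3"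
  have Y3: "Y3 \<in> AH" "\<not> Y1 \<inter> Y2 \<subseteq> Y3" using 3(2) L.BH_iff by auto
  then obtain w where w: "w \<in> Y1" "w \<in> Y2" "w \<notin> Y3" by blast
  then have wH: "w \<in> H" using R.hyperplane_subset[OF 1(2)] by blast
  let ?p2 = "(\<lambda>_ :: nat. R.df Y1)(1 := R.df Y2)"
  obtain u where u: "R.dual_system 2 ?p2 u" using R.dual_system_pair[OF 1(2) 2(2,3)] by blast
  have "\<exists>u'. R.dual_system (Suc 2) (?p2(2 := R.df Y3)) u'"
  proof (rule R.dual_system_extend[OF u R.df_linear[OF Y3(1)] wH])
    show "R.df Y3 w \<noteq> 0" using R.df_eq_0_iff[OF Y3(1) wH] w by simp
    fix k :: nat assume "k < 2"
    then show "?p2 k w = 0" using R.df_eq_0_iff[OF 1(2) wH] R.df_eq_0_iff[OF 2(2) wH] w by (auto simp: less_2_cases_iff)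
  qed
  then obtain u' where u': "R.dual_system 3 (?p2(2 := R.df Y3)) u'" by (auto simp: numeral_3_eq_3)
  have hY1: "ry Y1 * ?h \<in> J" using J_mult[OF 1(4), of "c2 * c3"] 2(1) 3(1) by (simp add: mult_ac)
  have hY2: "ry Y2 * ?h \<in> J" using J_mult[OF 2(5), of c3] 3(1) by (simp add: mult_ac)
  have hY3: "ry Y3 * ?h \<in> J" using 3(4) by (simp add: mult_ac)
  have "?h \<in> J'"
  proof (rule free_J'_regular[OF free(2) Y0 u'])
    show "?h \<in> polys (length b)" using g 1 2 3 by simp
    fix k :: nat assume "k < 3"
    then consider "k = 0" | "k = 1" | "k = 2" by linarith
    then show "R.lf ((?p2(2 := R.df Y3)) k) * ?h \<in> J'"
      unfolding JJ using hY1 hY2 hY3 by cases simp_all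
  qed
  then show False using 3(3) JJ by blast
qed

end

section \<open>Multiarrangements of rank two\<close>

text \<open>Forms of degree \<open>d\<close> in \<open>x\<close> and \<open>y\<close>, encoded by
  recursion on the degree instead of monomials, which suits inductions on division by linear forms.
  The decomposition need not be unique.\<close>

fun binary :: "'k::field mpoly \<Rightarrow> 'k mpoly \<Rightarrow> nat \<Rightarrow> 'k mpoly set" where
  "binary x y 0 = range const"
| "binary x y (Suc d) = {x * f + y * g | f g. f \<in> binary x y d \<and> g \<in> binary x y d}"

lemma binary_0 [simp]: "0 \<in> binary x y d"
proof (induction d)
  case 0
  show ?case using rangeI[of const 0] by simp
next
  case (Suc d)
  then show ?case by (auto intro!: exI[of _ 0])
qed

lemma binary_add: "f \<in> binary x y d \<Longrightarrow> g \<in> binary x y d \<Longrightarrow> f + g \<in> binary x y d"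
proof (induction d arbitrary: f g)
  case 0
  then show ?case by (auto simp: const_add[symmetric])
next
  case (Suc d)
  then obtain f1 f2 g1 g2 where *: "f = x * f1 + y * f2" "g = x * g1 + y * g2"
    "f1 \<in> binary x y d" "f2 \<in> binary x y d" "g1 \<in> binary x y d" "g2 \<in> binary x y d" by auto
  have "f + g = x * (f1 + g1) + y * (f2 + g2)" by (simp add: * algebra_simps)
  then show ?case using Suc.IH * by auto
qed

lemma binary_cmult: "f \<in> binary x y d \<Longrightarrow> const c * f \<in> binary x y d"
proof (induction d arbitrary: f)
  case 0
  then show ?case by (auto simp: const_mult[symmetric])
next
  case (Suc d)
  then obtain f1 f2 where *: "f = x * f1 + y * f2" "f1 \<in> binary x y d" "f2 \<in> binary x y d" by auto
  have "const c * f = x * (const c * f1) + y * (const c * f2)" by (simp add: * algebra_simps)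
  then show ?case using Suc.IH * by auto
qed

lemma binary_diff: "f \<in> binary x y d \<Longrightarrow> g \<in> binary x y d \<Longrightarrow> f - g \<in> binary x y d"
  using binary_add[of f x y d "const (- 1) * g"] binary_cmult[of g x y d "- 1"] by (simp add: const_minus)

lemma binary_linear_mult:
  assumes "f \<in> binary x y d" shows "(const a * x + const b * y) * f \<in> binary x y (Suc d)"
proof -
  have "(const a * x + const b * y) * f = x * (const a * f) + y * (const b * f)" by (simp add: algebra_simps)
  then show ?thesis using binary_cmult[OF assms] by auto
qed

lemma binary_power_mult:
  assumes "f \<in> binary x y d" shows "(const a * x + const b * y) ^ k * f \<in> binary x y (k + d)"
proof (induction k)
  case (Suc k)
  have "(const a * x + const b * y) * ((const a * x + const b * y) ^ k * f) \<in> binary x y (Suc (k + d))"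
    by (rule binary_linear_mult[OF Suc])
  then show ?case by (simp add: mult.assoc)
qed (use assms in simp)

lemma binary_power: "(const a * x + const b * y) ^ k \<in> binary x y k"
  using binary_power_mult[of 1 x y 0 a b k] rangeI[of const 1] by simp

text \<open>\<open>l\<close> and \<open>t\<close> form another basis of the linear forms, and modulo
  \<open>l\<close> only the power of \<open>t\<close> is left. Degree 0 is separate: a quotient of
  degree -1 has to vanish, while \<open>d - 1\<close> truncates to 0.\<close>

lemma binary_remainder:
  fixes a b a' b' :: "'k::field"
  assumes det: "a * b' - a' * b \<noteq> 0" and h: "h \<in> binary x y d"
  defines "l \<equiv> const a * x + const b * y" and "t \<equiv> const a' * x + const b' * y"
  shows "\<exists>c h'. h = const c * t ^ d + l * h' \<and> (if d = 0 then h' = 0 else h' \<in> binary x y (d - 1))"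
  using h
proof (induction d arbitrary: h)
  case 0
  then obtain c where "h = const c" by auto
  then show ?case by (intro exI[of _ c] exI[of _ 0]) simp
next
  case (Suc d)
  let ?D = "a * b' - a' * b"
  obtain f g where fg: "h = x * f + y * g" "f \<in> binary x y d" "g \<in> binary x y d" using Suc.prems by auto
  obtain c1 f' where f': "f = const c1 * t ^ d + l * f'" "if d = 0 then f' = 0 else f' \<in> binary x y (d - 1)" using Suc.IH[OF fg(2)] by blast
  obtain c2 g' where g': "g = const c2 * t ^ d + l * g'" "if d = 0 then g' = 0 else g' \<in> binary x y (d - 1)" using Suc.IH[OF fg(3)] by blast
  \<comment> \<open>The entries of the inverse of the matrix with rows (a, b) and (a', b'); they
    express \<open>x\<close> and \<open>y\<close> through \<open>l\<close> and
    \<open>t\<close>.\<close>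
  define p q r s where "p = b' / ?D" and "q = - b / ?D" and "r = - a' / ?D" and "s = a / ?D"
  have "p * a + q * a' = (a * b' - a' * b) / ?D" "p * b + q * b' = 0" "r * a + s * a' = 0" "r * b + s * b' = (a * b' - a' * b) / ?D"
    unfolding p_def q_def r_def s_def by (simp_all add: add_divide_distrib[symmetric] diff_divide_distrib[symmetric] algebra_simps)
  then have coef: "p * a + q * a' = 1" "p * b + q * b' = 0" "r * a + s * a' = 0" "r * b + s * b' = 1"
    using det by simp_all
  have "const p * l + const q * t = const (p * a + q * a') * x + const (p * b + q * b') * y"
    by (simp add: l_def t_def const_add const_mult algebra_simps)
  then have x: "x = const p * l + const q * t" by (simp add: coef)
  have "const r * l + const s * t = const (r * a + s * a') * x + const (r * b + s * b') * y"
    by (simp add: l_def t_def const_add const_mult algebra_simps)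
  then have y: "y = const r * l + const s * t" by (simp add: coef)
  have "x * (const c1 * t ^ d) = const (q * c1) * t ^ Suc d + l * (const (p * c1) * t ^ d)"
    by (subst x) (simp add: const_mult algebra_simps)
  moreover have "y * (const c2 * t ^ d) = const (s * c2) * t ^ Suc d + l * (const (r * c2) * t ^ d)"
    by (subst y) (simp add: const_mult algebra_simps)
  moreover have "h = x * (const c1 * t ^ d) + y * (const c2 * t ^ d) + l * (x * f' + y * g')"
    unfolding fg(1) f'(1) g'(1) by (simp add: algebra_simps)
  ultimately have "h = const (q * c1 + s * c2) * t ^ Suc d +
      l * (const (p * c1) * t ^ d + const (r * c2) * t ^ d + (x * f' + y * g'))"
    by (simp add: const_add algebra_simps)
  moreover have xy: "x * f' + y * g' \<in> binary x y d"
  proof (cases d)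
    case 0
    then show ?thesis using f'(2) g'(2) binary_0[of x y 0] by simp
  next
    case (Suc k)
    then show ?thesis using f'(2) g'(2) by auto
  qed
  have "const (p * c1) * t ^ d + const (r * c2) * t ^ d + (x * f' + y * g') \<in> binary x y d"
    unfolding t_def
    by (rule binary_add[OF binary_add[OF binary_cmult[OF binary_power] binary_cmult[OF binary_power]] xy])
  ultimately show ?case by (intro exI conjI) auto
qed

section \<open>Division of forms in two independent linear forms\<close>

locale binary_forms =
  fixes x y :: "'k::field mpoly" and n :: nat
  assumes xy_polys: "x \<in> polys n" "y \<in> polys n"
    and linear_prime: "a \<noteq> 0 \<or> b \<noteq> 0 \<Longrightarrow> prime_elem (const a * x + const b * y)"
    and linear_not_dvd: "a * b' - a' * b \<noteq> 0 \<Longrightarrow> \<not> const a * x + const b * y dvd const a' * x + const b' * y"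
begin

abbreviation lin :: "'k \<Rightarrow> 'k \<Rightarrow> 'k mpoly" where "lin a b \<equiv> const a * x + const b * y"

lemma lin_in_polys [simp]: "lin a b \<in> polys n" using xy_polys by simp

lemma binary_in_polys: "f \<in> binary x y d \<Longrightarrow> f \<in> polys n"
  using xy_polys by (induction d arbitrary: f) auto

lemma exists_complement: "(a :: 'k) \<noteq> 0 \<or> b \<noteq> 0 \<Longrightarrow> \<exists>a' b'. a * b' - a' * b \<noteq> 0"
proof (cases "a = 0")
  case True
  assume "a \<noteq> 0 \<or> b \<noteq> 0"
  with True have "a * 0 - 1 * b \<noteq> 0" by simp
  then show ?thesis by blast
next
  case False
  then have "a * 1 - 0 * b \<noteq> 0" by simp
  then show ?thesis by blast
qed

lemma remainder_dvd_iff: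
  assumes ab: "a * b' - a' * b \<noteq> 0" and "c \<noteq> 0" "lin a b dvd s * (const c * lin a' b' ^ i)"
  shows "lin a b dvd s"
proof -
  have "a \<noteq> 0 \<or> b \<noteq> 0" using ab by auto
  then have pr: "prime_elem (lin a b)" by (rule linear_prime)
  have "lin a b dvd const c * (s * lin a' b' ^ i)" using assms(3) by (simp only: mult_ac)
  then have "lin a b dvd s * lin a' b' ^ i" using dvd_const_mult_iff[OF \<open>c \<noteq> 0\<close>] by blast
  moreover have "\<not> lin a b dvd lin a' b' ^ i"
    using prime_elem_dvd_powerD[OF pr] linear_not_dvd[OF ab] by blast
  ultimately show ?thesis using pr by (simp add: prime_elem_dvd_mult_iff)
qed

text \<open>The remainder of the product modulo \<open>lin a b\<close> vanishes, because no power of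
  a complementary form is divisible by \<open>lin a b\<close>; the quotient is then the one given by
  \<open>binary_remainder\<close>.\<close>

lemma binary_divide:
  assumes ab: "a \<noteq> 0 \<or> b \<noteq> 0" and f: "lin a b * f \<in> binary x y d"
  shows "f = 0 \<or> (0 < d \<and> f \<in> binary x y (d - 1))"
proof -
  obtain a' b' where det: "a * b' - a' * b \<noteq> 0" using exists_complement[OF ab] by blast
  obtain c h where h: "lin a b * f = const c * lin a' b' ^ d + lin a b * h" "if d = 0 then h = 0 else h \<in> binary x y (d - 1)"
    using binary_remainder[OF det f] by blast
  have "c = 0"
  proof (rule ccontr)
    assume "c \<noteq> 0"
    have "1 * (const c * lin a' b' ^ d) = lin a b * (f - h)" using h(1) by (simp add: algebra_simps)
    then have "lin a b dvd 1 * (const c * lin a' b' ^ d)" by simp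
    then have "lin a b dvd 1" by (rule remainder_dvd_iff[OF det \<open>c \<noteq> 0\<close>])
    then show False using linear_prime[OF ab] by (simp add: prime_elem_def)
  qed
  then have "lin a b * f = lin a b * h" using h(1) by simp
  then have "f = h" using linear_prime[OF ab] by (auto simp: prime_elem_def)
  then show ?thesis using h(2) by (cases "d = 0") auto
qed

lemma binary_divide_power:
  assumes ab: "a \<noteq> 0 \<or> b \<noteq> 0" and f: "lin a b ^ k * f \<in> binary x y d"
  shows "f = 0 \<or> (k \<le> d \<and> f \<in> binary x y (d - k))"
  using f
proof (induction k arbitrary: d)
  case (Suc k)
  have "lin a b * (lin a b ^ k * f) \<in> binary x y d" using Suc.prems by (simp add: mult.assoc)
  from binary_divide[OF ab this] consider "lin a b ^ k * f = 0" | "0 < d" "lin a b ^ k * f \<in> binary x y (d - 1)" by blast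
  then show ?case
  proof cases
    case 1
    then show ?thesis using linear_prime[OF ab] by (auto simp: prime_elem_def)
  next
    case 2
    then show ?thesis using Suc.IH[OF 2(2)] by (auto simp: Suc_le_eq)
  qed
qed simp

section \<open>Modules with two homogeneous generators\<close>

definition gen :: "'k mpoly \<times> 'k mpoly \<Rightarrow> 'k mpoly \<times> 'k mpoly \<Rightarrow> ('k mpoly \<times> 'k mpoly) set" where
  "gen F G = {(s * fst F + t * fst G, s * snd F + t * snd G) | s t. s \<in> polys n \<and> t \<in> polys n}"

text \<open>The value of the form \<open>fst F\<close> dx + \<open>snd F\<close> dy at the vector
  (b, -a), which spans the kernel of \<open>lin a b\<close>.\<close>

definition ev :: "'k \<Rightarrow> 'k \<Rightarrow> 'k mpoly \<times> 'k mpoly \<Rightarrow> 'k mpoly" where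
  "ev a b F = const b * fst F - const a * snd F"

lemma genI: "s \<in> polys n \<Longrightarrow> t \<in> polys n \<Longrightarrow> (s * fst F + t * fst G, s * snd F + t * snd G) \<in> gen F G"
  unfolding gen_def by blast

lemma gen_left: "F \<in> gen F G"
  using genI[OF polys_1 polys_0, of F G] by simp

lemma gen_right: "G \<in> gen F G"
  using genI[OF polys_0 polys_1, of F G] by simp

lemma gen_comm: "gen F G = gen G F"
proof -
  have "gen F G \<subseteq> gen G F" for F G
  proof
    fix z assume "z \<in> gen F G"
    then obtain s t where st: "s \<in> polys n" "t \<in> polys n" "z = (s * fst F + t * fst G, s * snd F + t * snd G)"
      unfolding gen_def by blast
    show "z \<in> gen G F" unfolding st(3) add.commute[of "s * _"] by (rule genI[OF st(2,1)])
  qed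
  then show ?thesis by blast
qed

lemma ev_gen: "ev a b (s * fst F + t * fst G, s * snd F + t * snd G) = s * ev a b F + t * ev a b G"
  by (simp add: ev_def algebra_simps)

definition homog :: "nat \<Rightarrow> ('k mpoly \<times> 'k mpoly) \<Rightarrow> bool" where
  "homog d F \<longleftrightarrow> fst F \<in> binary x y d \<and> snd F \<in> binary x y d"

lemma homog_linear_mult: "homog d F \<Longrightarrow> homog (Suc d) (lin a b * fst F, lin a b * snd F)"
  unfolding homog_def fst_conv snd_conv by (blast intro: binary_linear_mult)

lemma homog_ev: "homog d F \<Longrightarrow> ev a b F \<in> binary x y d"
  unfolding homog_def ev_def by (intro binary_diff binary_cmult) auto

text \<open>Divided by the \<open>k\<close>-th power and reduced modulo \<open>lin a b\<close>,
  \<open>ev a b\<close> kills \<open>G\<close> but not \<open>F\<close>. Since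
  \<open>lin a b\<close> is prime, the sharper condition on s F + t G says that it divides the
  coefficient s.\<close>

lemma gen_step_one:
  assumes ab: "a \<noteq> 0 \<or> b \<noteq> 0" and "\<And>z. z \<in> gen F G \<Longrightarrow> lin a b ^ k dvd ev a b z"
    and G: "lin a b ^ Suc k dvd ev a b G" and F: "\<not> lin a b ^ Suc k dvd ev a b F"
  shows "{z \<in> gen F G. lin a b ^ Suc k dvd ev a b z} = gen (lin a b * fst F, lin a b * snd F) G"
proof (intro equalityI subsetI)
  let ?l = "lin a b"
  have l0: "?l \<noteq> 0" and pr: "prime_elem ?l" using linear_prime[OF ab] by (auto simp: prime_elem_def)
  obtain h where h: "ev a b F = ?l ^ k * h" using assms(2)[OF gen_left] by (auto elim: dvdE)
  have nh: "\<not> ?l dvd h" using F unfolding h by (simp add: l0 mult.commute)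
  fix z assume "z \<in> {z \<in> gen F G. ?l ^ Suc k dvd ev a b z}"
  then obtain s t where st: "s \<in> polys n" "t \<in> polys n" "z = (s * fst F + t * fst G, s * snd F + t * snd G)"
    and z: "?l ^ Suc k dvd ev a b z" unfolding gen_def by blast
  have "?l ^ Suc k dvd t * ev a b G" using G by (rule dvd_mult)
  then have "?l ^ Suc k dvd s * ev a b F" using z unfolding st(3) ev_gen by (metis dvd_add_left_iff)
  then have "?l ^ k * ?l dvd ?l ^ k * (s * h)" unfolding h by (simp add: mult_ac)
  then have "?l dvd s * h" using l0 by simp
  then have "?l dvd s" using pr nh by (simp add: prime_elem_dvd_mult_iff)
  then obtain s' where s': "s' \<in> polys n" "s = ?l * s'" using st(1) l0 by (elim polys_dvdE[where n = n]) auto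
  have "z = (s' * fst (?l * fst F, ?l * snd F) + t * fst G, s' * snd (?l * fst F, ?l * snd F) + t * snd G)"
    unfolding st(3) s'(2) by (simp add: mult_ac)
  then show "z \<in> gen (?l * fst F, ?l * snd F) G" using genI[OF s'(1) st(2), of "(?l * fst F, ?l * snd F)" G] by simp
next
  let ?l = "lin a b"
  fix z assume "z \<in> gen (?l * fst F, ?l * snd F) G"
  then obtain s t where st: "s \<in> polys n" "t \<in> polys n" "z = (s * ?l * fst F + t * fst G, s * ?l * snd F + t * snd G)"
    unfolding gen_def by (auto simp: mult.assoc)
  have "s * ?l \<in> polys n" using st(1) by simp
  then have zg: "z \<in> gen F G" unfolding st(3) by (rule genI[OF _ st(2)])
  have "?l * ?l ^ k dvd (s * ?l) * ev a b F" by (rule mult_dvd_mono[OF dvd_triv_right assms(2)[OF gen_left]])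
  then have "?l ^ Suc k dvd s * ?l * ev a b F" by simp
  then have "?l ^ Suc k dvd ev a b z" unfolding st(3) ev_gen by (rule dvd_add[OF _ dvd_mult[OF G]])
  then show "z \<in> {z \<in> gen F G. ?l ^ Suc k dvd ev a b z}" using zg by blast
qed

lemma gen_shear:
  assumes "c \<in> polys n"
  shows "gen F (fst G - c * fst F, snd G - c * snd F) = gen F G"
proof (intro equalityI subsetI)
  let ?G = "(fst G - c * fst F, snd G - c * snd F)"
  fix z assume "z \<in> gen F ?G"
  then obtain s t where st: "s \<in> polys n" "t \<in> polys n" "z = (s * fst F + t * fst ?G, s * snd F + t * snd ?G)"
    unfolding gen_def by blast
  have "z = ((s - t * c) * fst F + t * fst G, (s - t * c) * snd F + t * snd G)" unfolding st(3) by (simp add: algebra_simps)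
  then show "z \<in> gen F G" using genI[of "s - t * c" t F G] st assms by simp
next
  let ?G = "(fst G - c * fst F, snd G - c * snd F)"
  fix z assume "z \<in> gen F G"
  then obtain s t where st: "s \<in> polys n" "t \<in> polys n" "z = (s * fst F + t * fst G, s * snd F + t * snd G)"
    unfolding gen_def by blast
  have "z = ((s + t * c) * fst F + t * fst ?G, (s + t * c) * snd F + t * snd ?G)" unfolding st(3) by (simp add: algebra_simps)
  then show "z \<in> gen F ?G" using genI[of "s + t * c" t F ?G] st assms by simp
qed

text \<open>Modulo \<open>lin a b\<close> a binary form is a scalar times a power of a complementary
  form. The generator of lower degree therefore eliminates the remainder of the other one by a
  shear, and \<open>gen_step_one\<close> applies.\<close>

lemma gen_step_both:
  assumes ab: "a \<noteq> 0 \<or> b \<noteq> 0" and sub: "\<And>z. z \<in> gen F G \<Longrightarrow> lin a b ^ k dvd ev a b z"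
    and hom: "homog d F" "homog d' G" "d \<le> d'"
    and F: "\<not> lin a b ^ Suc k dvd ev a b F"
  shows "\<exists>F' G' e e'. homog e F' \<and> homog e' G' \<and> {z \<in> gen F G. lin a b ^ Suc k dvd ev a b z} = gen F' G'"
proof -
  let ?l = "lin a b"
  have l0: "?l \<noteq> 0" using linear_prime[OF ab] by (auto simp: prime_elem_def)
  obtain a' b' where det: "a * b' - a' * b \<noteq> 0" using exists_complement[OF ab] by blast
  let ?t = "lin a' b'"
  obtain f where f: "ev a b F = ?l ^ k * f" using sub[OF gen_left] by (auto elim: dvdE)
  obtain g where g: "ev a b G = ?l ^ k * g" using sub[OF gen_right] by (auto elim: dvdE)
  have f0: "f \<noteq> 0" using F f by auto
  have "?l ^ k * f \<in> binary x y d" "?l ^ k * g \<in> binary x y d'" using homog_ev hom f g by metis+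
  then have fd: "k \<le> d" "f \<in> binary x y (d - k)" and gd: "g \<in> binary x y (d' - k)"
    using binary_divide_power[OF ab] f0 binary_0 by blast+
  obtain c h where c: "f = const c * ?t ^ (d - k) + ?l * h" using binary_remainder[OF det fd(2)] by blast
  obtain c' h' where c': "g = const c' * ?t ^ (d' - k) + ?l * h'" using binary_remainder[OF det gd] by blast
  have cn: "c \<noteq> 0" using F unfolding f c by (auto simp: mult_ac)
  \<comment> \<open>The quotient of the two remainders; its degree \<open>d' - d\<close> keeps the
    sheared generator homogeneous of degree \<open>d'\<close>.\<close>
  define r where "r = const (c' / c) * ?t ^ (d' - d)"
  have r: "r \<in> polys n" unfolding r_def by (intro polys_mult polys_const polys_power lin_in_polys)
  let ?G = "(fst G - r * fst F, snd G - r * snd F)"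
  have deg: "d' - k = (d' - d) + (d - k)" using fd(1) hom(3) by simp
  have "r * (const c * ?t ^ (d - k)) = const c' * ?t ^ (d' - k)"
    unfolding r_def deg power_add using cn by (simp add: const_mult[symmetric] mult_ac)
  then have gf: "g - r * f = ?l * (h' - r * h)" unfolding c c' by (simp add: algebra_simps)
  have "ev a b ?G = ev a b G - r * ev a b F" by (simp add: ev_def algebra_simps)
  also have "\<dots> = ?l ^ k * (g - r * f)" unfolding f g right_diff_distrib by (simp only: mult_ac)
  also have "\<dots> = ?l ^ Suc k * (h' - r * h)" unfolding gf by (simp only: power_Suc mult_ac)
  finally have "ev a b ?G = ?l ^ Suc k * (h' - r * h)" .
  then have G: "?l ^ Suc k dvd ev a b ?G" by simp
  have sub': "?l ^ k dvd ev a b z" if "z \<in> gen F ?G" for z using sub that unfolding gen_shear[OF r] .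
  have "{z \<in> gen F ?G. ?l ^ Suc k dvd ev a b z} = gen (?l * fst F, ?l * snd F) ?G"
    by (rule gen_step_one[OF ab sub' G F])
  moreover have "homog (Suc d) (?l * fst F, ?l * snd F)" by (rule homog_linear_mult[OF hom(1)])
  moreover have "homog d' ?G"
  proof -
    have "r * q \<in> binary x y d'" if "q \<in> binary x y d" for q
      using binary_cmult[OF binary_power_mult[OF that, of a' b' "d' - d"], of "c' / c"] hom(3) by (simp add: r_def mult.assoc)
    then show ?thesis using hom(1,2) unfolding homog_def by (auto intro: binary_diff)
  qed
  ultimately show ?thesis unfolding gen_shear[OF r] by blast
qed

lemma gen_step:
  assumes ab: "a \<noteq> 0 \<or> b \<noteq> 0" and sub: "\<And>z. z \<in> gen F G \<Longrightarrow> lin a b ^ k dvd ev a b z"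
    and hom: "homog d F" "homog d' G"
  shows "\<exists>F' G' e e'. homog e F' \<and> homog e' G' \<and> {z \<in> gen F G. lin a b ^ Suc k dvd ev a b z} = gen F' G'"
proof -
  let ?l = "lin a b"
  have sub': "\<And>z. z \<in> gen G F \<Longrightarrow> ?l ^ k dvd ev a b z" using sub gen_comm by blast
  note hl = homog_linear_mult[of _ _ a b]
  consider "?l ^ Suc k dvd ev a b F" "?l ^ Suc k dvd ev a b G"
    | "\<not> ?l ^ Suc k dvd ev a b F" "?l ^ Suc k dvd ev a b G"
    | "?l ^ Suc k dvd ev a b F" "\<not> ?l ^ Suc k dvd ev a b G"
    | "\<not> ?l ^ Suc k dvd ev a b F" "d \<le> d'"
    | "\<not> ?l ^ Suc k dvd ev a b G" "d' \<le> d" by linarith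
  then show ?thesis
  proof cases
    case 1
    have "?l ^ Suc k dvd ev a b z" if z: "z \<in> gen F G" for z
    proof -
      obtain s t where "z = (s * fst F + t * fst G, s * snd F + t * snd G)" using z unfolding gen_def by blast
      then show ?thesis using 1 by (simp only: ev_gen) (intro dvd_add dvd_mult; assumption)
    qed
    then have "{z \<in> gen F G. ?l ^ Suc k dvd ev a b z} = gen F G" by blast
    then show ?thesis using hom by blast
  next
    case 2
    show ?thesis using gen_step_one[OF ab sub 2(2,1)] hl[OF hom(1)] hom(2) by blast
  next
    case 3
    show ?thesis using gen_step_one[OF ab sub' 3] hl[OF hom(2)] hom(1) unfolding gen_comm[of G F] by blast
  next
    case 4
    show ?thesis by (rule gen_step_both[OF ab sub hom 4(2,1)])
  next
    case 5
    show ?thesis using gen_step_both[OF ab sub' hom(2,1) 5(2,1)] unfolding gen_comm[of G F] .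
  qed
qed

text \<open>Two-dimensional multiarrangements are free.\<close>

theorem two_generated:
  assumes fin: "finite I" and ab: "\<And>i. i \<in> I \<Longrightarrow> a i \<noteq> 0 \<or> b i \<noteq> 0"
  shows "\<exists>F G d d'. homog d F \<and> homog d' G \<and>
    {z \<in> polys n \<times> polys n. \<forall>i\<in>I. lin (a i) (b i) ^ k i dvd ev (a i) (b i) z} = gen F G"
proof (induction "\<Sum>i\<in>I. k i" arbitrary: k)
  case 0
  then have "k i = 0" if "i \<in> I" for i using fin that by simp
  then have "{z \<in> polys n \<times> polys n. \<forall>i\<in>I. lin (a i) (b i) ^ k i dvd ev (a i) (b i) z} = polys n \<times> polys n" by auto
  also have "\<dots> = gen (1, 0) (0, 1)" unfolding gen_def by auto
  finally have eq: "{z \<in> polys n \<times> polys n. \<forall>i\<in>I. lin (a i) (b i) ^ k i dvd ev (a i) (b i) z} = gen (1, 0) (0, 1)" .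
  have "homog 0 (1, 0)" "homog 0 (0, 1)" unfolding homog_def using rangeI[of const 1] rangeI[of const 0] by simp_all
  then show ?case using eq by blast
next
  case (Suc m)
  then have "(\<Sum>i\<in>I. k i) \<noteq> 0" by simp
  then obtain j where j: "j \<in> I" "k j \<noteq> 0" using sum.neutral by meson
  \<comment> \<open>One condition is relaxed by a single power; \<open>gen_step\<close> restores it
    at the price of new generators.\<close>
  let ?k = "k(j := k j - 1)"
  have "(\<Sum>i\<in>I. k i) = k j + (\<Sum>i\<in>I - {j}. k i)" by (rule sum.remove[OF fin j(1)])
  moreover have "(\<Sum>i\<in>I. ?k i) = (k j - 1) + (\<Sum>i\<in>I - {j}. k i)"
    by (subst sum.remove[OF fin j(1)]) simp
  ultimately have "m = (\<Sum>i\<in>I. ?k i)" using Suc.hyps(2) j(2) by simp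
  from Suc.hyps(1)[OF this] obtain F G d d' where hom: "homog d F" "homog d' G"
    and eq: "{z \<in> polys n \<times> polys n. \<forall>i\<in>I. lin (a i) (b i) ^ ?k i dvd ev (a i) (b i) z} = gen F G" by blast
  have sub: "lin (a j) (b j) ^ (k j - 1) dvd ev (a j) (b j) z" if "z \<in> gen F G" for z
    using that j(1) unfolding eq[symmetric] by auto
  have "{z \<in> polys n \<times> polys n. \<forall>i\<in>I. lin (a i) (b i) ^ k i dvd ev (a i) (b i) z}
      = {z \<in> gen F G. lin (a j) (b j) ^ k j dvd ev (a j) (b j) z}" (is "?A = ?B")
  proof (intro equalityI subsetI)
    fix z assume z: "z \<in> ?A"
    have "lin (a i) (b i) ^ ?k i dvd ev (a i) (b i) z" if "i \<in> I" for i
    proof -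
      have "lin (a i) (b i) ^ ?k i dvd lin (a i) (b i) ^ k i" by (rule le_imp_power_dvd) simp
      also have "\<dots> dvd ev (a i) (b i) z" using z that by blast
      finally show ?thesis .
    qed
    then show "z \<in> ?B" using z j(1) unfolding eq[symmetric] by blast
  next
    fix z assume z: "z \<in> ?B"
    then have "z \<in> gen F G" by blast
    then have "z \<in> polys n \<times> polys n" "\<forall>i\<in>I. lin (a i) (b i) ^ ?k i dvd ev (a i) (b i) z" unfolding eq[symmetric] by blast+
    moreover have "lin (a i) (b i) ^ k i dvd ev (a i) (b i) z" if "i \<in> I" for i
      using that z calculation(2) by (cases "i = j") auto
    ultimately show "z \<in> ?A" by blast
  qed
  also have "k j = Suc (k j - 1)" using j(2) by simp
  finally show ?case using gen_step[OF ab[OF j(1)] sub hom] by simp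
qed

end

section \<open>Completing dual systems\<close>

context based_space
begin

text \<open>Fewer than \<open>length e\<close> vectors do not span \<open>W\<close>, so some
  projection is nonzero. A coordinate function that is nonzero on it is the new form, as the old
  forms vanish there.\<close>

lemma dual_system_extend_one:
  assumes d: "dual_system m p u" and m: "m < length e"
  shows "\<exists>q u'. dual_system (Suc m) (p(m := q)) u'"
proof -
  have "\<exists>w\<in>W. proj m p u w \<noteq> 0"
  proof (rule ccontr)
    assume "\<not> ?thesis"
    then have w: "w = (\<Sum>k<m. p k w *s u k)" if "w \<in> W" for w using that by (simp add: proj_def)
    have "W \<subseteq> span (u ` {..<m})"
    proof
      fix v assume "v \<in> W"
      have "(\<Sum>k<m. p k v *s u k) \<in> span (u ` {..<m})" by (intro span_sum span_scale span_base) auto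
      then show "v \<in> span (u ` {..<m})" using w[OF \<open>v \<in> W\<close>] by simp
    qed
    then have "set e \<subseteq> span (u ` {..<m})" using span_superset[of "set e"] span_e by blast
    then have "card (set e) \<le> card (u ` {..<m})" using independent_span_bound[of "u ` {..<m}" "set e"] indep_e by simp
    also have "\<dots> \<le> m" using card_image_le[of "{..<m}" u] by simp
    finally show False using m distinct_card[OF distinct_e] by simp
  qed
  then obtain v where v: "v \<in> W" "proj m p u v \<noteq> 0" by blast
  let ?w = "proj m p u v"
  have wW: "?w \<in> W" by (rule proj_in_W[OF d v(1)])
  have "\<exists>i<length e. coord ?w i \<noteq> 0"
  proof (rule ccontr)
    assume "\<not> ?thesis"
    then have "(\<Sum>i<length e. coord ?w i *s e ! i) = 0" by (intro sum.neutral) simp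
    then show False using coord_expand[OF wW] v(2) by simp
  qed
  then obtain i where i: "i < length e" "coord ?w i \<noteq> 0" by blast
  then obtain q where q: "linear_form q" "\<forall>w\<in>W. q w = coord w i" using var_lf by blast
  show ?thesis using dual_system_extend[OF d q(1) wW _ form_proj[OF d]] q(2) wW i(2) by auto
qed

lemma dual_system_extend_full:
  assumes d: "dual_system m p u" and m: "m \<le> k" "k \<le> length e"
  shows "\<exists>p' u'. dual_system k p' u' \<and> (\<forall>j<m. p' j = p j)"
  using m
proof (induction k rule: dec_induct)
  case base
  show ?case using d by blast
next
  case (step k)
  then obtain p' u' where p': "dual_system k p' u'" "\<forall>j<m. p' j = p j" by auto
  obtain q u'' where "dual_system (Suc k) (p'(k := q)) u''" using dual_system_extend_one[OF p'(1)] step by auto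
  moreover have "\<forall>j<m. (p'(k := q)) j = p j" using p'(2) step(1) by auto
  ultimately show ?case by blast
qed

text \<open>Source of the flag of primes: for a projection \<open>T\<close>, the kernel is the ideal
  generated by the linear forms it sends to zero.\<close>

lemma primeideal_kernel:
  "primeideal {f \<in> polys (length e). pullback T f = 0} (poly_ring (length e))"
  unfolding primeideal_poly_ring_iff ideal_poly_ring_iff by auto

end

section \<open>Restrictions of rank two\<close>

locale rank_two = arr_restriction scale e A b H
  for scale :: "'a::field \<Rightarrow> 'b::ab_group_add \<Rightarrow> 'b" and e A b H +
  fixes Y1 Y2 :: "'b set"
  assumes Y1: "Y1 \<in> arr_restrict A H" and Y2: "Y2 \<in> arr_restrict A H" and Y12: "Y1 \<noteq> Y2"
    and center: "Y \<in> arr_restrict A H \<Longrightarrow> Y1 \<inter> Y2 \<subseteq> Y"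
begin

definition p :: "nat \<Rightarrow> 'b \<Rightarrow> 'a" where "p = (\<lambda>_. R.df Y1)(1 := R.df Y2)"

definition u :: "nat \<Rightarrow> 'b" where "u = (SOME u. R.dual_system 2 p u)"

lemma dual: "R.dual_system 2 p u"
proof -
  obtain u' where "R.dual_system 2 p u'" using R.dual_system_pair[OF Y1 Y2 Y12] unfolding p_def by blast
  then show ?thesis unfolding u_def by (rule someI[of "R.dual_system 2 p"])
qed

lemma p_linear: "linear_form (p 0)" "linear_form (p 1)"
  and u_in_H: "u 0 \<in> H" "u 1 \<in> H"
  and p_u: "p 0 (u 0) = 1" "p 0 (u 1) = 0" "p 1 (u 0) = 0" "p 1 (u 1) = 1"
  using dual by (simp_all add: R.dual_system_def)

abbreviation x :: "'a mpoly" where "x \<equiv> R.lf (p 0)"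
abbreviation y :: "'a mpoly" where "y \<equiv> R.lf (p 1)"

definition ca :: "'b set \<Rightarrow> 'a" where "ca Y = R.df Y (u 0)"
definition cb :: "'b set \<Rightarrow> 'a" where "cb Y = R.df Y (u 1)"

lemma proj_center: "w \<in> H \<Longrightarrow> R.proj 2 p u w \<in> Y1 \<inter> Y2"
proof -
  assume w: "w \<in> H"
  have "R.proj 2 p u w \<in> H" by (rule R.proj_in_W[OF dual w])
  moreover have "p 0 (R.proj 2 p u w) = 0" "p 1 (R.proj 2 p u w) = 0" by (rule R.form_proj[OF dual]; simp)+
  ultimately show ?thesis using R.hyperplaneI[OF Y1] R.hyperplaneI[OF Y2] by (simp add: p_def)
qed

lemma lessThan_2: "{..<2::nat} = {0, 1}" by auto

text \<open>\<open>w\<close> differs from its components along \<open>u 0\<close> and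
  \<open>u 1\<close> by a vector of the center, which \<open>Y\<close> contains.\<close>

lemma df_expand:
  assumes Y: "Y \<in> AH" and w: "w \<in> H"
  shows "R.df Y w = ca Y * p 0 w + cb Y * p 1 w"
proof -
  have "R.proj 2 p u w \<in> Y" using proj_center[OF w] center[OF Y] by blast
  then have "R.df Y (R.proj 2 p u w) = 0" using R.df_kernel[OF Y] by blast
  then show ?thesis
    unfolding R.proj_def lessThan_2 by (simp add: linear_form_simps[OF R.df_linear[OF Y]] ca_def cb_def algebra_simps)
qed

lemma ry_eq: "Y \<in> AH \<Longrightarrow> ry Y = const (ca Y) * x + const (cb Y) * y"
  unfolding R.lf_combination[symmetric] by (rule R.lf_cong) (simp add: df_expand)

lemma ca_cb_nonzero:
  assumes "Y \<in> AH" shows "ca Y \<noteq> 0 \<or> cb Y \<noteq> 0"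
proof -
  obtain v where v: "v \<in> H" "R.df Y v = 1" using R.df_normal[OF assms] .
  then show ?thesis using df_expand[OF assms v(1)] by auto
qed

lemma det_nonzero:
  assumes Y: "Y \<in> AH" and Z: "Z \<in> AH" "Y \<noteq> Z"
  shows "ca Y * cb Z - ca Z * cb Y \<noteq> 0"
proof
  assume det: "ca Y * cb Z - ca Z * cb Y = 0"
  have "Y \<subseteq> Z"
  proof
    fix w assume w: "w \<in> Y"
    then have wH: "w \<in> H" using R.hyperplane_subset[OF Y] by blast
    have "R.df Y w = 0" using R.df_kernel[OF Y] w by blast
    then have 0: "ca Y * p 0 w + cb Y * p 1 w = 0" unfolding df_expand[OF Y wH] .
    have "ca Y * R.df Z w = ca Z * (ca Y * p 0 w + cb Y * p 1 w) + (ca Y * cb Z - ca Z * cb Y) * p 1 w"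
      unfolding df_expand[OF Z(1) wH] by (simp add: algebra_simps)
    moreover have "cb Y * R.df Z w = cb Z * (ca Y * p 0 w + cb Y * p 1 w) - (ca Y * cb Z - ca Z * cb Y) * p 0 w"
      unfolding df_expand[OF Z(1) wH] by (simp add: algebra_simps)
    ultimately have "ca Y * R.df Z w = 0" "cb Y * R.df Z w = 0" unfolding 0 det by simp_all
    then have "R.df Z w = 0" using ca_cb_nonzero[OF Y] by auto
    then show "w \<in> Z" by (rule R.hyperplaneI[OF Z(1) wH])
  qed
  then show False using R.hyperplane_subset_eq[OF Y Z(1)] Z(2) by blast
qed

lemma combination_value: "a \<noteq> 0 \<or> c \<noteq> 0 \<Longrightarrow> \<exists>w\<in>H. a * p 0 w + c * p 1 w = 1"
proof (cases "a = 0")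
  case True
  assume "a \<noteq> 0 \<or> c \<noteq> 0"
  then have "a * p 0 (inverse c *s u 1) + c * p 1 (inverse c *s u 1) = 1"
    using True p_u unfolding linear_form_scale[OF p_linear(1)] linear_form_scale[OF p_linear(2)] by simp
  then show ?thesis using subspace_scale[OF R.subspace_W u_in_H(2)] by blast
next
  case False
  then have "a * p 0 (inverse a *s u 0) + c * p 1 (inverse a *s u 0) = 1"
    using p_u unfolding linear_form_scale[OF p_linear(1)] linear_form_scale[OF p_linear(2)] by simp
  then show ?thesis using subspace_scale[OF R.subspace_W u_in_H(1)] by blast
qed

sublocale BF: binary_forms x y "length b"
proof
  fix a c :: 'a assume ac: "a \<noteq> 0 \<or> c \<noteq> 0"
  obtain w where w: "w \<in> H" "a * p 0 w + c * p 1 w = 1" using combination_value[OF ac] by blast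
  show "prime_elem (const a * x + const c * y)"
    unfolding R.lf_combination[symmetric]
    by (rule R.prime_elem_lf[OF linear_form_combination[OF p_linear] w])
next
  fix a b' a' c :: 'a assume det: "a * b' - a' * c \<noteq> 0"
  then have ac: "a \<noteq> 0 \<or> c \<noteq> 0" by auto
  obtain w where w: "w \<in> H" "a * p 0 w + c * p 1 w = 1" using combination_value[OF ac] by blast
  let ?v = "c *s u 0 - a *s u 1"
  have v: "?v \<in> H" using u_in_H by (intro R.W_closed)
  have pv: "p 0 ?v = c" "p 1 ?v = - a"
    unfolding linear_form_simps[OF p_linear(1)] linear_form_simps[OF p_linear(2)] p_u by simp_all
  show "\<not> const a * x + const c * y dvd const a' * x + const b' * y"
  proof
    assume "const a * x + const c * y dvd const a' * x + const b' * y"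
    from R.lf_dvd_lfD[OF linear_form_combination[OF p_linear] w linear_form_combination[OF p_linear]
        this[folded R.lf_combination] v]
    have "a' * p 0 ?v + b' * p 1 ?v = 0" unfolding pv by (simp add: mult.commute)
    then show False using det unfolding pv by (simp add: algebra_simps)
  qed
qed (simp_all)

text \<open>The multirestriction seen in the plane of \<open>u 0\<close> and \<open>u 1\<close>:
  pairs of coefficients of dx and dy, with the values on the center forgotten.\<close>

definition N :: "('a mpoly \<times> 'a mpoly) set" where
  "N = {z \<in> polys (length b) \<times> polys (length b). \<forall>Y\<in>AH. BF.lin (ca Y) (cb Y) ^ mu Y dvd BF.ev (ca Y) (cb Y) z}"

lemma pair_in_N:
  assumes \<xi>: "\<xi> \<in> Wm" shows "(\<xi> (u 0), \<xi> (u 1)) \<in> N"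
proof -
  note f = Wm_form[OF \<xi>]
  have "BF.lin (ca Y) (cb Y) ^ mu Y dvd BF.ev (ca Y) (cb Y) (\<xi> (u 0), \<xi> (u 1))" if Y: "Y \<in> AH" for Y
  proof -
    let ?w = "cb Y *s u 0 - ca Y *s u 1"
    have w: "?w \<in> H" using u_in_H by (intro R.W_closed)
    have "?w \<in> Y"
      by (rule R.hyperplaneI[OF Y w]) (simp add: linear_form_simps[OF R.df_linear[OF Y]] ca_def cb_def)
    then have "ry Y ^ mu Y dvd \<xi> ?w" by (rule Wm_dvd[OF \<xi> Y])
    also have "\<xi> ?w = \<xi> (cb Y *s u 0) - \<xi> (ca Y *s u 1)"
      by (rule R.poly_form_diff[OF f]) (intro R.W_closed u_in_H)+
    also have "\<dots> = BF.ev (ca Y) (cb Y) (\<xi> (u 0), \<xi> (u 1))"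
      unfolding poly_form_scale[OF f u_in_H(1)] poly_form_scale[OF f u_in_H(2)] BF.ev_def by simp
    finally show ?thesis unfolding ry_eq[OF Y] .
  qed
  then show ?thesis unfolding N_def using poly_form_in_polys[OF f] u_in_H by auto
qed

text \<open>On \<open>Y\<close> the vector (\<open>p 0 w\<close>, \<open>p 1 w\<close>) is
  proportional to (\<open>cb Y\<close>, \<open>- ca Y\<close>), so a nonzero multiple of the value
  at \<open>w\<close> is a multiple of \<open>ev\<close>, whichever of \<open>ca Y\<close> and
  \<open>cb Y\<close> is nonzero.\<close>

lemma form_in_Wm:
  assumes z: "z \<in> N" shows "(\<lambda>w. const (p 0 w) * fst z + const (p 1 w) * snd z) \<in> Wm"
  unfolding Wm_def
proof (intro CollectI conjI ballI)
  let ?\<xi> = "\<lambda>w. const (p 0 w) * fst z + const (p 1 w) * snd z"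
  have zp: "fst z \<in> polys (length b)" "snd z \<in> polys (length b)" using z by (auto simp: N_def)
  show "poly_form H (length b) ?\<xi>" by (intro poly_form_plus poly_form_linear_form p_linear zp)
  fix Y w assume Y: "Y \<in> AH" "w \<in> Y"
  then have wH: "w \<in> H" using R.hyperplane_subset[OF Y(1)] by blast
  let ?e = "BF.ev (ca Y) (cb Y) z"
  have dvd: "ry Y ^ mu Y dvd ?e" using z Y(1) unfolding N_def ry_eq[OF Y(1)] by blast
  have "R.df Y w = 0" using R.df_kernel[OF Y(1)] Y(2) by blast
  then have "ca Y * p 0 w + cb Y * p 1 w = 0" unfolding df_expand[OF Y(1) wH] .
  then have rel: "const (ca Y) * const (p 0 w) = - (const (cb Y) * const (p 1 w))"
    by (metis const_minus const_mult eq_neg_iff_add_eq_0)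
  have "const (cb Y) * ?\<xi> w = const (p 0 w) * (const (cb Y) * fst z) + (const (cb Y) * const (p 1 w)) * snd z"
    by (simp add: algebra_simps)
  also have "const (cb Y) * const (p 1 w) = - (const (ca Y) * const (p 0 w))" unfolding rel by simp
  finally have 1: "const (cb Y) * ?\<xi> w = const (p 0 w) * ?e" by (simp add: BF.ev_def algebra_simps)
  have "const (ca Y) * ?\<xi> w = (const (ca Y) * const (p 0 w)) * fst z + const (p 1 w) * (const (ca Y) * snd z)"
    by (simp add: algebra_simps)
  then have 2: "const (ca Y) * ?\<xi> w = - const (p 1 w) * ?e" unfolding rel by (simp add: BF.ev_def algebra_simps)
  from ca_cb_nonzero[OF Y(1)] show "ry Y ^ mu Y dvd ?\<xi> w"
  proof
    assume a: "ca Y \<noteq> 0"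
    have "ry Y ^ mu Y dvd const (ca Y) * ?\<xi> w" unfolding 2 by (rule dvd_mult[OF dvd])
    then show ?thesis unfolding dvd_const_mult_iff[OF a] .
  next
    assume c: "cb Y \<noteq> 0"
    have "ry Y ^ mu Y dvd const (cb Y) * ?\<xi> w" unfolding 1 by (rule dvd_mult[OF dvd])
    then show ?thesis unfolding dvd_const_mult_iff[OF c] .
  qed
qed

lemma euler_pair:
  "R.euler (\<lambda>w. const (p 0 w) * fst z + const (p 1 w) * snd z) = x * fst z + y * snd z"
  unfolding R.euler_add R.euler_linear_form ..

lemma Wm_subset_Log: "\<xi> \<in> Wm \<Longrightarrow> \<xi> \<in> R.Log"
  unfolding R.Log_def
proof (intro CollectI conjI ballI)
  assume \<xi>: "\<xi> \<in> Wm"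
  then show "poly_form H (length b) \<xi>" by (rule Wm_form)
  fix Y w assume Y: "Y \<in> AH" "w \<in> Y"
  show "ry Y dvd \<xi> w" by (rule dvd_mult_left) (rule Wm_dvd[OF \<xi> Y, unfolded mu_Suc[OF Y(1)]])
qed

lemma homogeneous_quotient:
  assumes "finite T" "T \<subseteq> AH" "(\<Prod>Y\<in>T. ry Y) * g \<in> binary x y d"
  shows "\<exists>d'. g \<in> binary x y d'"
  using assms
proof (induction T arbitrary: g d)
  case (insert Y T)
  then have Y: "Y \<in> AH" by simp
  have "BF.lin (ca Y) (cb Y) * ((\<Prod>Y\<in>T. ry Y) * g) \<in> binary x y d"
    using insert.prems(2) insert.hyps unfolding ry_eq[OF Y, symmetric] by (simp add: mult.assoc)
  from BF.binary_divide[OF ca_cb_nonzero[OF Y] this] obtain d' where "(\<Prod>Y\<in>T. ry Y) * g \<in> binary x y d'"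
    by (metis binary_0)
  then show ?case using insert.IH insert.prems(1) by blast
qed auto

text \<open>Besides its two coefficients, a member of \<open>Wm\<close> has values on the center.
  There all divisibility conditions hold at once, so these values contribute only multiples of
  \<open>pw AH = R.Q * \<beta>\<close>. As \<beta> itself comes from a pair in \<open>N\<close>, the
  contractions of the two generators of \<open>N\<close> suffice.\<close>

lemma J'_two_generated:
  "\<exists>G0\<in>J'. \<exists>G1\<in>J'. (\<exists>d. G0 \<in> binary x y d) \<and> (\<exists>d. G1 \<in> binary x y d) \<and>
     J' = {s * G0 + t * G1 | s t. s \<in> polys (length b) \<and> t \<in> polys (length b)}"
proof -
  obtain F G d d' where hom: "BF.homog d F" "BF.homog d' G" and N: "N = BF.gen F G"
    using BF.two_generated[OF R.finite_A, of ca cb mu] ca_cb_nonzero unfolding N_def by blast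
  have gen: "\<exists>g\<in>J'. x * fst z + y * snd z = R.Q * g" if z: "z \<in> N" for z
  proof -
    let ?\<xi> = "\<lambda>w. const (p 0 w) * fst z + const (p 1 w) * snd z"
    have \<xi>: "?\<xi> \<in> Wm" by (rule form_in_Wm[OF z])
    have "R.Q dvd R.euler ?\<xi>" by (rule R.euler_Log[OF Wm_subset_Log[OF \<xi>]])
    then obtain g where g: "g \<in> polys (length b)" "R.euler ?\<xi> = R.Q * g"
      using R.euler_in_polys[OF Wm_form[OF \<xi>]] by (elim polys_dvdE[where n = "length b"]) auto
    then have "g \<in> J'" unfolding J'_def using \<xi> by auto
    then show ?thesis using g(2) unfolding euler_pair by blast
  qed
  obtain G0 where G0: "G0 \<in> J'" "x * fst F + y * snd F = R.Q * G0" using gen[of F] N BF.gen_left by blast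
  obtain G1 where G1: "G1 \<in> J'" "x * fst G + y * snd G = R.Q * G1" using gen[of G] N BF.gen_right by blast
  have comb: "\<exists>s\<in>polys (length b). \<exists>t\<in>polys (length b). x * fst z + y * snd z = R.Q * (s * G0 + t * G1)" if z: "z \<in> N" for z
  proof -
    obtain s t where st: "s \<in> polys (length b)" "t \<in> polys (length b)" "z = (s * fst F + t * fst G, s * snd F + t * snd G)"
      using z unfolding N BF.gen_def by blast
    have "x * fst z + y * snd z = s * (x * fst F + y * snd F) + t * (x * fst G + y * snd G)"
      unfolding st(3) by (simp add: algebra_simps)
    also have "\<dots> = R.Q * (s * G0 + t * G1)" unfolding G0(2) G1(2) by (simp add: algebra_simps)
    finally show ?thesis using st by blast
  qed
  have bin: "\<exists>d. g \<in> binary x y d"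
    if eq: "x * f1 + y * f2 = R.Q * g" and f: "f1 \<in> binary x y d" "f2 \<in> binary x y d" for f1 f2 g d
  proof -
    have "R.Q * g \<in> binary x y (Suc d)" unfolding eq[symmetric] using f by auto
    then show ?thesis using homogeneous_quotient[OF R.finite_A order_refl] unfolding R.Q_def by blast
  qed
  have "J' \<subseteq> {s * G0 + t * G1 | s t. s \<in> polys (length b) \<and> t \<in> polys (length b)}"
  proof
    obtain F1 where F1: "(\<lambda>w. const (R.df Y1 w) * F1) \<in> Wm" "ry Y1 * F1 = R.Q * \<beta>" using \<beta>_form[OF Y1] by blast
    have p0: "p 0 = R.df Y1" by (simp add: p_def)
    obtain s1 t1 where s1: "s1 \<in> polys (length b)" "t1 \<in> polys (length b)" "\<beta> = s1 * G0 + t1 * G1"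
    proof -
      have "x * F1 = R.Q * \<beta>" using F1(2) by (simp add: p0)
      then show ?thesis using comb[OF pair_in_N[OF F1(1)]] p_u that by (auto simp: p0)
    qed
    fix r assume "r \<in> J'"
    then obtain \<xi> where r: "r \<in> polys (length b)" and \<xi>: "\<xi> \<in> Wm" "R.euler \<xi> = R.Q * r" unfolding J'_def by blast
    obtain s t where st: "s \<in> polys (length b)" "t \<in> polys (length b)"
      "x * \<xi> (u 0) + y * \<xi> (u 1) = R.Q * (s * G0 + t * G1)" using comb[OF pair_in_N[OF \<xi>(1)]] by auto
    let ?z = "\<Sum>i<length b. var i * \<xi> (R.proj 2 p u (b ! i))"
    have "pw AH dvd ?z"
    proof (intro dvd_sum dvd_mult)
      fix i assume "i \<in> {..<length b}"
      then have "R.proj 2 p u (b ! i) \<in> Y" if "Y \<in> AH" for Y using proj_center[of "b ! i"] center[OF that] by auto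
      then show "pw AH dvd \<xi> (R.proj 2 p u (b ! i))"
        unfolding pw_def by (intro prod_prime_powers_dvd[OF R.finite_A R.prime_df R.df_not_dvd] Wm_dvd[OF \<xi>(1)])
    qed
    moreover have zp: "?z \<in> polys (length b)"
      using poly_form_in_polys[OF Wm_form[OF \<xi>(1)]] R.proj_in_W[OF dual] by (intro polys_sum polys_mult polys_var) auto
    moreover have "pw AH \<noteq> 0" unfolding pw_def using R.finite_A R.df_nonzero by simp
    ultimately obtain k where k: "k \<in> polys (length b)" "?z = pw AH * k"
      by (elim polys_dvdE[where n = "length b"]) auto
    have "R.Q * r = ?z + (x * \<xi> (u 0) + y * \<xi> (u 1))"
      using R.euler_proj[OF Wm_form[OF \<xi>(1)] dual] \<xi>(2) by (simp add: lessThan_2)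
    also have "\<dots> = R.Q * ((k * s1 + s) * G0 + (k * t1 + t) * G1)"
      unfolding k(2) st(3) Q_\<beta>[symmetric] s1(3) by (simp add: algebra_simps)
    finally have "r = (k * s1 + s) * G0 + (k * t1 + t) * G1" by simp
    then show "r \<in> {s * G0 + t * G1 | s t. s \<in> polys (length b) \<and> t \<in> polys (length b)}"
      using k(1) s1 st by (intro CollectI exI[of _ "k * s1 + s"] exI[of _ "k * t1 + t"]) auto
  qed
  moreover have "{s * G0 + t * G1 | s t. s \<in> polys (length b) \<and> t \<in> polys (length b)} \<subseteq> J'"
  proof
    fix z assume "z \<in> {s * G0 + t * G1 | s t. s \<in> polys (length b) \<and> t \<in> polys (length b)}"
    then obtain s t where st: "z = s * G0 + t * G1" "s \<in> polys (length b)" "t \<in> polys (length b)" by blast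
    show "z \<in> J'" unfolding st(1) by (intro J'_add J'_mult G0(1) G1(1) st)
  qed
  ultimately have eq: "J' = {s * G0 + t * G1 | s t. s \<in> polys (length b) \<and> t \<in> polys (length b)}" by (rule subset_antisym)
  have "\<exists>d. G0 \<in> binary x y d" "\<exists>d. G1 \<in> binary x y d"
    using bin[OF G0(2), of d] bin[OF G1(2), of d'] hom unfolding BF.homog_def by simp_all
  then show ?thesis by (intro bexI[OF _ G0(1)] bexI[OF _ G1(1)] conjI eq)
qed

lemma J'_ideal: "ideal J' (poly_ring (length b))"
proof -
  have "(\<lambda>w. 0) \<in> Wm" by (simp add: Wm_def poly_form_def)
  then have "0 \<in> J'" unfolding J'_def by (auto intro!: bexI[of _ "\<lambda>w. 0"] simp: R.euler_def)
  moreover have "J' \<subseteq> polys (length b)" by (auto simp: J'_def)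
  ultimately show ?thesis unfolding ideal_poly_ring_iff using J'_add J'_mult by blast
qed

text \<open>The flag is given by the ideals of the first \<open>k\<close> forms of a full dual
  system beginning with \<open>x\<close> and \<open>y\<close>. Properness of \<open>J'\<close>
  excludes nonzero constants as homogeneous generators, so \<open>J'\<close> lies in (x, y). A prime
  over \<open>J'\<close> contains for each \<open>Y\<close> the form of some \<open>Z\<close>
  different from \<open>Y\<close>, hence two independent combinations of \<open>x\<close> and
  \<open>y\<close>; so (x, y) is the least such prime.\<close>

theorem rank_two_complete_intersection:
  assumes proper: "J' \<noteq> polys (length b)" and n: "2 \<le> length b"
  shows "complete_intersection (length b) J' \<and> ideal_height (poly_ring (length b)) J' = 2"
proof -
  let ?n = "length b"
  obtain G0 G1 d0 d1 where G: "G0 \<in> J'" "G1 \<in> J'" "G0 \<in> binary x y d0" "G1 \<in> binary x y d1"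
    and J': "J' = {s * G0 + t * G1 | s t. s \<in> polys ?n \<and> t \<in> polys ?n}" using J'_two_generated by blast
  have Gp: "G0 \<in> polys ?n" "G1 \<in> polys ?n" using G(1,2) by (auto simp: J'_def)
  obtain q v where qv: "R.dual_system ?n q v" "\<forall>j<2. q j = p j" using R.dual_system_extend_full[OF dual n] by blast
  have dk: "R.dual_system k q v" if "k \<le> ?n" for k by (rule R.dual_system_mono[OF qv(1) that])
  define Fl where "Fl = (\<lambda>k. {f \<in> polys ?n. R.pullback (R.proj k q v) f = 0})"
  have Fl2: "f \<in> Fl 2 \<longleftrightarrow> f \<in> polys ?n \<and> (\<exists>g h. f = x * g + y * h)" for f
  proof -
    have "R.pullback (R.proj 2 q v) f = 0 \<longleftrightarrow> (\<exists>g. f = x * g 0 + y * g (1 :: nat))"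
      unfolding R.pullback_proj_eq_0_iff[OF dk[OF n]] lessThan_2 using qv(2) by simp
    also have "\<dots> \<longleftrightarrow> (\<exists>g h. f = x * g + y * h)"
    proof
      assume "\<exists>g h. f = x * g + y * h"
      then obtain g h where "f = x * g + y * h" by blast
      then show "\<exists>g. f = x * g 0 + y * g (1 :: nat)" by (intro exI[of _ "\<lambda>i. if i = 0 then g else h"]) simp
    qed blast
    finally show ?thesis by (simp add: Fl_def)
  qed
  have one: "1 \<notin> J'" using proper J'_mult[of 1] by (auto simp: J'_def)
  have bin: "g \<in> Fl 2" if gJ: "g \<in> J'" and gb: "g \<in> binary x y d" for g d
  proof (cases d)
    case 0
    then obtain c where c: "g = const c" using gb by auto
    have "c = 0"
    proof (rule ccontr)
      assume "c \<noteq> 0"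
      then have "1 = const (inverse c) * g" using const_mult_inverse[of c] by (simp add: c mult.commute)
      then show False using one J'_mult[OF gJ, of "const (inverse c)"] by simp
    qed
    then show ?thesis unfolding Fl2 using c by (auto intro: exI[of _ 0])
  next
    case (Suc k)
    then show ?thesis unfolding Fl2 using gJ gb BF.binary_in_polys[OF gb] by auto
  qed
  have G2: "G0 \<in> Fl 2" "G1 \<in> Fl 2" using bin G by blast+
  have prime: "primeideal (Fl k) (poly_ring ?n)" for k unfolding Fl_def by (rule R.primeideal_kernel)
  interpret prime_flag ?n Fl 2 J'
  proof (rule prime_flag.intro)
    fix k assume k: "k < ?n"
    have "Fl k \<subseteq> Fl (Suc k)"
    proof
      fix f assume f: "f \<in> Fl k"
      then obtain g where "f = (\<Sum>j<k. R.lf (q j) * g j)"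
        unfolding Fl_def using R.pullback_proj_eq_0_iff[OF dk] k by auto
      then have "f = (\<Sum>j<Suc k. R.lf (q j) * (g(k := 0)) j)" by simp
      then have "\<exists>h. f = (\<Sum>j<Suc k. R.lf (q j) * h j)" by (rule exI[of _ "g(k := 0)"])
      then have "R.pullback (R.proj (Suc k) q v) f = 0"
        unfolding R.pullback_proj_eq_0_iff[OF dk[OF Suc_leI[OF k]]] .
      then show "f \<in> Fl (Suc k)" using f by (simp add: Fl_def)
    qed
    moreover have "R.lf (q k) \<in> Fl (Suc k) - Fl k"
    proof -
      have lin: "linear_form (q k)" and vk: "v k \<in> H" "q k (v k) = 1" and z: "\<And>j. j < k \<Longrightarrow> q k (v j) = 0"
        using qv(1) k by (simp_all add: R.dual_system_def)
      have "R.lf (q k) \<noteq> 0" using R.lf_eq_0D[OF lin _ vk(1)] vk(2) by auto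
      moreover have "R.pullback (R.proj k q v) (R.lf (q k)) = R.lf (q k)"
        using R.pullback_proj_lf[OF dk lin] z k by simp
      moreover have "R.lf (q k) = (\<Sum>j<Suc k. R.lf (q j) * (if j = k then 1 else 0))" by simp
      then have "\<exists>h. R.lf (q k) = (\<Sum>j<Suc k. R.lf (q j) * h j)" by (rule exI[of _ "\<lambda>j. if j = k then 1 else 0"])
      then have "R.pullback (R.proj (Suc k) q v) (R.lf (q k)) = 0"
        unfolding R.pullback_proj_eq_0_iff[OF dk[OF Suc_leI[OF k]]] .
      ultimately show ?thesis by (simp add: Fl_def)
    qed
    ultimately show "Fl k \<subset> Fl (Suc k)" by blast
  next
    show "primeideal (Fl k) (poly_ring ?n)" if "k \<le> ?n" for k by (rule prime)
    show "ideal J' (poly_ring ?n)" by (rule J'_ideal)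
    have "ideal (Fl 2) (poly_ring ?n)" using prime[of 2] unfolding primeideal_poly_ring_iff by blast
    then show "J' \<subseteq> Fl 2" using G2 unfolding J' ideal_poly_ring_iff by blast
    fix P assume P: "primeideal P (poly_ring ?n)" "J' \<subseteq> P"
    then have Pid: "P \<subseteq> polys ?n" "\<And>f g. f \<in> P \<Longrightarrow> g \<in> P \<Longrightarrow> f + g \<in> P" "\<And>f r. f \<in> P \<Longrightarrow> r \<in> polys ?n \<Longrightarrow> r * f \<in> P"
      and Pp: "1 \<notin> P" "\<And>f g. f \<in> polys ?n \<Longrightarrow> g \<in> polys ?n \<Longrightarrow> f * g \<in> P \<Longrightarrow> f \<in> P \<or> g \<in> P"
      unfolding primeideal_poly_ring_iff ideal_poly_ring_iff by blast+
    have ex: "\<exists>Z\<in>AH - {Y}. ry Z \<in> P" if Y: "Y \<in> AH" for Y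
    proof (rule ccontr)
      assume none: "\<not> ?thesis"
      have pow: "ry Z ^ k \<notin> P" if "Z \<in> AH - {Y}" for Z k
      proof (induction k)
        case (Suc k)
        then show ?case using Pp(2)[of "ry Z" "ry Z ^ k"] none that by auto
      qed (use Pp(1) in simp)
      have "pw T \<notin> P" if "finite T" "T \<subseteq> AH - {Y}" for T
        using that
      proof (induction T)
        case (insert Z T)
        then have "ry Z ^ mu Z \<notin> P" using pow by blast
        moreover have "pw (insert Z T) = ry Z ^ mu Z * pw T" unfolding pw_def using insert.hyps by simp
        ultimately show ?case using insert Pp(2)[of "ry Z ^ mu Z" "pw T"] by auto
      qed (use Pp(1) in \<open>simp add: pw_def\<close>)
      then have "pw (AH - {Y}) \<notin> P" using R.finite_A by blast
      then show False using pw_in_J'[OF Y] P(2) by blast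
    qed
    obtain Z where Z: "Z \<in> AH" "ry Z \<in> P" using ex[OF Y1] by blast
    obtain Z' where Z': "Z' \<in> AH" "Z' \<noteq> Z" "ry Z' \<in> P" using ex[OF Z(1)] by blast
    define D where "D = ca Z * cb Z' - ca Z' * cb Z"
    have D: "D \<noteq> 0" unfolding D_def using det_nonzero[OF Z(1) Z'(1)] Z'(2) by blast
    have inv: "f \<in> P" if "const D * f \<in> P" for f
    proof -
      have "const (inverse D) * (const D * f) \<in> P" by (rule Pid(3)[OF that]) simp
      also have "const (inverse D) * (const D * f) = (const D * const (inverse D)) * f" by (simp only: mult_ac)
      finally show ?thesis by (simp only: const_mult_inverse[OF D] mult_1)
    qed
    have "const D * x = const (cb Z') * ry Z + const (- cb Z) * ry Z'"
      unfolding ry_eq[OF Z(1)] ry_eq[OF Z'(1)] D_def by (simp add: const_diff const_mult const_minus algebra_simps)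
    then have xP: "x \<in> P" using Pid(2)[OF Pid(3)[OF Z(2)] Pid(3)[OF Z'(3)]] inv polys_const by metis
    have "const D * y = const (- ca Z') * ry Z + const (ca Z) * ry Z'"
      unfolding ry_eq[OF Z(1)] ry_eq[OF Z'(1)] D_def by (simp add: const_diff const_mult const_minus algebra_simps)
    then have yP: "y \<in> P" using Pid(2)[OF Pid(3)[OF Z(2)] Pid(3)[OF Z'(3)]] inv polys_const by metis
    show "Fl 2 \<subseteq> P"
    proof
      fix f assume "f \<in> Fl 2"
      then obtain g h where f: "f \<in> polys ?n" "f = x * g + y * h" unfolding Fl2 by blast
      have "f = trunc ?n (x * g + y * h)" using f trunc_id by metis
      also have "\<dots> = trunc ?n g * x + trunc ?n h * y" by (simp add: trunc_add trunc_mult trunc_id mult.commute)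
      finally show "f \<in> P" using Pid(2)[OF Pid(3)[OF xP] Pid(3)[OF yP]] trunc_in_polys by metis
    qed
  qed (rule n)
  interpret PR: cring "poly_ring ?n :: 'a mpoly ring" by (rule cring_poly_ring)
  have sub: "{G0, G1} \<subseteq> carrier (poly_ring ?n)" using Gp by simp
  have "J' = Idl\<^bsub>poly_ring ?n\<^esub> {G0, G1}"
  proof
    have "ideal (Idl\<^bsub>poly_ring ?n\<^esub> {G0, G1}) (poly_ring ?n)" by (rule PR.genideal_ideal[OF sub])
    moreover have "G0 \<in> Idl\<^bsub>poly_ring ?n\<^esub> {G0, G1}" "G1 \<in> Idl\<^bsub>poly_ring ?n\<^esub> {G0, G1}"
      using PR.genideal_self[OF sub] by blast+
    ultimately show "J' \<subseteq> Idl\<^bsub>poly_ring ?n\<^esub> {G0, G1}" unfolding J' ideal_poly_ring_iff by blast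
    show "Idl\<^bsub>poly_ring ?n\<^esub> {G0, G1} \<subseteq> J'" by (rule PR.genideal_minimal[OF J'_ideal]) (use G in simp)
  qed
  then have "complete_intersection ?n J'"
    unfolding complete_intersection_def using Gp krull_dim_quotient
    by (intro exI[of _ 2] exI[of _ "[G0, G1]"]) simp
  then show ?thesis using height_eq by simp
qed

end

section \<open>Dimensions of hyperplanes and flats\<close>

context arr_space
begin

lemma dim_kernel:
  assumes U: "subspace U" "U \<subseteq> span E" "finite E" and q: "linear_form q" "w \<in> U" "q w \<noteq> 0"
  shows "dim {x \<in> U. q x = 0} + 1 = dim U"
proof -
  let ?K = "{x \<in> U. q x = 0}"
  have K: "subspace ?K"
    using U(1) q(1) by (auto simp: subspace_def linear_form_simps)
  obtain B where B: "B \<subseteq> ?K" "independent B" "?K \<subseteq> span B" "card B = dim ?K" by (rule basis_exists)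
  have "finite B" using independent_span_bound[OF U(3) B(2)] B(1) U(2) by blast
  have "span B \<subseteq> ?K" by (rule span_minimal[OF B(1) K])
  then have w: "w \<notin> span B" using q(3) by blast
  then have wB: "w \<notin> B" using span_base by blast
  have ind: "independent (insert w B)" by (rule independent_insertI[OF w B(2)])
  have "U \<subseteq> span (insert w B)"
  proof
    fix x assume x: "x \<in> U"
    let ?c = "q x * inverse (q w)"
    have "x - ?c *s w \<in> ?K"
      using x q U(1) by (simp add: subspace_diff subspace_scale linear_form_simps)
    then have "x - ?c *s w \<in> span B" using B(3) by blast
    then show "x \<in> span (insert w B)" using span_breakdown_eq by blast
  qed
  moreover have "insert w B \<subseteq> U" using B(1) q(2) by blast
  ultimately have "card (insert w B) = dim U" using basis_card_eq_dim ind by blast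
  then show ?thesis using B(4) \<open>finite B\<close> wB by simp
qed

text \<open>A basis of \<open>L\<close> together with one vector outside \<open>L\<close> is a basis
  of the space; the form is the coordinate of that vector.\<close>

lemma hyperplane_form:
  assumes E: "independent E" "finite E" "span E = UNIV" and L: "subspace L" "dim L + 1 = dim (UNIV :: 'b set)"
  shows "\<exists>a u. linear_form a \<and> a u = 1 \<and> L = {w. a w = 0}"
proof -
  interpret fd: finite_dimensional_vector_space scale E by unfold_locales (use E in auto)
  interpret K: vector_space "(*) :: 'a \<Rightarrow> 'a \<Rightarrow> 'a" by unfold_locales (simp_all add: algebra_simps)
  interpret pr: vector_space_pair scale "(*) :: 'a \<Rightarrow> 'a \<Rightarrow> 'a" ..
  obtain B where B: "B \<subseteq> L" "independent B" "L \<subseteq> span B" "card B = dim L" by (rule basis_exists)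
  have LB: "L = span B" using B(3) span_minimal[OF B(1) L(1)] by blast
  have "L \<noteq> UNIV" using L(2) by auto
  then obtain v where v: "v \<notin> L" by blast
  have ind: "independent (insert v B)" by (rule independent_insertI) (use v LB B(2) in auto)
  have finB: "finite B" using fd.finiteI_independent[OF B(2)] .
  have "v \<notin> B" using v B(1) by blast
  then have "card (insert v B) = dim (UNIV :: 'b set)" using finB B(4) L(2) by simp
  then have span: "UNIV \<subseteq> span (insert v B)" using fd.card_ge_dim_independent[OF subset_UNIV ind] by simp
  obtain a where a: "Vector_Spaces.linear scale (*) a" "\<forall>x\<in>insert v B. a x = (if x = v then 1 else 0)"
    using pr.linear_independent_extend[OF ind, of "\<lambda>x. if x = v then 1 else 0"] by blast
  have lin: "linear_form a" using a(1) by (simp add: linear_form_def)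
  have sub: "subspace {w. a w = 0}" by (auto simp: subspace_def linear_form_simps[OF lin] lin)
  have "B \<subseteq> {w. a w = 0}" using a(2) \<open>v \<notin> B\<close> by auto
  then have 1: "L \<subseteq> {w. a w = 0}" unfolding LB by (rule span_minimal[OF _ sub])
  have "w \<in> L" if "a w = 0" for w
  proof -
    obtain c where c: "w - c *s v \<in> span B" using span span_breakdown_eq[of w v B] by blast
    then have "a (w - c *s v) = 0" using 1 LB by blast
    then have "c = 0" using that a(2) by (simp add: linear_form_simps[OF lin])
    then show ?thesis using c LB by simp
  qed
  then have "L = {w. a w = 0}" using 1 by blast
  moreover have "a v = 1" using a(2) by simp
  ultimately show ?thesis using lin by blast
qed

end

lemma (in based_arrangement) subspace_hyperplane:
  assumes "L \<in> A" shows "subspace L"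
proof -
  have "subspace {w \<in> W. df L w = 0}"
    using subspace_W df_linear[OF assms] by (auto simp: subspace_def linear_form_simps)
  then show ?thesis unfolding df_kernel[OF assms] .
qed

context arr_restriction
begin

lemma dim_restricted:
  assumes "Y \<in> AH" shows "dim Y + 1 = dim H"
proof -
  obtain v where v: "v \<in> H" "R.df Y v = 1" using R.df_normal[OF assms] .
  have "dim {w \<in> H. R.df Y w = 0} + 1 = dim H"
    by (rule dim_kernel[of H "set b"]) (use R.subspace_W R.span_e R.df_linear[OF assms] v in auto)
  then show ?thesis unfolding R.df_kernel[OF assms] .
qed

lemma dim_restricted_Int:
  assumes "Y \<in> AH" "Z \<in> AH" "Y \<noteq> Z" shows "dim (Y \<inter> Z) + 2 = dim H"
proof -
  obtain v where v: "v \<in> Y" "v \<notin> Z" using R.hyperplane_subset_eq[OF assms(1,2)] assms(3) by blast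
  have YH: "Y \<subseteq> H" by (rule R.hyperplane_subset[OF assms(1)])
  have sub: "subspace Y" by (rule R.subspace_hyperplane[OF assms(1)])
  have "dim {w \<in> Y. R.df Z w = 0} + 1 = dim Y"
    by (rule dim_kernel[of Y "set b"])
      (use sub YH R.span_e R.df_linear[OF assms(2)] v R.df_eq_0_iff[OF assms(2)] in auto)
  moreover have "{w \<in> Y. R.df Z w = 0} = Y \<inter> Z" using YH R.df_kernel[OF assms(2)] by blast
  ultimately show ?thesis using dim_restricted[OF assms(1)] by simp
qed

lemma subspace_flat:
  assumes "X \<in> flats H AH" shows "subspace X"
proof -
  obtain C where C: "C \<subseteq> AH" "X = H \<inter> \<Inter>C" using assms unfolding flats_def by blast
  then have "subspace Y" if "Y \<in> C" for Y using R.subspace_hyperplane that by blast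
  then show ?thesis unfolding C(2) by (intro subspace_inter subspace_Inter R.subspace_W) auto
qed

text \<open>Any \<open>Y\<close> of the family and any member \<open>Z\<close> not containing
  \<open>Y\<close> already cut out a subspace that contains \<open>X\<close> and has the same
  dimension.\<close>

lemma codim_two_flat:
  assumes X: "X \<in> flats H AH" "dim X + 2 = dim H"
  shows "\<exists>Y\<in>AH. \<exists>Z\<in>AH. Y \<noteq> Z \<and> X = Y \<inter> Z"
proof -
  interpret fd: finite_dimensional_vector_space scale "set e"
    by unfold_locales (use indep_e span_e in auto)
  obtain C where C: "C \<subseteq> AH" "X = H \<inter> \<Inter>C" using X(1) unfolding flats_def by blast
  have "X \<noteq> H" using X(2) by auto
  then obtain Y where Y: "Y \<in> C" using C(2) by blast
  then have YA: "Y \<in> AH" using C(1) by blast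
  have "X \<noteq> Y" using X(2) dim_restricted[OF YA] by auto
  then obtain Z where Z: "Z \<in> C" "\<not> Y \<subseteq> Z" using C(2) Y R.hyperplane_subset[OF YA] by blast
  then have ZA: "Z \<in> AH" and YZ: "Y \<noteq> Z" using C(1) by blast+
  have "X \<subseteq> Y \<inter> Z" using C(2) Y Z by blast
  moreover have "subspace (Y \<inter> Z)"
  proof (rule subspace_flat)
    have "Y \<inter> Z = H \<inter> \<Inter>{Y, Z}" using R.hyperplane_subset[OF YA] by auto
    then show "Y \<inter> Z \<in> flats H AH" unfolding flats_def using YA ZA by blast
  qed
  moreover have "dim (Y \<inter> Z) \<le> dim X" using dim_restricted_Int[OF YA ZA YZ] X(2) by simp
  ultimately have "X = Y \<inter> Z" using fd.subspace_dim_equal[OF subspace_flat[OF X(1)]] by blast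
  then show ?thesis using YA ZA YZ by blast
qed

text \<open>The other arguments start from some \<open>Y\<close>. For an empty restriction \<beta>
  is the empty product, so the residue ideal contains 1.\<close>

lemma J_empty:
  assumes "AH = {}" shows "J = polys (length b)"
proof -
  have "\<beta> = 1" unfolding \<beta>_def assms by simp
  then have "1 \<in> J" using \<beta>_in_J by simp
  then have "f \<in> J" if "f \<in> polys (length b)" for f using J_mult[OF \<open>1 \<in> J\<close> that] by simp
  then show ?thesis by (auto simp: J_def)
qed

end

section \<open>The residue ideal of a free arrangement\<close>

theorem corollary5p4:
  fixes scale :: "'k::field \<Rightarrow> 'v::ab_group_add \<Rightarrow> 'v"
    and e b :: "'v list" and A :: "'v set set" and H :: "'v set"
  assumes "vector_space scale"
    and "arr_space.ordered_basis scale e UNIV"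
    and "arr_space.arrangement scale UNIV A"
    and "H \<in> A"
    and "arr_space.ordered_basis scale b H"
    and "arr_space.free_arrangement scale e A"
    and "arr_space.free_arrangement scale b (arr_restrict A H)"
  shows "arr_space.residue_ideal scale e b A H =
           carrier (poly_ring (length b)) \<inter>
           (\<Inter>X \<in> arr_space.Xi3 scale e b A H.
              arr_space.residue_ideal scale e b (arr_localize A X) H) \<and>
         (\<forall>X \<in> arr_space.Xi3 scale e b A H.
            complete_intersection (length b)
              (arr_space.residue_ideal scale e b (arr_localize A X) H) \<and>
            ideal_height (poly_ring (length b))
              (arr_space.residue_ideal scale e b (arr_localize A X) H) = 2)"
proof -
  interpret arr_space scale by (rule arr_space.intro[OF assms(1)])
  interpret based_space scale e UNIV by unfold_locales (rule assms(2))
  have arr: "subspace L" "dim L + 1 = dim (UNIV :: 'v set)" if "L \<in> A" for L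
    using assms(3) that unfolding arrangement_def by blast+
  interpret based_arrangement scale e UNIV A
  proof unfold_locales
    show "finite A" using assms(3) unfolding arrangement_def by blast
    show "\<exists>a u. linear_form a \<and> u \<in> UNIV \<and> a u = 1 \<and> L = {w \<in> UNIV. a w = 0}" if "L \<in> A" for L
      using hyperplane_form[OF indep_e _ span_e arr[OF that]] by simp
  qed
  interpret arr_restriction scale e A b H by unfold_locales (rule assms(4,5))+
  have dim_e: "dim (UNIV :: 'v set) = length e"
    using dim_span_eq_card_independent[OF indep_e] distinct_card[OF distinct_e] span_e by simp
  have dim_H: "dim H + 1 = length e" using arr(2)[OF assms(4)] dim_e by simp
  have dim_b: "dim H = length b"
    using dim_span_eq_card_independent[OF R.indep_e] distinct_card[OF R.distinct_e] R.span_e by simp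
  \<comment> \<open>Dimension \<open>length e - 3\<close> is codimension two in H, so these flats
    are the intersections of two different members of \<open>AH\<close>.\<close>
  have Xi3_iff: "X \<in> Xi3 e b A H \<longleftrightarrow> (\<exists>Y\<in>AH. \<exists>Z\<in>AH. Y \<noteq> Z \<and> X = Y \<inter> Z) \<and>
      residue_ideal e b (arr_localize A X) H \<noteq> polys (length b)" for X
  proof -
    have "X \<in> flats H AH \<and> int (dim X) = int (length e) - 3 \<longleftrightarrow> (\<exists>Y\<in>AH. \<exists>Z\<in>AH. Y \<noteq> Z \<and> X = Y \<inter> Z)"
    proof
      assume "X \<in> flats H AH \<and> int (dim X) = int (length e) - 3"
      then show "\<exists>Y\<in>AH. \<exists>Z\<in>AH. Y \<noteq> Z \<and> X = Y \<inter> Z" using dim_H by (intro codim_two_flat) auto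
    next
      assume "\<exists>Y\<in>AH. \<exists>Z\<in>AH. Y \<noteq> Z \<and> X = Y \<inter> Z"
      then obtain Y Z where YZ: "Y \<in> AH" "Z \<in> AH" "Y \<noteq> Z" "X = Y \<inter> Z" by blast
      have "X = H \<inter> \<Inter>{Y, Z}" using R.hyperplane_subset[OF YZ(1)] YZ(4) by auto
      then have "X \<in> flats H AH" unfolding flats_def using YZ by blast
      then show "X \<in> flats H AH \<and> int (dim X) = int (length e) - 3"
        using dim_restricted_Int[OF YZ(1-3)] YZ(4) dim_H by auto
    qed
    then show ?thesis unfolding Xi3_def Xi_def by auto
  qed
  have localize: "J \<subseteq> residue_ideal e b (arr_localize A X) H \<and> residue_ideal e b (arr_localize A X) H \<subseteq> polys (length b)"
    if X: "X \<in> Xi3 e b A H" for X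
  proof -
    obtain Y Z where YZ: "Y \<in> AH" "Z \<in> AH" "X = Y \<inter> Z" using X unfolding Xi3_iff by blast
    interpret L: arr_localization scale e A b H X
      by unfold_locales (use YZ R.hyperplane_subset[OF YZ(1)] in blast)
    show ?thesis using L.J_subset_localize unfolding L.B.residue_ideal_eq L.B.J_def by auto
  qed
  have eq: "J = polys (length b) \<inter> (\<Inter>X\<in>Xi3 e b A H. residue_ideal e b (arr_localize A X) H)"
  proof
    show "J \<subseteq> polys (length b) \<inter> (\<Inter>X\<in>Xi3 e b A H. residue_ideal e b (arr_localize A X) H)"
      using localize by (auto simp: J_def)
    show "polys (length b) \<inter> (\<Inter>X\<in>Xi3 e b A H. residue_ideal e b (arr_localize A X) H) \<subseteq> J"
    proof
      fix g assume g: "g \<in> polys (length b) \<inter> (\<Inter>X\<in>Xi3 e b A H. residue_ideal e b (arr_localize A X) H)"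
      show "g \<in> J"
      proof (cases "AH = {}")
        case True
        then show ?thesis using J_empty g by simp
      next
        case False
        then obtain Y0 where "Y0 \<in> AH" by blast
        then show ?thesis
        proof (rule inter_localize_subset[OF assms(6,7)])
          show "g \<in> polys (length b)" using g by blast
          fix Y Z assume YZ: "Y \<in> AH" "Z \<in> AH" "Y \<noteq> Z"
          \<comment> \<open>At an intersection outside \<open>Xi3\<close> the local residue ideal is
            the whole ring.\<close>
          show "g \<in> residue_ideal e b (arr_localize A (Y \<inter> Z)) H"
          proof (cases "Y \<inter> Z \<in> Xi3 e b A H")
            case True
            then show ?thesis using g by blast
          next
            case False
            then have "residue_ideal e b (arr_localize A (Y \<inter> Z)) H = polys (length b)"
              unfolding Xi3_iff using YZ by blast
            then show ?thesis using g by blast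
          qed
        qed
      qed
    qed
  qed
  have ci: "complete_intersection (length b) (residue_ideal e b (arr_localize A X) H) \<and>
      ideal_height (poly_ring (length b)) (residue_ideal e b (arr_localize A X) H) = 2"
    if X: "X \<in> Xi3 e b A H" for X
  proof -
    obtain Y Z where YZ: "Y \<in> AH" "Z \<in> AH" "Y \<noteq> Z" "X = Y \<inter> Z"
      and proper: "residue_ideal e b (arr_localize A X) H \<noteq> polys (length b)" using X unfolding Xi3_iff by blast
    interpret L: arr_localization scale e A b H X
      by unfold_locales (use YZ R.hyperplane_subset[OF YZ(1)] in blast)
    have BH: "Y \<in> L.BH" "Z \<in> L.BH" using YZ L.BH_iff by auto
    interpret T: rank_two scale e L.B b H Y Z
      by unfold_locales (use BH YZ L.BH_iff in auto)
    \<comment> \<open>The rank two description concerns \<open>J'\<close> of the localization;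
      freeness of \<open>A\<close> identifies it with the residue ideal.\<close>
    have "L.B.J' = L.B.J" using L.localize_J'_subset[OF assms(6) YZ(1)] L.B.J_subset_J'[OF BH(1)] by blast
    then have res: "residue_ideal e b (arr_localize A X) H = L.B.J'" unfolding L.B.residue_ideal_eq by simp
    have "2 \<le> length b" using dim_restricted_Int[OF YZ(1-3)] dim_b by simp
    then show ?thesis using T.rank_two_complete_intersection proper unfolding res by blast
  qed
  show ?thesis using eq ci unfolding residue_ideal_eq by simp
qed

end
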